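(* Let $(\mathbf u,p)$ be a solution of the Stokes interface problem $$\begin{cases} -\nabla\cdot\boldsymbol\sigma(\mathbf u,p;\mu)=\mathbf f & \text{in } \Omega_B\cup\Omega_F,\\ \nabla\cdot\mathbf u=0 & \text{in } \Omega_B\cup\Omega_F,\\ [\![\mathbf u]\!]=\mathbf 0 & \text{on } \Gamma,\\ [\![\boldsymbol\sigma(\mathbf u,p;\mu)\mathbf n]\!]=\gamma\kappa\mathbf n & \text{on } \Gamma,\\ \mathbf u=\mathbf g_D & \text{on } \Gamma_D,\\ \boldsymbol\sigma(\mathbf u,p;\mu)\mathbf n=\mathbf g_N & \text{on } \Gamma_N, \end{cases}$$ and let $(\mathbf u_0,p_0)$ be a solution of the droplet-free Stokes problem with uniform viscosity $\mu_F$, $$\begin{cases} -\nabla\cdot\boldsymbol\sigma(\mathbf u_0,p_0;\mu_F)=\mathbf f & \text{in } \Omega,\\ \nabla\cdot\mathbf u_0=0 & \text{in } \Omega,\\ \mathbf u_0=\mathbf g_D & \text{on } \Gamma_D,\\ \boldsymbol\sigma(\mathbf u_0,p_0;\mu_F)\mathbf n=\mathbf g_N & \text{on } \Gamma_N. \end{cases}$$ Then the error fields $\mathbf v^{(0)}:=\mathbf u-\mathbf u_0$ and $q^{(0)}:=p-p_0$ satisfy $$\begin{cases} -\nabla\cdot\boldsymbol\sigma(\mathbf v^{(0)},q^{(0)};\mu)=2(\mu-\mu_F)\nabla\cdot\boldsymbol\varepsilon(\mathbf u_0) & \text{in }\Omega_B\cup\Omega_F,\\ \nabla\cdot\mathbf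 v^{(0)}=0 & \text{in }\Omega_B\cup\Omega_F,\\ [\![\mathbf v^{(0)}]\!]=\mathbf 0 & \text{on }\Gamma,\\ [\![\boldsymbol\sigma(\mathbf v^{(0)},q^{(0)};\mu)\mathbf n]\!]=\left(\gamma\kappa\,\mathrm I-2[\![\mu]\!]\,\boldsymbol\varepsilon(\mathbf u_0)|_{\Omega_B}\right)\mathbf n & \text{on }\Gamma,\\ \mathbf v^{(0)}=\mathbf 0 & \text{on }\Gamma_D,\\ \boldsymbol\sigma(\mathbf v^{(0)},q^{(0)};\mu)\mathbf n=\mathbf 0 & \text{on }\Gamma_N. \end{cases}$$
   Context: Geometry: $\Omega\subset\mathbb R^d$, $d\in\{2,3\}$, is a bounded Lipschitz domain; $\Omega_B$ is an open set with $\overline{\Omega_B}\subset\Omega$, consisting of $M\ge1$ connected components (the droplets), each bounded by a smooth interface; $\Omega_F=\Omega\setminus\overline{\Omega_B}$ is the surrounding fluid region; $\Gamma=\partial\Omega_B$ is the union of all interfaces, so that $\Omega\setminus\Gamma=\Omega_B\cup\Omega_F$. The outer boundary is split as $\Gamma_D\subset\partial\Omega$ and $\Gamma_N=\partial\Omega\setminus\Gamma_D$. The unit normal $\mathbf n$ on $\Gamma$ points towards $\Omega_F$, and on $\partial\Omega$ it points outwards. Coefficients: $\mu:\Omega\to\mathbb R_{>0}$ is a viscosity field that is constant on each droplet (possibly with different constants on different droplets) and satisfies $\mu|_{\Omega_F}\equiv\mu_F$ for a constant $\mu_F>0$. The surface tension coefficient $\gamma$ is constant on each connected component of $\Gamma$,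 and $\kappa:\Gamma\to\mathbb R$ is the mean curvature. Notation: $\boldsymbol\varepsilon(\mathbf u)=\frac12(\nabla\mathbf u+\nabla\mathbf u^\top)$ is the symmetric gradient, $\mathrm I$ is the identity tensor, and $\boldsymbol\sigma(\mathbf u,p;\mu)=2\mu\,\boldsymbol\varepsilon(\mathbf u)-p\,\mathrm I$ is the stress tensor. The jump across $\Gamma$ is $[\![w]\!]:=w|_{\Omega_F}-w|_{\Omega_B}$ (traces on $\Gamma$ from the two sides); in particular $[\![\mu]\!]=\mu_F-\mu|_{\Omega_B}$. The symbol $\boldsymbol\varepsilon(\mathbf u_0)|_{\Omega_B}$ on $\Gamma$ denotes the trace taken from the $\Omega_B$ side. Data: $\mathbf f\in[H^{-1}(\Omega)]^d$, $\mathbf g_D\in[H^{1/2}(\Gamma_D)]^d$, $\mathbf g_N\in[H^{-1/2}(\Gamma_N)]^d$. Solutions are sought in $[H^1(\Omega)]^d\times L^2(\Omega)$; equations are understood in the sense of distributions on the indicated open sets and boundary/interface conditions in the sense of traces (normal-stress traces are assumed to be meaningful). The solution $(\mathbf u_0,p_0)$ of the droplet-free problem is known to satisfy $[\![\mathbf u_0]\!]=\mathbf 0$ and $[\![\boldsymbol\sigma(\mathbf u_0,p_0;\mu_F)\mathbf n]\!]=\mathbf 0$ on $\Gamma$; this may be used as a standing fact. *)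

theory Defs
  imports "HOL-Analysis.Analysis"
begin

section \<open>Surface measure\<close>

text \<open>Hausdorff measure of integer dimension \<open>s > 0\<close>, normalised so that it is the usual surface
  measure on Lipschitz hypersurfaces.  (Covering sets may be empty, so \<open>s = 0\<close> is excluded.)\<close>

definition hausdorff_content :: "nat \<Rightarrow> real \<Rightarrow> 'a::metric_space set \<Rightarrow> ennreal" where
  "hausdorff_content s \<delta> A =
     (INF E \<in> {E :: nat \<Rightarrow> 'a set. A \<subseteq> (\<Union>i. E i) \<and> (\<forall>i. bounded (E i) \<and> diameter (E i) \<le> \<delta>)}.
        \<Sum>i. ennreal (unit_ball_vol (real s) * (diameter (E i) / 2) ^ s))"

definition hausdorff_outer :: "nat \<Rightarrow> 'a::metric_space set \<Rightarrow> ennreal" where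
  "hausdorff_outer s A = (SUP \<delta> \<in> {0<..}. hausdorff_content s \<delta> A)"

definition hausdorff_measure :: "nat \<Rightarrow> 'a::metric_space measure" where
  "hausdorff_measure s = measure_of UNIV (sets borel) (hausdorff_outer s)"

abbreviation surface_measure :: "(real^'n::finite) measure" where
  "surface_measure \<equiv> hausdorff_measure (CARD('n) - 1)"

text \<open>The Hausdorff outer measure is a metric outer measure, so that \<^term>\<open>hausdorff_measure s\<close> is its
  restriction to the Borel sets.\<close>

lemma hausdorff_content_empty: "0 < s \<Longrightarrow> 0 \<le> \<delta> \<Longrightarrow> hausdorff_content s \<delta> {} = 0"
proof -
  assume "0 < s" "0 \<le> \<delta>"
  then have "hausdorff_content s \<delta> {} \<le> (\<Sum>i::nat. ennreal (unit_ball_vol (real s) * (diameter ({}::'a set) / 2) ^ s))"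
    unfolding hausdorff_content_def by (intro INF_lower2[where i="\<lambda>_. {}"]) auto
  with \<open>0 < s\<close> show ?thesis by (simp add: power_0_left)
qed

lemma hausdorff_content_mono: "A \<subseteq> B \<Longrightarrow> hausdorff_content s \<delta> A \<le> hausdorff_content s \<delta> B"
  unfolding hausdorff_content_def by (rule INF_superset_mono) auto

lemma hausdorff_content_antimono: "\<delta> \<le> \<epsilon> \<Longrightarrow> hausdorff_content s \<epsilon> A \<le> hausdorff_content s \<delta> A"
  unfolding hausdorff_content_def by (rule INF_superset_mono) (auto intro: order_trans)

lemma hausdorff_content_countably_subadditive:
  fixes A :: "nat \<Rightarrow> 'a::metric_space set"
  shows "hausdorff_content s \<delta> (\<Union>i. A i) \<le> (\<Sum>i. hausdorff_content s \<delta> (A i))"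
proof (rule ennreal_le_epsilon)
  fix e :: real assume e: "0 < e" and fin: "(\<Sum>i. hausdorff_content s \<delta> (A i)) < top"
  define w where "w X = ennreal (unit_ball_vol (real s) * (diameter X / 2) ^ s)" for X :: "'a set"
  have "\<exists>E. A n \<subseteq> (\<Union>i. E i) \<and> (\<forall>i::nat. bounded (E i) \<and> diameter (E i) \<le> \<delta>) \<and>
      (\<Sum>i. w (E i)) \<le> hausdorff_content s \<delta> (A n) + ennreal (e * (1/2)^Suc n)" for n
  proof -
    have "hausdorff_content s \<delta> (A n) \<le> (\<Sum>i. hausdorff_content s \<delta> (A i))"
      using sum_le_suminf[of "\<lambda>i. hausdorff_content s \<delta> (A i)" "{n}"] by simp
    then have "hausdorff_content s \<delta> (A n) \<noteq> top" using fin by auto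
    then have "hausdorff_content s \<delta> (A n) < hausdorff_content s \<delta> (A n) + ennreal (e * (1/2)^Suc n)"
      using e by (simp add: ennreal_less_top less_top)
    then show ?thesis
      unfolding hausdorff_content_def[of s \<delta> "A n"] INF_less_iff w_def
      by (auto intro: less_imp_le simp del: power_Suc)
  qed
  then obtain E where E: "\<And>n. A n \<subseteq> (\<Union>i. E n i)" "\<And>n i. bounded (E n i) \<and> diameter (E n i) \<le> \<delta>"
      "\<And>n. (\<Sum>i::nat. w (E n i)) \<le> hausdorff_content s \<delta> (A n) + ennreal (e * (1/2)^Suc n)"
    by metis
  define D where "D k = case_prod E (prod_decode k)" for k
  have "(\<Union>i. A i) \<subseteq> (\<Union>k. D k)"
  proof
    fix x assume "x \<in> (\<Union>i. A i)"
    then obtain n i where "x \<in> E n i" using E(1) by blast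
    then have "x \<in> D (prod_encode (n, i))" by (simp add: D_def)
    then show "x \<in> (\<Union>k. D k)" by blast
  qed
  moreover have "bounded (D k) \<and> diameter (D k) \<le> \<delta>" for k
    using E(2) by (simp add: D_def split: prod.split)
  ultimately have "hausdorff_content s \<delta> (\<Union>i. A i) \<le> (\<Sum>k. w (D k))"
    unfolding hausdorff_content_def w_def by (intro INF_lower) auto
  also have "\<dots> = (\<Sum>n. \<Sum>i. w (E n i))"
    unfolding D_def
    using suminf_ennreal_2dimen[of "\<lambda>n. \<Sum>i. w (E n i)" "\<lambda>p. w (case_prod E p)"]
    by (simp add: comp_def)
  also have "\<dots> \<le> (\<Sum>n. hausdorff_content s \<delta> (A n) + ennreal (e * (1/2)^Suc n))"
    by (intro suminf_le E(3) summableI)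
  also have "\<dots> = (\<Sum>n. hausdorff_content s \<delta> (A n)) + (\<Sum>n. ennreal (e * (1/2)^Suc n))"
    by (intro suminf_add[symmetric] summableI)
  also have "(\<Sum>n. ennreal (e * (1/2)^Suc n)) = ennreal e"
  proof -
    have "(\<lambda>n. e * (1/2)^Suc n) sums (e * 1)"
      by (intro sums_mult power_half_series)
    then show ?thesis using e by (intro suminf_ennreal_eq) auto
  qed
  finally show "hausdorff_content s \<delta> (\<Union>i. A i) \<le> (\<Sum>i. hausdorff_content s \<delta> (A i)) + ennreal e" .
qed

lemma hausdorff_outer_mono: "A \<subseteq> B \<Longrightarrow> hausdorff_outer s A \<le> hausdorff_outer s B"
  unfolding hausdorff_outer_def by (intro SUP_mono' hausdorff_content_mono)

lemma outer_measure_space_hausdorff_outer: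
  assumes "0 < s"
  shows "outer_measure_space UNIV (hausdorff_outer s :: 'a::metric_space set \<Rightarrow> ennreal)"
  unfolding outer_measure_space_def
proof (intro conjI)
  show "positive UNIV (hausdorff_outer s :: 'a set \<Rightarrow> ennreal)"
    using assms by (auto simp: positive_def hausdorff_outer_def hausdorff_content_empty)
  show "increasing UNIV (hausdorff_outer s :: 'a set \<Rightarrow> ennreal)"
    by (auto simp: increasing_def hausdorff_outer_mono)
  show "countably_subadditive UNIV (hausdorff_outer s :: 'a set \<Rightarrow> ennreal)"
    unfolding countably_subadditive_def
  proof (intro allI impI)
    fix A :: "nat \<Rightarrow> 'a set"
    have "hausdorff_content s \<delta> (\<Union>i. A i) \<le> (\<Sum>i. hausdorff_outer s (A i))" if "0 < \<delta>" for \<delta>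
    proof (rule order_trans[OF hausdorff_content_countably_subadditive suminf_le])
      show "hausdorff_content s \<delta> (A n) \<le> hausdorff_outer s (A n)" for n
        using that unfolding hausdorff_outer_def by (intro SUP_upper) auto
    qed (auto intro: summableI)
    then show "hausdorff_outer s (\<Union>i. A i) \<le> (\<Sum>i. hausdorff_outer s (A i))"
      unfolding hausdorff_outer_def[of s "\<Union>i. A i"] by (intro SUP_least) auto
  qed
qed

lemma hausdorff_outer_Un:
  assumes "0 < s" shows "hausdorff_outer s (A \<union> B) \<le> hausdorff_outer s A + hausdorff_outer s B"
proof -
  interpret sigma_algebra UNIV "UNIV :: 'a set set" using sigma_algebra_Pow[of UNIV] by simp
  have "subadditive UNIV (hausdorff_outer s :: 'a set \<Rightarrow> ennreal)" if "A \<inter> B = {}" for A B :: "'a set"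
    using outer_measure_space_hausdorff_outer[OF assms, where 'a='a] countably_subadditive_subadditive
    unfolding outer_measure_space_def by blast
  then have "hausdorff_outer s (A \<union> (B - A)) \<le> hausdorff_outer s A + hausdorff_outer s (B - A)"
    by (subst (asm) subadditive_def) blast
  also have "\<dots> \<le> hausdorff_outer s A + hausdorff_outer s B"
    by (intro add_left_mono hausdorff_outer_mono) auto
  finally show ?thesis by simp
qed

lemma hausdorff_content_separated:
  fixes A B :: "'a::metric_space set"
  assumes "0 < s" "0 < \<delta>" and sep: "\<And>x y. x \<in> A \<Longrightarrow> y \<in> B \<Longrightarrow> \<delta> < dist x y"
  shows "hausdorff_content s \<delta> A + hausdorff_content s \<delta> B \<le> hausdorff_content s \<delta> (A \<union> B)"
  unfolding hausdorff_content_def[of s \<delta> "A \<union> B"]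
proof (rule INF_greatest)
  fix E :: "nat \<Rightarrow> 'a set"
  assume "E \<in> {E. A \<union> B \<subseteq> (\<Union>i. E i) \<and> (\<forall>i. bounded (E i) \<and> diameter (E i) \<le> \<delta>)}"
  then have E: "A \<union> B \<subseteq> (\<Union>i. E i)" "\<And>i. bounded (E i)" "\<And>i. diameter (E i) \<le> \<delta>" by auto
  define w where "w X = ennreal (unit_ball_vol (real s) * (diameter X / 2) ^ s)" for X :: "'a set"
  define EA where "EA i = (if E i \<inter> A = {} then {} else E i)" for i
  define EB where "EB i = (if E i \<inter> B = {} then {} else E i)" for i
  have "hausdorff_content s \<delta> A \<le> (\<Sum>i. w (EA i))"
    unfolding hausdorff_content_def w_def using E \<open>0 < \<delta>\<close>
    by (intro INF_lower) (simp add: EA_def, blast)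
  moreover have "hausdorff_content s \<delta> B \<le> (\<Sum>i. w (EB i))"
    unfolding hausdorff_content_def w_def using E \<open>0 < \<delta>\<close>
    by (intro INF_lower) (simp add: EB_def, blast)
  ultimately have "hausdorff_content s \<delta> A + hausdorff_content s \<delta> B \<le> (\<Sum>i. w (EA i)) + (\<Sum>i. w (EB i))"
    by (rule add_mono)
  also have "\<dots> = (\<Sum>i. w (EA i) + w (EB i))"
    by (intro suminf_add summableI)
  also have "\<dots> \<le> (\<Sum>i. w (E i))"
  proof (intro suminf_le summableI)
    fix i
    have "E i \<inter> A = {} \<or> E i \<inter> B = {}"
    proof (rule ccontr)
      assume "\<not> ?thesis"
      then obtain x y where "x \<in> E i" "x \<in> A" "y \<in> E i" "y \<in> B" by blast
      then have "\<delta> < dist x y" "dist x y \<le> diameter (E i)"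
        using sep E(2) diameter_bounded_bound by blast+
      then show False using E(3)[of i] by linarith
    qed
    moreover have "w {} = 0" using \<open>0 < s\<close> by (simp add: w_def)
    ultimately show "w (EA i) + w (EB i) \<le> w (E i)" by (auto simp: EA_def EB_def)
  qed
  finally show "hausdorff_content s \<delta> A + hausdorff_content s \<delta> B
      \<le> (\<Sum>i. ennreal (unit_ball_vol (real s) * (diameter (E i) / 2) ^ s))"
    by (simp add: w_def)
qed

lemma hausdorff_outer_separated:
  fixes A B :: "'a::metric_space set"
  assumes "0 < s" "0 < \<epsilon>" and sep: "\<And>x y. x \<in> A \<Longrightarrow> y \<in> B \<Longrightarrow> \<epsilon> \<le> dist x y"
  shows "hausdorff_outer s A + hausdorff_outer s B \<le> hausdorff_outer s (A \<union> B)"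
proof -
  have *: "hausdorff_content s a A + hausdorff_content s b B \<le> hausdorff_outer s (A \<union> B)"
    if "0 < a" "0 < b" for a b
  proof -
    define d where "d = min (min a b) (\<epsilon> / 2)"
    have d: "0 < d" "d < \<epsilon>" "d \<le> a" "d \<le> b" using that assms(2) by (auto simp: d_def)
    have "hausdorff_content s a A + hausdorff_content s b B \<le> hausdorff_content s d A + hausdorff_content s d B"
      using d by (intro add_mono hausdorff_content_antimono)
    also have "\<dots> \<le> hausdorff_content s d (A \<union> B)"
      using d sep by (intro hausdorff_content_separated assms(1)) (auto intro: less_le_trans)
    also have "\<dots> \<le> hausdorff_outer s (A \<union> B)"
      unfolding hausdorff_outer_def using d by (intro SUP_upper) auto
    finally show ?thesis .
  qed
  have "hausdorff_outer s A + hausdorff_outer s B =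
      (SUP a\<in>{0<..}. hausdorff_content s a A + hausdorff_outer s B)"
    unfolding hausdorff_outer_def[of s A] by (subst ennreal_SUP_add_left) auto
  also have "\<dots> = (SUP a\<in>{0<..}. SUP b\<in>{0<..}. hausdorff_content s a A + hausdorff_content s b B)"
    unfolding hausdorff_outer_def[of s B]
    by (intro SUP_cong refl ennreal_SUP_add_right) auto
  also have "\<dots> \<le> hausdorff_outer s (A \<union> B)"
    using * by (intro SUP_least) auto
  finally show ?thesis .
qed

lemma closed_in_lambda_system_hausdorff:
  fixes C :: "'a::metric_space set"
  assumes "0 < s" "closed C"
  shows "C \<in> lambda_system UNIV UNIV (hausdorff_outer s)"
proof (cases "C = {}")
  case True
  have "hausdorff_outer s ({} :: 'a set) = 0"
    using outer_measure_space_hausdorff_outer[OF assms(1), where 'a='a]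
    by (simp add: outer_measure_space_def positive_def)
  then show ?thesis using True by (simp add: lambda_system_def)
next
  case False
  let ?H = "hausdorff_outer s :: 'a set \<Rightarrow> ennreal"
  have le: "?H (X \<inter> C) + ?H (X - C) \<le> ?H X" for X
  proof (cases "?H X = top")
    case fin: False
    define r where "r n = 1 / real (Suc n)" for n
    have r: "0 < r n" "r (Suc n) < r n" for n by (auto simp: r_def field_simps)
    have r_mono: "r n \<le> r m" if "m \<le> n" for m n using that by (simp add: r_def field_simps)
    define D where "D n = {x \<in> X. r n \<le> infdist x C}" for n
    define R where "R n = {x \<in> X. r (Suc n) \<le> infdist x C \<and> infdist x C < r n}" for n
    have far: "r n \<le> dist x y" if "x \<in> D n" "y \<in> C" for n x y
      using that infdist_le[of y C x] by (auto simp: D_def)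
    have one: "?H (X \<inter> C) + ?H (D n) \<le> ?H X" for n
    proof -
      have "?H (X \<inter> C) + ?H (D n) \<le> ?H (X \<inter> C \<union> D n)"
        using far r(1) by (intro hausdorff_outer_separated[OF assms(1), of "r n"])
           (auto, metis dist_commute)
      also have "\<dots> \<le> ?H X" by (intro hausdorff_outer_mono) (auto simp: D_def)
      finally show ?thesis .
    qed
    have sep: "r m - r n \<le> dist x y" if "r m \<le> infdist x C" "infdist y C \<le> r n" for m n x y
      using that infdist_triangle[of x C y] by linarith
    have sums: "(\<Sum>i<n. ?H (R (2 * i + j))) \<le> ?H (\<Union>i<n. R (2 * i + j))" for n j
    proof (induction n)
      case (Suc n)
      have "(\<Sum>i<Suc n. ?H (R (2 * i + j))) \<le> ?H (\<Union>i<n. R (2 * i + j)) + ?H (R (2 * n + j))"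
        using Suc by (simp add: add_right_mono)
      also have "\<dots> \<le> ?H ((\<Union>i<n. R (2 * i + j)) \<union> R (2 * n + j))"
      proof (rule hausdorff_outer_separated[OF assms(1)])
        show "0 < (if n = 0 then 1 else r (2 * n + j - 1) - r (2 * n + j))"
          using r(2)[of "2 * n + j - 1"] by auto
        fix x y assume x: "x \<in> (\<Union>i<n. R (2 * i + j))" and y: "y \<in> R (2 * n + j)"
        then obtain i where i: "i < n" "x \<in> R (2 * i + j)" by blast
        have "r (2 * n + j - 1) \<le> infdist x C"
        proof -
          have "Suc (2 * i + j) \<le> 2 * n + j - 1" using i by linarith
          then have "r (2 * n + j - 1) \<le> r (Suc (2 * i + j))" by (rule r_mono)
          then show ?thesis using i by (auto simp: R_def)
        qed
        then show "(if n = 0 then 1 else r (2 * n + j - 1) - r (2 * n + j)) \<le> dist x y"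
          using i y sep by (auto simp: R_def)
      qed
      also have "(\<Union>i<n. R (2 * i + j)) \<union> R (2 * n + j) = (\<Union>i<Suc n. R (2 * i + j))"
        by (auto simp: less_Suc_eq)
      finally show ?case .
    qed simp
    have bound: "(\<Sum>i<n. ?H (R i)) \<le> 2 * ?H X" for n
    proof -
      have "(\<Sum>i<n. ?H (R i)) \<le> (\<Sum>i<2 * n. ?H (R i))"
        by (intro sum_mono2) auto
      also have "\<dots> = (\<Sum>i<n. ?H (R (2 * i + 0))) + (\<Sum>i<n. ?H (R (2 * i + 1)))"
        by (induction n) (simp_all add: algebra_simps)
      also have "\<dots> \<le> ?H X + ?H X"
        by (intro add_mono order_trans[OF sums] hausdorff_outer_mono) (auto simp: R_def)
      finally show ?thesis by (simp add: mult_2)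
    qed
    then have "(\<Sum>i. ?H (R i)) \<le> 2 * ?H X"
      by (intro suminf_le_const summableI)
    then have "(\<Sum>i. ?H (R i)) \<noteq> top"
      using fin by (auto simp: ennreal_mult_eq_top_iff top_unique)
    have cover: "X - C \<subseteq> D n \<union> (\<Union>i. R (i + n))" for n
    proof
      fix x assume x: "x \<in> X - C"
      then have pos: "0 < infdist x C"
        using assms(2) False by (metis DiffD2 in_closed_iff_infdist_zero infdist_nonneg less_eq_real_def)
      then obtain k where k: "r k \<le> infdist x C"
        using reals_Archimedean[of "infdist x C"] unfolding r_def inverse_eq_divide
        by (meson less_imp_le)
      show "x \<in> D n \<union> (\<Union>i. R (i + n))"
      proof (cases "r n \<le> infdist x C")
        case True then show ?thesis using x by (auto simp: D_def)
      next
        case False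
        define m where "m = (LEAST m. r m \<le> infdist x C)"
        have m: "r m \<le> infdist x C" unfolding m_def using k by (rule LeastI)
        have "n < m" using False m r_mono by (meson not_le order_trans)
        then obtain i where i: "m = Suc (i + n)" using less_imp_Suc_add by (metis add.commute)
        have "\<not> r (i + n) \<le> infdist x C"
          using not_less_Least[of "i + n" "\<lambda>m. r m \<le> infdist x C"] i by (simp add: m_def[symmetric])
        then have "x \<in> R (i + n)" using m x i by (auto simp: R_def)
        then show ?thesis by blast
      qed
    qed
    have tail: "?H (X \<inter> C) + ?H (X - C) \<le> ?H X + (\<Sum>i. ?H (R (i + n)))" for n
    proof -
      have "?H (X - C) \<le> ?H (D n) + ?H (\<Union>i. R (i + n))"
        using hausdorff_outer_mono[OF cover] hausdorff_outer_Un[OF assms(1)] by (rule order_trans)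
      also have "\<dots> \<le> ?H (D n) + (\<Sum>i. ?H (R (i + n)))"
      proof (rule add_left_mono)
        have "hausdorff_content s \<delta> (\<Union>i. R (i + n)) \<le> (\<Sum>i. ?H (R (i + n)))" if "0 < \<delta>" for \<delta>
          by (rule order_trans[OF hausdorff_content_countably_subadditive])
             (use that in \<open>auto intro!: suminf_le summableI SUP_upper simp: hausdorff_outer_def\<close>)
        then show "?H (\<Union>i. R (i + n)) \<le> (\<Sum>i. ?H (R (i + n)))"
          unfolding hausdorff_outer_def[of s "\<Union>i. R (i + n)"] by (intro SUP_least) auto
      qed
      finally have "?H (X \<inter> C) + ?H (X - C) \<le> ?H (X \<inter> C) + (?H (D n) + (\<Sum>i. ?H (R (i + n))))"
        by (rule add_left_mono)
      also have "\<dots> \<le> ?H X + (\<Sum>i. ?H (R (i + n)))"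
        using add_right_mono[OF one] by (simp add: add.assoc)
      finally show ?thesis .
    qed
    have "(\<lambda>n. \<Sum>i. ?H (R (i + n))) \<longlonglongrightarrow> 0"
    proof -
      have eq: "?H (R i) = ennreal (enn2real (?H (R i)))" for i
      proof -
        have "?H (R i) \<le> ?H X" by (intro hausdorff_outer_mono) (auto simp: R_def)
        then show ?thesis using fin by (simp add: top.not_eq_extremum less_top)
      qed
      have sm: "summable (\<lambda>i. enn2real (?H (R i)))"
        using \<open>(\<Sum>i. ?H (R i)) \<noteq> top\<close> eq
        by (intro summable_suminf_not_top) auto
      have "(\<Sum>i. ?H (R (i + n))) = ennreal (\<Sum>i. enn2real (?H (R (i + n))))" for n
        by (subst eq, subst suminf_ennreal2) (auto intro!: summable_ignore_initial_segment[OF sm])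
      moreover have "(\<lambda>n. \<Sum>i. enn2real (?H (R (i + n)))) \<longlonglongrightarrow> 0"
        using suminf_exist_split2[OF sm] .
      ultimately show ?thesis using tendsto_ennrealI by fastforce
    qed
    then have "(\<lambda>n. ?H X + (\<Sum>i. ?H (R (i + n)))) \<longlonglongrightarrow> ?H X + 0"
      by (intro tendsto_add tendsto_const)
    then show ?thesis
      using tail by (intro LIMSEQ_le_const[where a="?H (X \<inter> C) + ?H (X - C)"]) auto
  qed simp
  have "?H (C \<inter> X) + ?H ((UNIV - C) \<inter> X) = ?H X" for X
  proof -
    have "C \<inter> X = X \<inter> C" "(UNIV - C) \<inter> X = X - C" "X \<inter> C \<union> (X - C) = X" by auto
    then show ?thesis
      using le[of X] hausdorff_outer_Un[OF assms(1), of "X \<inter> C" "X - C"] by (metis antisym)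
  qed
  then show ?thesis by (simp add: lambda_system_def)
qed

lemma space_hausdorff_measure [simp]: "space (hausdorff_measure s) = UNIV"
  by (simp add: hausdorff_measure_def)

lemma sets_hausdorff_measure [simp, measurable_cong]: "sets (hausdorff_measure s) = sets borel"
  using sets.sigma_sets_eq[of borel] by (simp add: hausdorff_measure_def)

theorem emeasure_hausdorff_measure:
  fixes A :: "'a::metric_space set"
  assumes "0 < s" "A \<in> sets borel"
  shows "emeasure (hausdorff_measure s) A = hausdorff_outer s A"
proof -
  let ?H = "hausdorff_outer s :: 'a set \<Rightarrow> ennreal"
  let ?L = "lambda_system UNIV UNIV ?H"
  interpret sigma_algebra UNIV "UNIV :: 'a set set" using sigma_algebra_Pow[of UNIV] by simp
  have L: "measure_space UNIV ?L ?H"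
    by (rule caratheodory_lemma[OF outer_measure_space_hausdorff_outer[OF assms(1)]])
  have "sets (borel :: 'a measure) = sigma_sets UNIV (Collect closed)"
    by (simp add: borel_eq_closed)
  also have "\<dots> \<subseteq> ?L"
    using L closed_in_lambda_system_hausdorff[OF assms(1)]
    by (intro sigma_algebra.sigma_sets_subset) (auto simp: measure_space_def)
  finally have "measure_space UNIV (sets (borel :: 'a measure)) ?H"
    using sets.sigma_algebra_axioms[of "borel :: 'a measure"] by (intro measure_down[OF L]) simp_all
  then show ?thesis
    using assms(2) sets.sigma_algebra_axioms[of "borel :: 'a measure"]
    unfolding hausdorff_measure_def
    by (intro emeasure_measure_of_sigma) (auto simp: measure_space_def)
qed


section \<open>Smooth functions and domains\<close>

primrec C_k :: "nat \<Rightarrow> ('a::euclidean_space \<Rightarrow> 'b::real_normed_vector) \<Rightarrow> bool" where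
  "C_k 0 f \<longleftrightarrow> continuous_on UNIV f"
| "C_k (Suc k) f \<longleftrightarrow>
     (\<exists>f'. (\<forall>x. (f has_derivative f' x) (at x)) \<and> (\<forall>h. C_k k (\<lambda>x. f' x h)))"

definition smooth :: "('a::euclidean_space \<Rightarrow> 'b::real_normed_vector) \<Rightarrow> bool" where
  "smooth f \<longleftrightarrow> (\<forall>k. C_k k f)"

definition grad :: "(real^'n::finite \<Rightarrow> real) \<Rightarrow> real^'n \<Rightarrow> real^'n" where
  "grad \<eta> x = (\<chi> j. frechet_derivative \<eta> (at x) (axis j 1))"

definition jacobian :: "(real^'n::finite \<Rightarrow> real^'n) \<Rightarrow> real^'n \<Rightarrow> real^'n^'n" where
  "jacobian \<phi> x = matrix (frechet_derivative \<phi> (at x))"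

text \<open>In suitable orthonormal coordinates \<open>U\<close> is locally the region strictly below the graph of a
  Lipschitz function \<open>\<zeta>\<close> of the components orthogonal to the unit vector \<open>e\<close>.\<close>

definition lipschitz_boundary :: "'a::euclidean_space set \<Rightarrow> bool" where
  "lipschitz_boundary U \<longleftrightarrow>
     (\<forall>x \<in> frontier U. \<exists>e \<zeta> L r. norm e = 1 \<and> r > 0 \<and> L-lipschitz_on UNIV \<zeta> \<and>
        (\<forall>y \<in> ball x r. y \<in> U \<longleftrightarrow> y \<bullet> e < \<zeta> (y - (y \<bullet> e) *\<^sub>R e)))"

text \<open>\<open>\<rho>\<close> is a smooth local defining function of \<open>U\<close> at the boundary point \<open>x\<close>, negative inside.\<close>

definition defining_function :: "(real^'n::finite) set \<Rightarrow> real^'n \<Rightarrow> (real^'n \<Rightarrow> real) \<Rightarrow> bool" where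
  "defining_function U x \<rho> \<longleftrightarrow>
     smooth \<rho> \<and> grad \<rho> x \<noteq> 0 \<and> (\<exists>r>0. \<forall>y \<in> ball x r. y \<in> U \<longleftrightarrow> \<rho> y < 0)"

definition smooth_boundary :: "(real^'n::finite) set \<Rightarrow> bool" where
  "smooth_boundary U \<longleftrightarrow> (\<forall>x \<in> frontier U. \<exists>\<rho>. defining_function U x \<rho>)"

definition unit_grad :: "(real^'n::finite \<Rightarrow> real) \<Rightarrow> real^'n \<Rightarrow> real^'n" where
  "unit_grad \<rho> x = grad \<rho> x /\<^sub>R norm (grad \<rho> x)"

text \<open>The outward unit normal \<open>\<nabla>\<rho> / |\<nabla>\<rho>|\<close> and the mean curvature \<open>\<nabla> \<cdot> (\<nabla>\<rho> / |\<nabla>\<rho>|)\<close> on the boundary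
  of a smooth set; neither depends on the choice of the defining function \<open>\<rho>\<close>.  The mean curvature
  is the sum of the principal curvatures (not their average), positive for balls: with this
  normalisation a jump \<open>\<gamma> \<kappa> n\<close> of the normal stress is the Young--Laplace law.\<close>

definition unit_normal :: "(real^'n::finite) set \<Rightarrow> real^'n \<Rightarrow> real^'n" where
  "unit_normal U x = (THE \<nu>. \<exists>\<rho>. defining_function U x \<rho> \<and> \<nu> = unit_grad \<rho> x)"

definition mean_curvature :: "(real^'n::finite) set \<Rightarrow> real^'n \<Rightarrow> real" where
  "mean_curvature U x =
     (THE k. \<exists>\<rho>. defining_function U x \<rho> \<and> k = trace (jacobian (unit_grad \<rho>) x))"


section \<open>Distributions and Sobolev spaces\<close>

definition test_functions :: "'a::euclidean_space set \<Rightarrow> ('a \<Rightarrow> 'b::real_normed_vector) set" where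
  "test_functions U =
     {\<phi>. smooth \<phi> \<and> compact (closure {x. \<phi> x \<noteq> 0}) \<and> closure {x. \<phi> x \<noteq> 0} \<subseteq> U}"

definition square_integrable_on ::
    "'a measure \<Rightarrow> 'a set \<Rightarrow> ('a \<Rightarrow> 'b::{second_countable_topology, real_normed_vector}) \<Rightarrow> bool" where
  "square_integrable_on M U f \<longleftrightarrow>
     set_borel_measurable M U f \<and> (\<integral>\<^sup>+x\<in>U. ennreal ((norm (f x))\<^sup>2) \<partial>M) < \<infinity>"

abbreviation L2 :: "'a::euclidean_space set \<Rightarrow> ('a \<Rightarrow> 'b::euclidean_space) \<Rightarrow> bool" where
  "L2 U f \<equiv> square_integrable_on lebesgue U f"

text \<open>Vector fields have type \<open>real^'n \<Rightarrow> real^'n\<close>; a gradient \<open>Du\<close> has the entries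
  \<open>Du x $ i $ j = \<partial>\<^sub>j u\<^sub>i\<close>, and the inner product of two matrices is the Frobenius product.
  Weak gradients are unique only up to null sets, so they are introduced by a relation:
  \<open>H1 U u Du\<close> says that \<open>u\<close> is in \<open>H\<^sup>1(U)\<close> with weak gradient \<open>Du\<close>.\<close>

definition has_weak_gradient ::
    "(real^'n::finite) set \<Rightarrow> (real^'n \<Rightarrow> real^'n) \<Rightarrow> (real^'n \<Rightarrow> real^'n^'n) \<Rightarrow> bool" where
  "has_weak_gradient U u Du \<longleftrightarrow>
     (\<forall>\<eta> \<in> test_functions U. \<forall>i j.
        (LINT x:U|lebesgue. u x $ i * grad \<eta> x $ j) = - (LINT x:U|lebesgue. Du x $ i $ j * \<eta> x))"

definition H1 :: "(real^'n::finite) set \<Rightarrow> (real^'n \<Rightarrow> real^'n) \<Rightarrow> (real^'n \<Rightarrow> real^'n^'n) \<Rightarrow> bool" where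
  "H1 U u Du \<longleftrightarrow> L2 U u \<and> L2 U Du \<and> has_weak_gradient U u Du"

definition H1_norm :: "(real^'n::finite) set \<Rightarrow> (real^'n \<Rightarrow> real^'n) \<Rightarrow> (real^'n \<Rightarrow> real^'n^'n) \<Rightarrow> real" where
  "H1_norm U u Du =
     sqrt ((LINT x:U|lebesgue. (norm (u x))\<^sup>2) + (LINT x:U|lebesgue. (norm (Du x))\<^sup>2))"

text \<open>Vector-valued distributions are functionals on test fields.  \<open>H\<^sup>-\<^sup>1(U)\<close> is the space of
  distributions that are bounded in the \<open>H\<^sup>1\<close> norm, i.e. extend to the dual of \<open>H\<^sup>1\<^sub>0(U)\<close>.\<close>

type_synonym 'n functional = "(real^'n \<Rightarrow> real^'n) \<Rightarrow> real"

definition H_minus_one :: "(real^'n::finite) set \<Rightarrow> 'n functional \<Rightarrow> bool" where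
  "H_minus_one U f \<longleftrightarrow>
     (\<forall>\<phi> \<in> test_functions U. \<forall>\<psi> \<in> test_functions U. f (\<lambda>x. \<phi> x + \<psi> x) = f \<phi> + f \<psi>) \<and>
     (\<forall>c. \<forall>\<phi> \<in> test_functions U. f (\<lambda>x. c *\<^sub>R \<phi> x) = c * f \<phi>) \<and>
     (\<exists>C. \<forall>\<phi> \<in> test_functions U. \<bar>f \<phi>\<bar> \<le> C * H1_norm U \<phi> (jacobian \<phi>))"

text \<open>The distributional (row-wise) divergence of a tensor field on \<open>U\<close>, the product of a
  distribution with a smooth (here: locally constant) function, and divergence-free fields.\<close>

definition distr_div :: "(real^'n::finite) set \<Rightarrow> (real^'n \<Rightarrow> real^'n^'n) \<Rightarrow> 'n functional" where
  "distr_div U \<tau> \<phi> = - (LINT x:U|lebesgue. \<tau> x \<bullet> jacobian \<phi> x)"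

definition distr_mult :: "(real^'n::finite \<Rightarrow> real) \<Rightarrow> 'n functional \<Rightarrow> 'n functional" where
  "distr_mult m T \<phi> = T (\<lambda>x. m x *\<^sub>R \<phi> x)"

definition div_free :: "(real^'n::finite) set \<Rightarrow> (real^'n \<Rightarrow> real^'n) \<Rightarrow> bool" where
  "div_free U u \<longleftrightarrow> (\<forall>\<eta> \<in> test_functions U. (LINT x:U|lebesgue. u x \<bullet> grad \<eta> x) = 0)"

definition has_weak_divergence ::
    "(real^'n::finite) set \<Rightarrow> (real^'n \<Rightarrow> real^'n^'n) \<Rightarrow> (real^'n \<Rightarrow> real^'n) \<Rightarrow> bool" where
  "has_weak_divergence U \<tau> d \<longleftrightarrow>
     (\<forall>\<phi> \<in> test_functions U. distr_div U \<tau> \<phi> = (LINT x:U|lebesgue. d x \<bullet> \<phi> x))"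


section \<open>Traces\<close>

text \<open>\<open>g\<close> is the trace on \<open>S \<subseteq> frontier U\<close> of the field \<open>u\<close> in \<open>H\<^sup>1(U)\<close>.  The trace operator is the
  continuous extension, from \<open>H\<^sup>1(U)\<close> to the square-integrable functions on the boundary, of the
  restriction of fields that are continuous up to the boundary.\<close>

definition has_trace ::
    "(real^'n::finite) set \<Rightarrow> (real^'n) set \<Rightarrow> (real^'n \<Rightarrow> real^'n) \<Rightarrow> (real^'n \<Rightarrow> real^'n^'n) \<Rightarrow>
     (real^'n \<Rightarrow> real^'n) \<Rightarrow> bool" where
  "has_trace U S u Du g \<longleftrightarrow>
     square_integrable_on surface_measure S g \<and>
     (\<exists>w Dw. (\<forall>k::nat. H1 U (w k) (Dw k) \<and> continuous_on (closure U) (w k)) \<and>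
        (\<lambda>k. \<integral>\<^sup>+x\<in>U. ennreal ((norm (w k x - u x))\<^sup>2) \<partial>lebesgue) \<longlonglongrightarrow> 0 \<and>
        (\<lambda>k. \<integral>\<^sup>+x\<in>U. ennreal ((norm (Dw k x - Du x))\<^sup>2) \<partial>lebesgue) \<longlonglongrightarrow> 0 \<and>
        (\<lambda>k. \<integral>\<^sup>+x\<in>S. ennreal ((norm (w k x - g x))\<^sup>2) \<partial>surface_measure) \<longlonglongrightarrow> 0)"

text \<open>\<open>H\<^sup>1\<^sup>/\<^sup>2(S)\<close> for \<open>S \<subseteq> frontier U\<close>.\<close>

definition H_half :: "(real^'n::finite) set \<Rightarrow> (real^'n) set \<Rightarrow> (real^'n \<Rightarrow> real^'n) set" where
  "H_half U S = {g. \<exists>u Du. H1 U u Du \<and> has_trace U S u Du g}"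

text \<open>\<open>\<phi>\<close> is a lifting to \<open>U\<close> of the boundary field \<open>\<psi>\<close> on \<open>S\<close>, with zero trace on the rest of the
  boundary.  The fields \<open>\<psi>\<close> having a lifting form the space of those elements of \<open>H\<^sup>1\<^sup>/\<^sup>2(S)\<close> whose
  extension by zero is in \<open>H\<^sup>1\<^sup>/\<^sup>2(frontier U)\<close>; its dual is \<open>H\<^sup>-\<^sup>1\<^sup>/\<^sup>2(S)\<close>.\<close>

definition is_lifting ::
    "(real^'n::finite) set \<Rightarrow> (real^'n) set \<Rightarrow> (real^'n \<Rightarrow> real^'n) \<Rightarrow>
     (real^'n \<Rightarrow> real^'n) \<Rightarrow> (real^'n \<Rightarrow> real^'n^'n) \<Rightarrow> bool" where
  "is_lifting U S \<psi> \<phi> D\<phi> \<longleftrightarrow>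
     H1 U \<phi> D\<phi> \<and> has_trace U S \<phi> D\<phi> \<psi> \<and> has_trace U (frontier U - S) \<phi> D\<phi> (\<lambda>_. 0)"

definition H_half0 :: "(real^'n::finite) set \<Rightarrow> (real^'n) set \<Rightarrow> (real^'n \<Rightarrow> real^'n) set" where
  "H_half0 U S = {\<psi>. \<exists>\<phi> D\<phi>. is_lifting U S \<psi> \<phi> D\<phi>}"

definition H_minus_half :: "(real^'n::finite) set \<Rightarrow> (real^'n) set \<Rightarrow> 'n functional \<Rightarrow> bool" where
  "H_minus_half U S l \<longleftrightarrow>
     (\<forall>\<psi> \<in> H_half0 U S. \<forall>\<psi>' \<in> H_half0 U S. l (\<lambda>x. \<psi> x + \<psi>' x) = l \<psi> + l \<psi>') \<and>
     (\<forall>c. \<forall>\<psi> \<in> H_half0 U S. l (\<lambda>x. c *\<^sub>R \<psi> x) = c * l \<psi>) \<and>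
     (\<exists>C. \<forall>\<psi> \<phi> D\<phi>. is_lifting U S \<psi> \<phi> D\<phi> \<longrightarrow> \<bar>l \<psi>\<bar> \<le> C * H1_norm U \<phi> D\<phi>)"

text \<open>The functional \<open>l\<close> is the normal trace \<open>\<tau> \<nu>\<close> on \<open>S \<subseteq> frontier U\<close> of the tensor field \<open>\<tau>\<close>, where
  \<open>\<nu>\<close> is the outward normal of \<open>U\<close>.  It is given by Green's formula
  \<open>\<langle>\<tau> \<nu>, \<psi>\<rangle> = \<integral> \<tau> : \<nabla>\<phi> + (\<nabla> \<cdot> \<tau>) \<cdot> \<phi>\<close> for liftings \<open>\<phi>\<close> of \<open>\<psi>\<close>.  For this to be meaningful, \<open>\<nabla> \<cdot> \<tau>\<close> must be
  square-integrable on a one-sided neighbourhood \<open>U \<inter> V\<close> of \<open>S\<close>; it suffices to consider liftings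
  that vanish outside a closed subset \<open>K\<close> of \<open>V\<close>, since other liftings can be cut off.\<close>

definition has_normal_trace ::
    "(real^'n::finite) set \<Rightarrow> (real^'n) set \<Rightarrow> (real^'n \<Rightarrow> real^'n^'n) \<Rightarrow> 'n functional \<Rightarrow> bool" where
  "has_normal_trace U S \<tau> l \<longleftrightarrow>
     (\<exists>V d. open V \<and> closure S \<subseteq> V \<and> L2 (U \<inter> V) \<tau> \<and> L2 (U \<inter> V) d \<and>
        has_weak_divergence (U \<inter> V) \<tau> d \<and>
        (\<forall>K \<psi> \<phi> D\<phi>. closed K \<and> K \<subseteq> V \<and> is_lifting U S \<psi> \<phi> D\<phi> \<and>
            (AE x in lebesgue. x \<in> U - K \<longrightarrow> \<phi> x = 0 \<and> D\<phi> x = 0) \<longrightarrow>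
          l \<psi> = (LINT x:U \<inter> V|lebesgue. \<tau> x \<bullet> D\<phi> x + d x \<bullet> \<phi> x)))"


section \<open>Jumps across an interface\<close>

text \<open>All jumps are the value from \<open>F\<close> minus the value from \<open>B\<close>, on \<open>\<Gamma> = frontier B\<close>.\<close>

definition trace_jump ::
    "(real^'n::finite) set \<Rightarrow> (real^'n) set \<Rightarrow> (real^'n \<Rightarrow> real^'n) \<Rightarrow> (real^'n \<Rightarrow> real^'n^'n) \<Rightarrow>
     (real^'n \<Rightarrow> real^'n) \<Rightarrow> bool" where
  "trace_jump F B u Du j \<longleftrightarrow>
     (\<exists>gF gB. has_trace F (frontier B) u Du gF \<and> has_trace B (frontier B) u Du gB \<and>
        (AE x in surface_measure. x \<in> frontier B \<longrightarrow> gF x - gB x = j x))"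

text \<open>The normal in the jump of the normal stress points from \<open>B\<close> to \<open>F\<close>.  It is the outward normal
  of \<open>B\<close> and the inward normal of \<open>F\<close>, hence the sign of \<open>lF\<close>.\<close>

definition normal_jump ::
    "(real^'n::finite) set \<Rightarrow> (real^'n) set \<Rightarrow> (real^'n \<Rightarrow> real^'n^'n) \<Rightarrow> 'n functional \<Rightarrow> bool" where
  "normal_jump F B \<tau> J \<longleftrightarrow>
     (\<exists>lF lB. has_normal_trace F (frontier B) \<tau> lF \<and> has_normal_trace B (frontier B) \<tau> lB \<and>
        (\<forall>\<psi> \<in> H_half B (frontier B). - lF \<psi> - lB \<psi> = J \<psi>))"

definition jump ::
    "(real^'n::finite) set \<Rightarrow> (real^'n) set \<Rightarrow> (real^'n \<Rightarrow> real) \<Rightarrow> real^'n \<Rightarrow> real" where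
  "jump F B w x = Lim (at x within F) w - Lim (at x within B) w"

text \<open>The functional \<open>\<psi> \<mapsto> \<integral>\<^sub>\<Gamma> \<gamma> \<kappa> n \<cdot> \<psi>\<close> given by the surface tension force \<open>\<gamma> \<kappa> n\<close>.\<close>

definition surface_tension :: "(real^'n::finite) set \<Rightarrow> (real^'n \<Rightarrow> real) \<Rightarrow> 'n functional" where
  "surface_tension B \<gamma> \<psi> =
     (LINT x:frontier B|surface_measure.
        (\<gamma> x * mean_curvature B x) *\<^sub>R unit_normal B x \<bullet> \<psi> x)"


section \<open>The Stokes problems\<close>

definition sym_grad :: "(real^'n::finite \<Rightarrow> real^'n^'n) \<Rightarrow> real^'n \<Rightarrow> real^'n^'n" where
  "sym_grad Du x = (1/2) *\<^sub>R (Du x + transpose (Du x))"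

definition stress ::
    "(real^'n::finite \<Rightarrow> real) \<Rightarrow> (real^'n \<Rightarrow> real^'n^'n) \<Rightarrow> (real^'n \<Rightarrow> real) \<Rightarrow> real^'n \<Rightarrow> real^'n^'n" where
  "stress \<mu> Du p x = (2 * \<mu> x) *\<^sub>R sym_grad Du x - p x *\<^sub>R mat 1"

text \<open>The system on \<open>\<Omega>\<close> with interface \<open>frontier B\<close>, bulk force \<open>f\<close>, jump \<open>J\<close> of the normal stress and
  boundary data \<open>gD\<close>, \<open>gN\<close>.  The Neumann part of the boundary is \<open>frontier \<Omega> - \<Gamma>D\<close>.\<close>

definition stokes_interface_problem ::
    "(real^'n::finite) set \<Rightarrow> (real^'n) set \<Rightarrow> (real^'n) set \<Rightarrow> (real^'n \<Rightarrow> real) \<Rightarrow>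
     'n functional \<Rightarrow> 'n functional \<Rightarrow> (real^'n \<Rightarrow> real^'n) \<Rightarrow> 'n functional \<Rightarrow>
     (real^'n \<Rightarrow> real^'n) \<Rightarrow> (real^'n \<Rightarrow> real^'n^'n) \<Rightarrow> (real^'n \<Rightarrow> real) \<Rightarrow> bool" where
  "stokes_interface_problem \<Omega> B \<Gamma>D \<mu> f J gD gN u Du p \<longleftrightarrow>
     (let F = \<Omega> - closure B in
      H1 \<Omega> u Du \<and> L2 \<Omega> p \<and>
      (\<forall>\<phi> \<in> test_functions (B \<union> F). - distr_div (B \<union> F) (stress \<mu> Du p) \<phi> = f \<phi>) \<and>
      div_free (B \<union> F) u \<and>
      trace_jump F B u Du (\<lambda>_. 0) \<and>
      normal_jump F B (stress \<mu> Du p) J \<and>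
      has_trace \<Omega> \<Gamma>D u Du gD \<and>
      has_normal_trace F (frontier \<Omega> - \<Gamma>D) (stress \<mu> Du p) gN)"

definition stokes_problem ::
    "(real^'n::finite) set \<Rightarrow> (real^'n) set \<Rightarrow> real \<Rightarrow>
     'n functional \<Rightarrow> (real^'n \<Rightarrow> real^'n) \<Rightarrow> 'n functional \<Rightarrow>
     (real^'n \<Rightarrow> real^'n) \<Rightarrow> (real^'n \<Rightarrow> real^'n^'n) \<Rightarrow> (real^'n \<Rightarrow> real) \<Rightarrow> bool" where
  "stokes_problem \<Omega> \<Gamma>D \<mu>0 f gD gN u Du p \<longleftrightarrow>
     H1 \<Omega> u Du \<and> L2 \<Omega> p \<and>
     (\<forall>\<phi> \<in> test_functions \<Omega>. - distr_div \<Omega> (stress (\<lambda>_. \<mu>0) Du p) \<phi> = f \<phi>) \<and>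
     div_free \<Omega> u \<and>
     has_trace \<Omega> \<Gamma>D u Du gD \<and>
     has_normal_trace \<Omega> (frontier \<Omega> - \<Gamma>D) (stress (\<lambda>_. \<mu>0) Du p) gN"

end

theory Submission
  imports Defs
begin

text \<open>
  The error fields solve the difference of the two problems, and all operators are linear in the
  velocity and the pressure, except that the viscosities differ.  Hence everything follows from the
  identity \<open>\<sigma>(v, q; \<mu>) = \<sigma>(u, p; \<mu>) - \<sigma>(u\<^sub>0, p\<^sub>0; \<mu>F) - 2 (\<mu> - \<mu>F) \<epsilon>(u\<^sub>0)\<close> (lemma \<open>stress_diff\<close>) and from the
  behaviour of its last term, whose coefficient is zero in the fluid and locally constant in the
  droplets.

  In the bulk, a locally constant factor commutes with the distributional divergence, because it can
  be moved onto the test function (\<open>distr_div_locally_constant_scaleR\<close>).  The forces \<open>f\<close> cancel, since test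
  functions on \<open>\<Omega>B \<union> \<Omega>F\<close> are test functions on \<open>\<Omega>\<close>.

  On the interface, the last term contributes only to the normal trace from the side of the droplets.
  There the factor has to be continued to the boundary.  A droplet is connected near each boundary
  point (\<open>smooth_boundary_locally_connected\<close>), so that the factor is locally constant on \<open>closure \<Omega>B\<close> when it
  is given the values of the jump of \<open>\<mu>\<close> on the interface (\<open>jump_extension_locally_constant\<close>).  In Green's
  formula it can then be moved onto the liftings (\<open>has_normal_trace_locally_constant_scaleR\<close>), which
  yields the term with \<open>\<epsilon>(u\<^sub>0)\<close> taken from the droplets.  Normal traces can be subtracted because
  they can be computed on a common neighbourhood, and traces because approximating sequences can
  (\<open>has_normal_trace_add_scaleR\<close>, \<open>has_trace_diff\<close>).  For traces from the fluid it is also used that a smooth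
  set lies locally on one side of its boundary, so that the interface belongs to \<open>closure \<Omega>F\<close>.

  On the outer boundary the Dirichlet data cancel.  The Neumann condition needs more care, as the
  normal traces are taken from \<open>\<Omega>F\<close> in one problem and from \<open>\<Omega>\<close> in the other.  They agree, because
  the droplets keep a positive distance from \<open>frontier \<Omega>\<close> and smooth cutoffs turn liftings to \<open>\<Omega>F\<close> that
  vanish near the droplets into liftings to \<open>\<Omega>\<close> (\<open>has_normal_trace_away_from_compact\<close>, \<open>cutoff_exists\<close>).
\<close>


section \<open>Square-integrable fields\<close>

lemma set_borel_measurable_scaleR:
  fixes f :: "'a \<Rightarrow> 'b::{second_countable_topology, real_normed_vector}"
  assumes "set_borel_measurable M U m" "set_borel_measurable M U f"
  shows "set_borel_measurable M U (\<lambda>x. m x *\<^sub>R f x)"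
proof -
  have "(\<lambda>x. (indicator U x *\<^sub>R m x :: real) *\<^sub>R (indicator U x *\<^sub>R f x)) \<in> borel_measurable M"
    using assms unfolding set_borel_measurable_def by (rule borel_measurable_scaleR)
  also have "(\<lambda>x. (indicator U x *\<^sub>R m x :: real) *\<^sub>R (indicator U x *\<^sub>R f x)) =
      (\<lambda>x. indicator U x *\<^sub>R (m x *\<^sub>R f x))"
    by (auto simp: indicator_def)
  finally show ?thesis unfolding set_borel_measurable_def .
qed

lemma set_borel_measurable_add:
  fixes f :: "'a \<Rightarrow> 'b::{second_countable_topology, real_normed_vector}"
  assumes "set_borel_measurable M U f" "set_borel_measurable M U g"
  shows "set_borel_measurable M U (\<lambda>x. f x + g x)"
  using borel_measurable_add[OF assms[unfolded set_borel_measurable_def]]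
  by (simp add: set_borel_measurable_def scaleR_add_right)

lemma set_borel_measurable_diff:
  fixes f :: "'a \<Rightarrow> 'b::{second_countable_topology, real_normed_vector}"
  assumes "set_borel_measurable M U f" "set_borel_measurable M U g"
  shows "set_borel_measurable M U (\<lambda>x. f x - g x)"
  using borel_measurable_diff[OF assms[unfolded set_borel_measurable_def]]
  by (simp add: set_borel_measurable_def scaleR_diff_right)

lemma set_borel_measurable_linear:
  fixes f :: "'a \<Rightarrow> 'b::{second_countable_topology, real_normed_vector}"
    and T :: "'b \<Rightarrow> 'c::{second_countable_topology, real_normed_vector}"
  assumes "set_borel_measurable M U f" "bounded_linear T"
  shows "set_borel_measurable M U (\<lambda>x. T (f x))"
proof -
  have "(\<lambda>x. T (indicat_real U x *\<^sub>R f x)) \<in> borel_measurable M"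
    using assms(1) unfolding set_borel_measurable_def
    by (rule measurable_compose) (rule borel_measurable_continuous_onI[OF linear_continuous_on[OF assms(2)]])
  then show ?thesis
    by (simp add: set_borel_measurable_def linear_scale[OF bounded_linear.linear[OF assms(2)]])
qed

lemma set_borel_measurable_cong:
  fixes f g :: "'a \<Rightarrow> 'b::{second_countable_topology, real_normed_vector}"
  assumes "\<And>x. x \<in> U \<Longrightarrow> f x = g x"
  shows "set_borel_measurable M U f \<longleftrightarrow> set_borel_measurable M U g"
proof -
  have "(\<lambda>x. indicat_real U x *\<^sub>R f x) = (\<lambda>x. indicat_real U x *\<^sub>R g x)"
    using assms by (auto simp: fun_eq_iff split: split_indicator)
  then show ?thesis by (simp add: set_borel_measurable_def)
qed

lemma set_borel_measurable_continuous_lebesgue: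
  fixes f :: "'a::euclidean_space \<Rightarrow> 'b::{second_countable_topology, real_normed_vector}"
  assumes "U \<in> sets borel" "continuous_on U f"
  shows "set_borel_measurable lebesgue U f"
  unfolding set_borel_measurable_def
  by (rule measurable_completion) (use borel_measurable_continuous_on_indicator[OF assms] in simp)

lemma set_borel_measurable_continuous_surface:
  fixes f :: "real^'n::finite \<Rightarrow> 'b::{second_countable_topology, real_normed_vector}"
  assumes "S \<in> sets borel" "continuous_on S f"
  shows "set_borel_measurable surface_measure S f"
  unfolding set_borel_measurable_def
  using borel_measurable_continuous_on_indicator[OF assms]
  by (simp add: measurable_cong_sets[OF sets_hausdorff_measure refl])

text \<open>Subadditivity of the upper integral needs measurable majorants; the estimate also covers
  fields on a larger set \<open>U'\<close> that vanish off \<open>U\<close>, as extensions by zero do.\<close>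

lemma nn_integral_norm_square_dominated:
  fixes f :: "'a \<Rightarrow> 'b::real_normed_vector"
    and g :: "'a \<Rightarrow> 'c::{second_countable_topology, real_normed_vector}"
    and h :: "'a \<Rightarrow> 'd::{second_countable_topology, real_normed_vector}"
  assumes g: "set_borel_measurable M U g" and h: "set_borel_measurable M U h"
    and le: "\<And>x. x \<in> U \<Longrightarrow> norm (f x) \<le> C * (norm (g x) + norm (h x))"
    and 0: "\<And>x. x \<in> U' - U \<Longrightarrow> f x = 0"
  shows "(\<integral>\<^sup>+x\<in>U'. ennreal ((norm (f x))\<^sup>2) \<partial>M) \<le>
     ennreal (2 * C\<^sup>2) * ((\<integral>\<^sup>+x\<in>U. ennreal ((norm (g x))\<^sup>2) \<partial>M) + (\<integral>\<^sup>+x\<in>U. ennreal ((norm (h x))\<^sup>2) \<partial>M))"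
proof -
  have ind: "ennreal ((norm (k x))\<^sup>2) * indicator U x = ennreal ((norm (indicat_real U x *\<^sub>R k x))\<^sup>2)"
    for k :: "'a \<Rightarrow> 'e::real_normed_vector" and x
    by (auto simp: indicator_def)
  have nm: "(\<lambda>x. ennreal ((norm (k x))\<^sup>2)) \<in> borel_measurable M"
    if "k \<in> borel_measurable M" for k :: "'a \<Rightarrow> 'e::{second_countable_topology, real_normed_vector}"
    using that by measurable
  have m: "(\<lambda>x. ennreal ((norm (g x))\<^sup>2) * indicator U x) \<in> borel_measurable M"
    "(\<lambda>x. ennreal ((norm (h x))\<^sup>2) * indicator U x) \<in> borel_measurable M"
    unfolding ind using g h unfolding set_borel_measurable_def by (intro nm; simp)+
  \<comment> \<open>\<open>(a + b)\<^sup>2 \<le> 2 (a\<^sup>2 + b\<^sup>2)\<close> accounts for the factor \<open>2\<close> in the bound.\<close>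
  have sq: "(norm (f x))\<^sup>2 \<le> 2 * C\<^sup>2 * ((norm (g x))\<^sup>2 + (norm (h x))\<^sup>2)" if "x \<in> U" for x
  proof -
    have "(norm (f x))\<^sup>2 \<le> (C * (norm (g x) + norm (h x)))\<^sup>2"
      using le[OF that] by (intro power_mono) auto
    also have "\<dots> = C\<^sup>2 * (norm (g x) + norm (h x))\<^sup>2" by (simp add: power_mult_distrib)
    also have "\<dots> \<le> C\<^sup>2 * (2 * ((norm (g x))\<^sup>2 + (norm (h x))\<^sup>2))"
      using sum_squares_ge_zero[of "norm (g x) - norm (h x)" 0]
      by (intro mult_left_mono) (auto simp: power2_eq_square algebra_simps)
    finally show ?thesis by (simp add: algebra_simps)
  qed
  have "(\<integral>\<^sup>+x\<in>U'. ennreal ((norm (f x))\<^sup>2) \<partial>M) \<le>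
      (\<integral>\<^sup>+x. ennreal (2 * C\<^sup>2) * (ennreal ((norm (g x))\<^sup>2) * indicator U x + ennreal ((norm (h x))\<^sup>2) * indicator U x) \<partial>M)"
  proof (rule nn_integral_mono)
    fix x
    show "ennreal ((norm (f x))\<^sup>2) * indicator U' x \<le>
      ennreal (2 * C\<^sup>2) * (ennreal ((norm (g x))\<^sup>2) * indicator U x + ennreal ((norm (h x))\<^sup>2) * indicator U x)"
    proof (cases "x \<in> U")
      case True
      have "ennreal ((norm (f x))\<^sup>2) * indicator U' x \<le> ennreal ((norm (f x))\<^sup>2)"
        by (simp add: indicator_def)
      also have "\<dots> \<le> ennreal (2 * C\<^sup>2 * ((norm (g x))\<^sup>2 + (norm (h x))\<^sup>2))"
        using sq[OF True] by (rule ennreal_leI)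
      finally show ?thesis using True by (simp add: ennreal_mult)
    next
      case False
      then show ?thesis using 0[of x] by (cases "x \<in> U'") auto
    qed
  qed
  also have "\<dots> = ennreal (2 * C\<^sup>2) * ((\<integral>\<^sup>+x\<in>U. ennreal ((norm (g x))\<^sup>2) \<partial>M) + (\<integral>\<^sup>+x\<in>U. ennreal ((norm (h x))\<^sup>2) \<partial>M))"
    using m by (simp add: nn_integral_cmult nn_integral_add)
  finally show ?thesis .
qed

lemma square_integrable_on_dominated:
  fixes f :: "'a \<Rightarrow> 'b::{second_countable_topology, real_normed_vector}"
    and g :: "'a \<Rightarrow> 'c::{second_countable_topology, real_normed_vector}"
    and h :: "'a \<Rightarrow> 'd::{second_countable_topology, real_normed_vector}"
  assumes "square_integrable_on M U g" "square_integrable_on M U h"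
    and f: "set_borel_measurable M U' f"
    and le: "\<And>x. x \<in> U \<Longrightarrow> norm (f x) \<le> C * (norm (g x) + norm (h x))"
    and 0: "\<And>x. x \<in> U' - U \<Longrightarrow> f x = 0"
  shows "square_integrable_on M U' f"
proof -
  have "(\<integral>\<^sup>+x\<in>U'. ennreal ((norm (f x))\<^sup>2) \<partial>M) \<le> ennreal (2 * C\<^sup>2) *
     ((\<integral>\<^sup>+x\<in>U. ennreal ((norm (g x))\<^sup>2) \<partial>M) + (\<integral>\<^sup>+x\<in>U. ennreal ((norm (h x))\<^sup>2) \<partial>M))"
    using assms by (intro nn_integral_norm_square_dominated) (auto simp: square_integrable_on_def)
  also have "\<dots> < \<infinity>"
    using assms by (auto simp: square_integrable_on_def ennreal_mult_less_top)
  finally show ?thesis using f by (simp add: square_integrable_on_def)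
qed

lemma nn_integral_norm_square_tendsto_0_dominated:
  fixes f :: "nat \<Rightarrow> 'a \<Rightarrow> 'b::real_normed_vector"
    and g :: "nat \<Rightarrow> 'a \<Rightarrow> 'c::{second_countable_topology, real_normed_vector}"
    and h :: "nat \<Rightarrow> 'a \<Rightarrow> 'd::{second_countable_topology, real_normed_vector}"
  assumes m: "\<And>k. set_borel_measurable M U (g k)" "\<And>k. set_borel_measurable M U (h k)"
    and g: "(\<lambda>k. \<integral>\<^sup>+x\<in>U. ennreal ((norm (g k x))\<^sup>2) \<partial>M) \<longlonglongrightarrow> 0"
    and h: "(\<lambda>k. \<integral>\<^sup>+x\<in>U. ennreal ((norm (h k x))\<^sup>2) \<partial>M) \<longlonglongrightarrow> 0"
    and le: "\<And>k x. x \<in> U \<Longrightarrow> norm (f k x) \<le> C * (norm (g k x) + norm (h k x))"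
    and 0: "\<And>k x. x \<in> U' - U \<Longrightarrow> f k x = 0"
  shows "(\<lambda>k. \<integral>\<^sup>+x\<in>U'. ennreal ((norm (f k x))\<^sup>2) \<partial>M) \<longlonglongrightarrow> 0"
proof (rule tendsto_sandwich[OF _ _ tendsto_const])
  show "\<forall>\<^sub>F k in sequentially. (\<integral>\<^sup>+x\<in>U'. ennreal ((norm (f k x))\<^sup>2) \<partial>M) \<le> ennreal (2 * C\<^sup>2) *
      ((\<integral>\<^sup>+x\<in>U. ennreal ((norm (g k x))\<^sup>2) \<partial>M) + (\<integral>\<^sup>+x\<in>U. ennreal ((norm (h k x))\<^sup>2) \<partial>M))"
    using m le 0 by (intro always_eventually allI nn_integral_norm_square_dominated) auto
  have "(\<lambda>k. ennreal (2 * C\<^sup>2) *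
      ((\<integral>\<^sup>+x\<in>U. ennreal ((norm (g k x))\<^sup>2) \<partial>M) + (\<integral>\<^sup>+x\<in>U. ennreal ((norm (h k x))\<^sup>2) \<partial>M))) \<longlonglongrightarrow>
      ennreal (2 * C\<^sup>2) * (0 + 0)"
    by (intro ennreal_tendsto_cmult tendsto_add g h) simp
  then show "(\<lambda>k. ennreal (2 * C\<^sup>2) *
      ((\<integral>\<^sup>+x\<in>U. ennreal ((norm (g k x))\<^sup>2) \<partial>M) + (\<integral>\<^sup>+x\<in>U. ennreal ((norm (h k x))\<^sup>2) \<partial>M))) \<longlonglongrightarrow> 0"
    by simp
qed simp

lemma square_integrable_on_add:
  assumes "square_integrable_on M U f" "square_integrable_on M U g"
  shows "square_integrable_on M U (\<lambda>x. f x + g x)"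
proof (rule square_integrable_on_dominated[OF assms, of U _ 1])
  show "set_borel_measurable M U (\<lambda>x. f x + g x)"
    using assms by (intro set_borel_measurable_add) (simp_all add: square_integrable_on_def)
qed (simp_all add: norm_triangle_ineq)

lemma square_integrable_on_diff:
  assumes "square_integrable_on M U f" "square_integrable_on M U g"
  shows "square_integrable_on M U (\<lambda>x. f x - g x)"
proof (rule square_integrable_on_dominated[OF assms, of U _ 1])
  show "set_borel_measurable M U (\<lambda>x. f x - g x)"
    using assms by (intro set_borel_measurable_diff) (simp_all add: square_integrable_on_def)
qed (simp_all add: norm_triangle_ineq4)

lemma square_integrable_on_linear:
  fixes f :: "'a \<Rightarrow> 'b::{second_countable_topology, real_normed_vector}"
    and T :: "'b \<Rightarrow> 'c::{second_countable_topology, real_normed_vector}"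
  assumes "square_integrable_on M U f" "bounded_linear T"
  shows "square_integrable_on M U (\<lambda>x. T (f x))"
proof -
  obtain C where C: "\<And>y. norm (T y) \<le> norm y * C"
    using bounded_linear.bounded[OF assms(2)] by blast
  have "0 \<le> C * norm y" for y :: "'b" using order_trans[OF norm_ge_zero C, of y] by (simp add: mult.commute)
  then have "norm (T y) \<le> C * (norm y + norm y)" for y
    using C[of y] add_increasing2[of "C * norm y" "norm (T y)" "C * norm y"] by (simp add: algebra_simps)
  then show ?thesis
    using assms set_borel_measurable_linear[OF _ assms(2), of M U f]
    by (intro square_integrable_on_dominated[OF assms(1,1), of U _ C]) (simp_all add: square_integrable_on_def)
qed

lemma square_integrable_on_scaleR_bounded:
  assumes "square_integrable_on M U f" "set_borel_measurable M U m" "\<And>x. x \<in> U \<Longrightarrow> \<bar>m x\<bar> \<le> C"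
  shows "square_integrable_on M U (\<lambda>x. m x *\<^sub>R f x)"
proof (rule square_integrable_on_dominated[OF assms(1,1), of U _ C])
  show "norm (m x *\<^sub>R f x) \<le> C * (norm (f x) + norm (f x))" if "x \<in> U" for x
  proof -
    have "norm (m x *\<^sub>R f x) \<le> C * norm (f x)"
      using assms(3)[OF that] by (simp add: mult_right_mono)
    moreover have "0 \<le> C * norm (f x)" using assms(3)[OF that] by (intro mult_nonneg_nonneg) auto
    ultimately show ?thesis by (simp add: distrib_left)
  qed
qed (use assms in \<open>simp_all add: square_integrable_on_def set_borel_measurable_scaleR\<close>)

lemma square_integrable_on_cong:
  fixes f g :: "'a \<Rightarrow> 'b::{second_countable_topology, real_normed_vector}"
  assumes "\<And>x. x \<in> U \<Longrightarrow> f x = g x"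
  shows "square_integrable_on M U f \<longleftrightarrow> square_integrable_on M U g"
proof -
  have "(\<integral>\<^sup>+x\<in>U. ennreal ((norm (f x))\<^sup>2) \<partial>M) = (\<integral>\<^sup>+x\<in>U. ennreal ((norm (g x))\<^sup>2) \<partial>M)"
    using assms by (intro nn_integral_cong) (auto simp: indicator_def)
  then show ?thesis
    using set_borel_measurable_cong[of U f g M, OF assms] by (simp add: square_integrable_on_def)
qed

lemma square_integrable_on_subset:
  fixes f :: "'a \<Rightarrow> 'b::{second_countable_topology, banach}"
  assumes "square_integrable_on M U f" "A \<in> sets M" "A \<subseteq> U"
  shows "square_integrable_on M A f"
proof -
  have "(\<integral>\<^sup>+x\<in>A. ennreal ((norm (f x))\<^sup>2) \<partial>M) \<le> (\<integral>\<^sup>+x\<in>U. ennreal ((norm (f x))\<^sup>2) \<partial>M)"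
    using assms(3) by (intro nn_integral_mono) (auto simp: indicator_def)
  also have "\<dots> < \<infinity>" using assms(1) by (simp add: square_integrable_on_def)
  finally show ?thesis
    using assms set_borel_measurable_subset[of M U f A] by (simp add: square_integrable_on_def)
qed

lemma set_integrable_inner_square_integrable:
  fixes f g :: "'a \<Rightarrow> 'b::euclidean_space"
  assumes "square_integrable_on M U f" "square_integrable_on M U g"
  shows "set_integrable M U (\<lambda>x. f x \<bullet> g x)"
  unfolding set_integrable_def
proof (rule integrableI_bounded)
  have eq: "(\<lambda>x. indicator U x *\<^sub>R (f x \<bullet> g x)) = (\<lambda>x. (indicator U x *\<^sub>R f x) \<bullet> (indicator U x *\<^sub>R g x))"
    by (auto simp: indicator_def)
  show "(\<lambda>x. indicator U x *\<^sub>R (f x \<bullet> g x)) \<in> borel_measurable M"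
    unfolding eq using assms unfolding square_integrable_on_def set_borel_measurable_def
    by (intro borel_measurable_inner) auto
  have ind: "ennreal ((norm (k x))\<^sup>2) * indicator U x = ennreal ((norm (indicat_real U x *\<^sub>R k x))\<^sup>2)"
    for k :: "'a \<Rightarrow> 'b" and x
    by (auto simp: indicator_def)
  have nm: "(\<lambda>x. ennreal ((norm (k x))\<^sup>2)) \<in> borel_measurable M"
    if "k \<in> borel_measurable M" for k :: "'a \<Rightarrow> 'b"
    using that by measurable
  have m: "(\<lambda>x. ennreal ((norm (f x))\<^sup>2) * indicator U x) \<in> borel_measurable M"
    "(\<lambda>x. ennreal ((norm (g x))\<^sup>2) * indicator U x) \<in> borel_measurable M"
    unfolding ind using assms unfolding square_integrable_on_def set_borel_measurable_def by (intro nm; simp)+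
  have "(\<integral>\<^sup>+x. ennreal (norm (indicat_real U x *\<^sub>R (f x \<bullet> g x))) \<partial>M) \<le>
      (\<integral>\<^sup>+x. ennreal ((norm (f x))\<^sup>2) * indicator U x + ennreal ((norm (g x))\<^sup>2) * indicator U x \<partial>M)"
  proof (rule nn_integral_mono)
    fix x
    have "\<bar>f x \<bullet> g x\<bar> \<le> norm (f x) * norm (g x)" by (rule Cauchy_Schwarz_ineq2)
    also have "2 * (norm (f x) * norm (g x)) \<le> (norm (f x))\<^sup>2 + (norm (g x))\<^sup>2"
      using sum_squares_ge_zero[of "norm (f x) - norm (g x)" 0]
      by (auto simp: power2_eq_square algebra_simps)
    then have "norm (f x) * norm (g x) \<le> (norm (f x))\<^sup>2 + (norm (g x))\<^sup>2"
      using mult_nonneg_nonneg[OF norm_ge_zero[of "f x"] norm_ge_zero[of "g x"]] by linarith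
    finally have "\<bar>f x \<bullet> g x\<bar> \<le> (norm (f x))\<^sup>2 + (norm (g x))\<^sup>2" .
    then show "ennreal (norm (indicat_real U x *\<^sub>R (f x \<bullet> g x))) \<le>
        ennreal ((norm (f x))\<^sup>2) * indicator U x + ennreal ((norm (g x))\<^sup>2) * indicator U x"
      by (auto simp: indicator_def simp flip: ennreal_plus intro: ennreal_leI)
  qed
  also have "\<dots> < \<infinity>"
    using assms m by (simp add: nn_integral_add square_integrable_on_def)
  finally show "(\<integral>\<^sup>+x. ennreal (norm (indicat_real U x *\<^sub>R (f x \<bullet> g x))) \<partial>M) < \<infinity>" .
qed

lemma set_integral_eq_AE_zero_outside:
  fixes f :: "'a \<Rightarrow> 'b::{banach, second_countable_topology}"
  assumes "set_integrable M U f" "set_integrable M A f" "A \<subseteq> U" "AE x in M. x \<in> U - A \<longrightarrow> f x = 0"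
  shows "set_lebesgue_integral M U f = set_lebesgue_integral M A f"
  unfolding set_lebesgue_integral_def
proof (rule integral_cong_AE)
  show "AE x in M. indicat_real U x *\<^sub>R f x = indicat_real A x *\<^sub>R f x"
    using assms(4) by eventually_elim (use assms(3) in \<open>auto simp: indicator_def\<close>)
qed (use assms(1,2) in \<open>unfold set_integrable_def, blast intro: borel_measurable_integrable\<close>)+


section \<open>Smooth functions and cutoffs\<close>

lemma C_k_SucI:
  assumes "\<And>x. (f has_derivative f' x) (at x)" "\<And>h. C_k k (\<lambda>x. f' x h)"
  shows "C_k (Suc k) f"
  unfolding C_k.simps(2) using assms by (intro exI[of _ f']) simp

lemma C_k_Suc_imp: "C_k (Suc k) f \<Longrightarrow> C_k k f"
proof (induction k arbitrary: f)
  case 0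
  then show ?case
    by (auto intro!: continuous_at_imp_continuous_on intro: has_derivative_continuous)
next
  case (Suc k)
  then obtain f' where "\<forall>x. (f has_derivative f' x) (at x)" "\<forall>h. C_k (Suc k) (\<lambda>x. f' x h)"
    by (auto simp only: C_k.simps(2)[of "Suc k"])
  with Suc.IH show ?case by auto
qed

lemma C_k_const: "C_k k (\<lambda>_. c)"
proof (induction k arbitrary: c)
  case (Suc k)
  show ?case using Suc[of 0] by (auto intro!: exI[of _ "\<lambda>_ _. 0"])
qed simp

lemma C_k_add: "C_k k f \<Longrightarrow> C_k k g \<Longrightarrow> C_k k (\<lambda>x. f x + g x)"
proof (induction k arbitrary: f g)
  case (Suc k)
  then obtain f' g' where "\<forall>x. (f has_derivative f' x) (at x)" "\<forall>h. C_k k (\<lambda>x. f' x h)"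
      "\<forall>x. (g has_derivative g' x) (at x)" "\<forall>h. C_k k (\<lambda>x. g' x h)" by auto
  with Suc.IH show ?case
    by (auto intro!: exI[of _ "\<lambda>x h. f' x h + g' x h"] has_derivative_add)
qed (auto intro: continuous_intros)

text \<open>The product rule expresses the derivative by products of functions that are one order less smooth,
  so that one induction covers all bilinear products.\<close>

lemma C_k_bilinear:
  assumes pr: "bounded_bilinear pr"
  shows "C_k k f \<Longrightarrow> C_k k g \<Longrightarrow> C_k k (\<lambda>x. pr (f x) (g x))"
proof (induction k arbitrary: f g)
  case 0
  then show ?case using bounded_bilinear.continuous_on[OF pr] by auto
next
  case (Suc k)
  then obtain f' g' where fg: "\<forall>x. (f has_derivative f' x) (at x)" "\<forall>h. C_k k (\<lambda>x. f' x h)"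
      "\<forall>x. (g has_derivative g' x) (at x)" "\<forall>h. C_k k (\<lambda>x. g' x h)" by auto
  have "C_k k f" "C_k k g" using Suc.prems by (simp_all only: C_k_Suc_imp)
  then have "C_k k (\<lambda>x. pr (f x) (g' x h) + pr (f' x h) (g x))" for h
    using fg by (intro C_k_add Suc.IH) auto
  moreover have "((\<lambda>x. pr (f x) (g x)) has_derivative (\<lambda>h. pr (f x) (g' x h) + pr (f' x h) (g x))) (at x)" for x
    using fg by (intro bounded_bilinear.FDERIV[OF pr]) auto
  ultimately show ?case by (rule C_k_SucI[rotated])
qed

lemmas C_k_mult = C_k_bilinear[OF bounded_bilinear_mult]

lemma C_k_ident: "C_k k (\<lambda>x::'a::euclidean_space. x)"
proof (cases k)
  case (Suc n)
  have "C_k (Suc n) (\<lambda>x::'a. x)"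
    unfolding C_k.simps(2) by (rule exI[of _ "\<lambda>x h. h"]) (simp add: C_k_const)
  then show ?thesis using Suc by simp
qed simp

text \<open>The outer function has a real argument, hence its derivative is multiplication by a scalar and the
  chain rule reduces the claim to products.\<close>

lemma C_k_compose_real:
  fixes \<theta> :: "real \<Rightarrow> real"
  shows "C_k k \<theta> \<Longrightarrow> C_k k q \<Longrightarrow> C_k k (\<lambda>x. \<theta> (q x))"
proof (induction k arbitrary: \<theta>)
  case 0
  then show ?case unfolding C_k.simps(1) by (rule continuous_on_compose2) simp
next
  case (Suc k)
  then obtain \<theta>' q' where d: "\<forall>x. (\<theta> has_derivative \<theta>' x) (at x)" "\<forall>h. C_k k (\<lambda>x. \<theta>' x h)"
      "\<forall>x. (q has_derivative q' x) (at x)" "\<forall>h. C_k k (\<lambda>x. q' x h)" by auto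
  have q: "C_k k q" using Suc.prems(2) by (rule C_k_Suc_imp)
  have lin: "\<theta>' x h = h * \<theta>' x 1" for x h
    using linear_scale[OF has_derivative_linear[OF d(1)[rule_format]], of x h 1]
    by (simp only: real_scaleR_def mult_1_right)
  have "C_k k (\<lambda>x. \<theta>' (q x) (q' x h))" for h
    using C_k_mult[OF d(4)[rule_format, of h] Suc.IH[OF d(2)[rule_format, of 1] q]]
    by (subst lin)
  moreover have "((\<lambda>x. \<theta> (q x)) has_derivative (\<lambda>h. \<theta>' (q x) (q' x h))) (at x)" for x
    by (rule has_derivative_compose[OF d(3)[rule_format] d(1)[rule_format]])
  ultimately show ?case by (rule C_k_SucI[rotated])
qed

lemma C_k_inverse:
  fixes g :: "'a::euclidean_space \<Rightarrow> real"
  assumes "smooth g" and nz: "\<And>x. g x \<noteq> 0"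
  shows "C_k k (\<lambda>x. inverse (g x))"
proof (induction k)
  case 0
  have "C_k 0 g" using assms(1) unfolding smooth_def by blast
  then show ?case using nz by (auto intro!: continuous_on_inverse)
next
  case (Suc k)
  obtain g' where d: "\<forall>x. (g has_derivative g' x) (at x)" "\<forall>h. C_k k (\<lambda>x. g' x h)"
    using assms(1) unfolding smooth_def by (metis C_k.simps(2))
  have "C_k k (\<lambda>x. - 1 * (inverse (g x) * (g' x h * inverse (g x))))" for h
    using d Suc by (intro C_k_mult C_k_const) auto
  moreover have "((\<lambda>x. inverse (g x)) has_derivative (\<lambda>h. - 1 * (inverse (g x) * (g' x h * inverse (g x))))) (at x)" for x
    using Deriv.has_derivative_inverse[OF nz d(1)[rule_format]] by (simp add: mult.assoc)
  ultimately show ?case by (rule C_k_SucI[rotated])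
qed

text \<open>The functions \<open>exp (- 1 / t) / t ^ n\<close>, extended by \<open>0\<close>, have derivatives that are linear
  combinations of functions of the same kind; this is why the whole family is treated at once.\<close>

definition flat_exp :: "nat \<Rightarrow> real \<Rightarrow> real" where
  "flat_exp n t = (if t > 0 then exp (- 1 / t) / t ^ n else 0)"

lemma flat_exp_tendsto_0: "(flat_exp n \<longlongrightarrow> 0) (at 0)"
proof (rule filterlim_split_at)
  show "(flat_exp n \<longlongrightarrow> 0) (at_left 0)"
    by (rule tendsto_eventually) (auto simp: flat_exp_def eventually_at_filter)
  have "((\<lambda>t. inverse t ^ n / exp (inverse t)) \<longlongrightarrow> 0) (at_right (0::real))"
    by (rule filterlim_compose[OF tendsto_power_div_exp_0 filterlim_inverse_at_top_right])
  then show "(flat_exp n \<longlongrightarrow> 0) (at_right 0)"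
    by (rule Lim_transform_eventually)
       (auto simp: flat_exp_def eventually_at_filter exp_minus field_simps power_inverse)
qed

lemma flat_exp_has_derivative:
  "(flat_exp n has_real_derivative flat_exp (n + 2) t - real n * flat_exp (n + 1) t) (at t)"
proof -
  consider "t > 0" | "t < 0" | "t = 0" by linarith
  then show ?thesis
  proof cases
    case 1
    have "((\<lambda>t. exp (- 1 / t) / t ^ n) has_real_derivative flat_exp (n + 2) t - real n * flat_exp (n + 1) t) (at t)"
    proof -
      have "((\<lambda>t. exp (- 1 / t) / t ^ n) has_real_derivative
          (exp (- 1 / t) * (1 / t\<^sup>2) * t ^ n - exp (- 1 / t) * (real n * t ^ (n - 1))) / (t ^ n * t ^ n)) (at t)"
        using 1 by (auto intro!: derivative_eq_intros simp: power2_eq_square)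
      moreover have "real n * t ^ (n - 1) = real n * t ^ n / t"
        using 1 by (cases n) auto
      moreover have "(exp (- 1 / t) * (1 / t\<^sup>2) * t ^ n - exp (- 1 / t) * (real n * t ^ n / t)) / (t ^ n * t ^ n)
          = flat_exp (n + 2) t - real n * flat_exp (n + 1) t"
        using 1 by (simp add: flat_exp_def field_simps power2_eq_square)
      ultimately show ?thesis by simp
    qed
    then show ?thesis
      by (rule DERIV_cong_ev[THEN iffD1, OF refl _ refl, rotated])
         (use 1 in \<open>auto simp: flat_exp_def eventually_nhds intro!: exI[of _ "{0<..}"]\<close>)
  next
    case 2
    have "((\<lambda>t. 0) has_real_derivative flat_exp (n + 2) t - real n * flat_exp (n + 1) t) (at t)"
      using 2 by (simp add: flat_exp_def)
    then show ?thesis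
      by (rule DERIV_cong_ev[THEN iffD1, OF refl _ refl, rotated])
         (use 2 in \<open>auto simp: flat_exp_def eventually_nhds intro!: exI[of _ "{..<0}"]\<close>)
  next
    case 3
    \<comment> \<open>The difference quotient of a member of the family at \<open>0\<close> is the next member.\<close>
    have "(\<lambda>h. (flat_exp n (0 + h) - flat_exp n 0) / h) = flat_exp (n + 1)"
      by (auto simp: flat_exp_def)
    then have "(flat_exp n has_real_derivative 0) (at 0)"
      using flat_exp_tendsto_0[of "n + 1"] by (simp add: DERIV_def)
    then show ?thesis using 3 by (simp add: flat_exp_def)
  qed
qed

lemma C_k_flat_exp: "C_k k (flat_exp n)"
proof (induction k arbitrary: n)
  case 0
  show ?case
    using flat_exp_has_derivative by (auto intro!: continuous_at_imp_continuous_on DERIV_isCont)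
next
  case (Suc k)
  have "C_k k (\<lambda>t. (flat_exp (n + 2) t + - real n * flat_exp (n + 1) t) * h)" for h
    using Suc by (intro C_k_mult C_k_add C_k_const) auto
  moreover have "(flat_exp n has_derivative (\<lambda>h. (flat_exp (n + 2) t + - real n * flat_exp (n + 1) t) * h)) (at t)" for t
    using flat_exp_has_derivative[of n t] by (simp add: has_field_derivative_def)
  ultimately show ?case by (rule C_k_SucI[rotated])
qed

text \<open>The classical quotient \<open>e t / (e t + e (1 - t))\<close> with \<open>e t = exp (- 1 / t)\<close>; its denominator is
  positive because \<open>t\<close> and \<open>1 - t\<close> cannot both be nonpositive.\<close>

lemma smooth_step_exists:
  "\<exists>\<theta> :: real \<Rightarrow> real. smooth \<theta> \<and> (\<forall>t\<le>0. \<theta> t = 0) \<and> (\<forall>t\<ge>1. \<theta> t = 1)"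
proof (intro exI conjI allI impI)
  let ?e = "flat_exp 0"
  let ?s = "\<lambda>t. ?e t + ?e (1 + (- 1) * t)"
  have r: "C_k k (\<lambda>t. ?e (1 + (- 1) * t))" for k
    by (intro C_k_compose_real[OF C_k_flat_exp] C_k_add C_k_mult C_k_const C_k_ident)
  have "smooth ?s" unfolding smooth_def by (intro allI C_k_add C_k_flat_exp r)
  moreover have "0 < ?s t" for t
    by (cases "0 < t"; cases "t < 1") (auto simp: flat_exp_def add_pos_pos)
  then have "?s t \<noteq> 0" for t by (metis less_irrefl)
  ultimately have "C_k k (\<lambda>t. inverse (?s t))" for k
    by (rule C_k_inverse)
  then show "smooth (\<lambda>t. ?e t * inverse (?s t))"
    unfolding smooth_def by (intro allI C_k_mult C_k_flat_exp)
  show "?e t * inverse (?s t) = 0" if "t \<le> 0" for t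
    using that by (simp add: flat_exp_def)
  show "?e t * inverse (?s t) = 1" if "1 \<le> t" for t
  proof -
    have "?s t = ?e t" "?e t \<noteq> 0" using that by (simp_all add: flat_exp_def)
    then show ?thesis by simp
  qed
qed

lemma test_functionI:
  assumes "smooth \<phi>" "compact S" "S \<subseteq> U" "\<And>x. x \<notin> S \<Longrightarrow> \<phi> x = 0"
  shows "\<phi> \<in> test_functions U"
proof -
  have supp: "{x. \<phi> x \<noteq> 0} \<subseteq> S" using assms(4) by blast
  then have "closure {x. \<phi> x \<noteq> 0} \<subseteq> S"
    by (rule closure_minimal) (rule compact_imp_closed[OF assms(2)])
  moreover have "compact (closure {x. \<phi> x \<noteq> 0})"
    using bounded_subset[OF compact_imp_bounded[OF assms(2)] supp] by (simp add: compact_closure)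
  ultimately show ?thesis using assms(1,3) by (auto simp: test_functions_def)
qed

lemma test_function_smooth: "\<phi> \<in> test_functions U \<Longrightarrow> smooth \<phi>"
  by (simp add: test_functions_def)

lemma test_function_support:
  assumes "\<phi> \<in> test_functions U"
  shows "\<exists>S. compact S \<and> S \<subseteq> U \<and> (\<forall>x. x \<notin> S \<longrightarrow> \<phi> x = 0)"
proof (intro exI conjI allI impI)
  show "\<phi> x = 0" if "x \<notin> closure {x. \<phi> x \<noteq> 0}" for x
    using that subsetD[OF closure_subset, of x "{x. \<phi> x \<noteq> 0}"] by auto
qed (use assms in \<open>simp_all add: test_functions_def\<close>)

lemma test_functions_mono: "\<phi> \<in> test_functions U \<Longrightarrow> U \<subseteq> U' \<Longrightarrow> \<phi> \<in> test_functions U'"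
  by (auto simp: test_functions_def)

text \<open>A smooth step composed with a quadratic function is a cutoff for a ball, and finitely many balls cover
  a compact set.  The cutoff equals \<open>1\<close> on a neighbourhood of \<open>K\<close>, hence its gradient vanishes there.\<close>

lemma cutoff_exists:
  fixes K U :: "'a::euclidean_space set"
  assumes "compact K" "open U" "K \<subseteq> U"
  obtains b :: "'a \<Rightarrow> real" and N
  where "b \<in> test_functions U" "open N" "K \<subseteq> N" "\<And>x. x \<in> N \<Longrightarrow> b x = 1"
proof -
  obtain \<theta> :: "real \<Rightarrow> real"
    where "smooth \<theta> \<and> (\<forall>t\<le>0. \<theta> t = 0) \<and> (\<forall>t\<ge>1. \<theta> t = 1)"
    using smooth_step_exists by (rule exE)
  then have \<theta>: "smooth \<theta>" "\<And>t. t \<le> 0 \<Longrightarrow> \<theta> t = 0" "\<And>t. 1 \<le> t \<Longrightarrow> \<theta> t = 1"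
    by simp_all
  have ball_cutoff: "\<exists>b \<in> test_functions U. \<forall>x \<in> ball c r. b x = (1::real)"
    if "cball c (2 * r) \<subseteq> U" "0 < r" for c :: 'a and r
  proof
    \<comment> \<open>\<open>q \<ge> 1\<close> on the ball of radius \<open>r\<close>, and \<open>q \<le> 0\<close> already at distance \<open>\<surd>2 r < 2 r\<close>.\<close>
    define q where "q x = 2 + (- 1 / r\<^sup>2) * ((x + - c) \<bullet> (x + - c))" for x
    have q: "q x = 2 - (dist c x / r)\<^sup>2" for x
      by (simp add: q_def dist_norm norm_minus_commute power_divide flip: power2_norm_eq_inner)
    have "C_k k q" for k
      unfolding q_def
      by (intro C_k_add C_k_const C_k_mult C_k_bilinear[OF bounded_bilinear_inner] C_k_ident)
    then have "smooth (\<lambda>x. \<theta> (q x))"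
      using \<theta>(1) unfolding smooth_def by (auto intro: C_k_compose_real)
    then show "(\<lambda>x. \<theta> (q x)) \<in> test_functions U"
    proof (rule test_functionI)
      show "\<theta> (q x) = 0" if "x \<notin> cball c (2 * r)" for x
      proof (rule \<theta>(2))
        have "2 \<le> dist c x / r" using that \<open>0 < r\<close> by (simp add: field_simps)
        then have "2\<^sup>2 \<le> (dist c x / r)\<^sup>2" by (intro power_mono) auto
        then show "q x \<le> 0" by (simp add: q)
      qed
    qed (use that in auto)
    show "\<forall>x \<in> ball c r. \<theta> (q x) = 1"
    proof (intro ballI \<theta>(3))
      fix x assume "x \<in> ball c r"
      then have "(dist c x / r)\<^sup>2 \<le> 1\<^sup>2" using \<open>0 < r\<close> by (intro power_mono) (auto simp: field_simps)
      then show "1 \<le> q x" by (simp add: q)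
    qed
  qed
  have "\<exists>r. 0 < r \<and> cball x (2 * r) \<subseteq> U" if x: "x \<in> K" for x
  proof -
    obtain e where "0 < e" "cball x e \<subseteq> U"
      using assms(2,3) x unfolding open_contains_cball by (meson subsetD)
    then show ?thesis by (intro exI[of _ "e / 2"]) auto
  qed
  then have "\<forall>x\<in>K. \<exists>r. 0 < r \<and> cball x (2 * r) \<subseteq> U" by blast
  then obtain r where r: "\<forall>x\<in>K. 0 < r x \<and> cball x (2 * r x) \<subseteq> U" by (rule bchoice[THEN exE])
  obtain C where C: "C \<subseteq> K" "finite C" "K \<subseteq> (\<Union>c\<in>C. ball c (r c))"
  proof (rule compactE_image[OF assms(1)])
    show "K \<subseteq> (\<Union>c\<in>K. ball c (r c))" using r by auto
  qed (simp_all)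
  from \<open>finite C\<close> \<open>C \<subseteq> K\<close> have "\<exists>b \<in> test_functions U. \<forall>x \<in> (\<Union>c\<in>C. ball c (r c)). b x = (1::real)"
  proof (induction C rule: finite_induct)
    case empty
    have "(\<lambda>_. 0) \<in> test_functions U"
      by (rule test_functionI[of _ "{}"]) (auto simp: smooth_def C_k_const)
    then show ?case by auto
  next
    case (insert c C)
    then obtain a b where a: "a \<in> test_functions U" "\<forall>x \<in> ball c (r c). a x = (1::real)"
      and b: "b \<in> test_functions U" "\<forall>x \<in> (\<Union>c\<in>C. ball c (r c)). b x = (1::real)"
      using ball_cutoff[of c "r c"] r by auto
    obtain S where S: "compact S" "S \<subseteq> U" "\<forall>x. x \<notin> S \<longrightarrow> a x = 0"
      using test_function_support[OF a(1)] by (elim exE conjE)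
    obtain T where T: "compact T" "T \<subseteq> U" "\<forall>x. x \<notin> T \<longrightarrow> b x = 0"
      using test_function_support[OF b(1)] by (elim exE conjE)
    \<comment> \<open>\<open>1 - (1 - a) (1 - b)\<close> equals \<open>1\<close> wherever \<open>a\<close> or \<open>b\<close> does.\<close>
    have "smooth (\<lambda>x. a x + (b x + - 1 * (a x * b x)))"
      using test_function_smooth[OF a(1)] test_function_smooth[OF b(1)] unfolding smooth_def
      by (intro allI C_k_add C_k_mult C_k_const) simp_all
    then have "(\<lambda>x. a x + (b x + - 1 * (a x * b x))) \<in> test_functions U"
      using S T by (intro test_functionI[of _ "S \<union> T"]) (auto intro: compact_Un)
    then show ?case
    proof (rule bexI[rotated])
      show "\<forall>x \<in> (\<Union>c\<in>insert c C. ball c (r c)). a x + (b x + - 1 * (a x * b x)) = 1"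
        using a(2) b(2) by auto
    qed
  qed
  then obtain b :: "'a \<Rightarrow> real" where b: "b \<in> test_functions U" "\<forall>x \<in> (\<Union>c\<in>C. ball c (r c)). b x = 1" ..
  show thesis by (rule that[OF b(1) _ C(3)]) (use b(2) in auto)
qed


section \<open>Test functions and locally constant factors\<close>

lemma set_integral_eq_zero_outside:
  fixes f :: "'a \<Rightarrow> 'b::{banach, second_countable_topology}"
  assumes "A \<subseteq> U" "\<And>x. x \<in> U - A \<Longrightarrow> f x = 0"
  shows "set_lebesgue_integral M U f = set_lebesgue_integral M A f"
  unfolding set_lebesgue_integral_def
proof (rule Bochner_Integration.integral_cong[OF refl])
  show "indicat_real U x *\<^sub>R f x = indicat_real A x *\<^sub>R f x" for x
    using assms by (cases "x \<in> A"; cases "x \<in> U") auto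
qed

lemma smooth_has_derivative:
  assumes "smooth f"
  shows "(f has_derivative frechet_derivative f (at x)) (at x)"
proof -
  have "C_k (Suc 0) f" using assms unfolding smooth_def by simp
  then have "f differentiable (at x)" unfolding C_k.simps(2) differentiable_def by blast
  then show ?thesis by (simp add: frechet_derivative_works)
qed

lemma continuous_on_frechet_derivative:
  assumes "smooth f"
  shows "continuous_on UNIV (\<lambda>x. frechet_derivative f (at x) h)"
proof -
  have "C_k (Suc 0) f" using assms unfolding smooth_def by simp
  then obtain f' where f': "\<forall>x. (f has_derivative f' x) (at x)" "\<forall>h. continuous_on UNIV (\<lambda>x. f' x h)"
    by auto
  then have "f' x = frechet_derivative f (at x)" for x
    using frechet_derivative_at by blast
  then show ?thesis using f'(2) by simp
qed

lemma smooth_continuous_on: "smooth f \<Longrightarrow> continuous_on A f"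
  unfolding smooth_def by (metis C_k.simps(1) continuous_on_subset subset_UNIV)

lemma continuous_on_grad: "smooth \<eta> \<Longrightarrow> continuous_on UNIV (grad \<eta>)"
  unfolding grad_def by (intro continuous_intros continuous_on_frechet_derivative)

lemma continuous_on_jacobian: "smooth \<phi> \<Longrightarrow> continuous_on UNIV (jacobian \<phi>)"
  unfolding jacobian_def matrix_def by (intro continuous_intros continuous_on_frechet_derivative)

lemma frechet_derivative_zero_outside:
  assumes "closed S" "\<forall>x. x \<notin> S \<longrightarrow> f x = 0" "x \<notin> S"
  shows "frechet_derivative f (at x) = (\<lambda>_. 0)"
proof -
  have "(f has_derivative (\<lambda>_. 0)) (at x)"
  proof (rule has_derivative_transform_within_open[OF has_derivative_const])
    show "open (- S)" using assms(1) by blast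
  qed (use assms in auto)
  from frechet_derivative_at[OF this] show ?thesis by simp
qed

lemma grad_zero_outside:
  assumes "closed S" "\<forall>x. x \<notin> S \<longrightarrow> \<eta> x = 0" "x \<notin> S"
  shows "grad \<eta> x = 0"
  using frechet_derivative_zero_outside[OF assms] by (simp add: grad_def vec_eq_iff)

lemma jacobian_zero_outside:
  assumes "closed S" "\<forall>x. x \<notin> S \<longrightarrow> \<phi> x = 0" "x \<notin> S"
  shows "jacobian \<phi> x = 0"
  using frechet_derivative_zero_outside[OF assms] by (simp add: jacobian_def matrix_def vec_eq_iff)

lemma test_function_zero_outside:
  assumes "\<phi> \<in> test_functions U" "x \<notin> U"
  shows "\<phi> x = 0"
  using test_function_support[OF assms(1)] assms(2) by blast

lemma grad_test_function_zero_outside: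
  assumes "\<eta> \<in> test_functions U" "x \<notin> U"
  shows "grad \<eta> x = 0"
  using test_function_support[OF assms(1)] assms(2) grad_zero_outside
  by (meson compact_imp_closed subsetD)

lemma jacobian_test_function_zero_outside:
  assumes "\<phi> \<in> test_functions U" "x \<notin> U"
  shows "jacobian \<phi> x = 0"
  using test_function_support[OF assms(1)] assms(2) jacobian_zero_outside
  by (meson compact_imp_closed subsetD)

lemma bounded_continuous_compact_support:
  fixes f :: "'a::euclidean_space \<Rightarrow> 'b::real_normed_vector"
  assumes "continuous_on UNIV f" "compact S" "\<forall>x. x \<notin> S \<longrightarrow> f x = 0"
  shows "\<exists>C\<ge>0. \<forall>x. norm (f x) \<le> C"
proof -
  have "compact (f ` S)"
    using continuous_on_subset[OF assms(1)] assms(2) by (intro compact_continuous_image) auto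
  then obtain C where C: "\<forall>y\<in>f ` S. norm y \<le> C" using compact_imp_bounded bounded_iff by metis
  have "norm (f x) \<le> max C 0" for x using C assms(3) by (cases "x \<in> S") auto
  then show ?thesis by (intro exI[of _ "max C 0"]) simp
qed

lemma L2_continuous_compact_support:
  fixes f :: "'a::euclidean_space \<Rightarrow> 'b::euclidean_space"
  assumes f: "continuous_on UNIV f" and S: "compact S" "\<forall>x. x \<notin> S \<longrightarrow> f x = 0" and A: "A \<in> sets borel"
  shows "L2 A f"
proof -
  obtain C where C: "\<forall>x. norm (f x) \<le> C"
    using bounded_continuous_compact_support[OF f S] by (elim exE conjE)
  have "(\<integral>\<^sup>+x\<in>A. ennreal ((norm (f x))\<^sup>2) \<partial>lebesgue) \<le> (\<integral>\<^sup>+x. ennreal (C\<^sup>2) * indicator S x \<partial>lebesgue)"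
  proof (rule nn_integral_mono)
    fix x
    show "ennreal ((norm (f x))\<^sup>2) * indicator A x \<le> ennreal (C\<^sup>2) * indicator S x"
    proof (cases "x \<in> S")
      case True
      then have "(norm (f x))\<^sup>2 \<le> C\<^sup>2" using C by (intro power_mono) simp_all
      then show ?thesis using True by (simp add: indicator_def ennreal_leI)
    qed (use S(2) in simp)
  qed
  also have "\<dots> = ennreal (C\<^sup>2) * emeasure lebesgue S"
    using S(1) by (intro nn_integral_cmult_indicator) (simp add: borel_compact)
  also have "\<dots> < \<infinity>"
    using fmeasurableD2[OF lmeasurable_compact[OF S(1)]] by (simp add: ennreal_mult_less_top top.not_eq_extremum)
  finally show ?thesis
    using set_borel_measurable_continuous_lebesgue[OF A continuous_on_subset[OF f]]
    by (simp add: square_integrable_on_def)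
qed

lemma L2_test_function:
  fixes \<phi> :: "'a::euclidean_space \<Rightarrow> 'b::euclidean_space"
  assumes "\<phi> \<in> test_functions U" "A \<in> sets borel"
  shows "L2 A \<phi>"
  using test_function_support[OF assms(1)] smooth_continuous_on[OF test_function_smooth[OF assms(1)]] assms(2)
  by (blast intro: L2_continuous_compact_support)

lemma L2_grad_test_function:
  assumes "\<eta> \<in> test_functions U" "A \<in> sets borel"
  shows "L2 A (grad \<eta>)"
proof -
  obtain S where S: "compact S" "\<forall>x. x \<notin> S \<longrightarrow> \<eta> x = 0"
    using test_function_support[OF assms(1)] by (elim exE conjE)
  then show ?thesis
    using continuous_on_grad[OF test_function_smooth[OF assms(1)]] assms(2) grad_zero_outside[of S \<eta>] compact_imp_closed
    by (intro L2_continuous_compact_support[of _ S]) auto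
qed

lemma L2_jacobian_test_function:
  assumes "\<phi> \<in> test_functions U" "A \<in> sets borel"
  shows "L2 A (jacobian \<phi>)"
proof -
  obtain S where S: "compact S" "\<forall>x. x \<notin> S \<longrightarrow> \<phi> x = 0"
    using test_function_support[OF assms(1)] by (elim exE conjE)
  then show ?thesis
    using continuous_on_jacobian[OF test_function_smooth[OF assms(1)]] assms(2) jacobian_zero_outside[of S \<phi>] compact_imp_closed
    by (intro L2_continuous_compact_support[of _ S]) auto
qed

lemma smooth_mult:
  fixes f g :: "'a::euclidean_space \<Rightarrow> real"
  shows "smooth f \<Longrightarrow> smooth g \<Longrightarrow> smooth (\<lambda>x. f x * g x)"
  unfolding smooth_def by (intro allI C_k_mult) simp_all

lemma grad_mult:
  assumes "smooth f" "smooth g"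
  shows "grad (\<lambda>x. f x * g x) x = f x *\<^sub>R grad g x + g x *\<^sub>R grad f x"
  using frechet_derivative_at[OF has_derivative_mult[OF assms[THEN smooth_has_derivative, of x]], symmetric]
  by (simp add: grad_def vec_eq_iff algebra_simps)

text \<open>Local constancy is relative to the set, so that it can be required up to the boundary of an open
  set: on \<open>closure B\<close> it makes the trace of a piecewise constant coefficient well defined.\<close>

definition locally_constant_on :: "'a::topological_space set \<Rightarrow> ('a \<Rightarrow> 'b) \<Rightarrow> bool" where
  "locally_constant_on S m \<longleftrightarrow> (\<forall>x\<in>S. \<forall>\<^sub>F y in at x within S. m y = m x)"

lemma locally_constant_on_subset:
  "locally_constant_on S m \<Longrightarrow> T \<subseteq> S \<Longrightarrow> locally_constant_on T m"
  unfolding locally_constant_on_def by (meson at_le filter_leD subsetD)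

lemma locally_constant_on_continuous:
  fixes m :: "'a::topological_space \<Rightarrow> 'b::topological_space"
  shows "locally_constant_on S m \<Longrightarrow> continuous_on S m"
  unfolding locally_constant_on_def continuous_on_def by (auto intro: tendsto_eventually)

text \<open>Near a point of \<open>U\<close> the factor is constant, and near any other point \<open>f\<close> vanishes because \<open>S\<close> is
  closed.  Hence \<open>m f\<close> is differentiated like a constant multiple of \<open>f\<close> at every point, although \<open>m\<close> is
  arbitrary off \<open>U\<close>.\<close>

lemma eventually_locally_constant_scaleR:
  fixes f :: "'a::euclidean_space \<Rightarrow> 'b::real_normed_vector"
  assumes m: "open U" "locally_constant_on U m" and S: "closed S" "S \<subseteq> U" "\<forall>x. x \<notin> S \<longrightarrow> f x = 0"
  shows "\<forall>\<^sub>F y in nhds x. m x *\<^sub>R f y = m y *\<^sub>R f y"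
proof (cases "x \<in> U")
  case True
  then have "\<forall>\<^sub>F y in at x. m y = m x"
    using m(2) unfolding locally_constant_on_def at_within_open[OF True m(1), symmetric] by blast
  then show ?thesis
    unfolding eventually_at_filter by (rule eventually_mono) auto
next
  case False
  then have "x \<in> - S" using S(2) by blast
  then have "\<forall>\<^sub>F y in nhds x. y \<in> - S"
    by (rule eventually_nhds_in_open[OF open_Compl[OF S(1)]])
  then show ?thesis by (rule eventually_mono) (use S(3) in simp)
qed

lemma has_derivative_locally_constant_scaleR:
  fixes f :: "'a::euclidean_space \<Rightarrow> 'b::real_normed_vector"
  assumes "open U" "locally_constant_on U m" "closed S" "S \<subseteq> U" "\<forall>x. x \<notin> S \<longrightarrow> f x = 0"
    and "(f has_derivative f') (at x)"
  shows "((\<lambda>x. m x *\<^sub>R f x) has_derivative (\<lambda>h. m x *\<^sub>R f' h)) (at x)"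
proof -
  have "((\<lambda>y. m x *\<^sub>R f y) has_derivative (\<lambda>h. m x *\<^sub>R f' h)) (at x)"
    by (rule has_derivative_scaleR_right[OF assms(6)])
  moreover have ev: "\<forall>\<^sub>F y in nhds x. m x *\<^sub>R f y = m y *\<^sub>R f y"
    by (rule eventually_locally_constant_scaleR[OF assms(1-5)])
  then have "\<forall>\<^sub>F y in at x. m x *\<^sub>R f y = m y *\<^sub>R f y"
    unfolding eventually_at_filter by (rule eventually_mono) simp
  ultimately show ?thesis
    by (rule has_derivative_transform_eventually) simp_all
qed

text \<open>The support condition is inherited by the derivatives, which lets the induction go through for the
  product extended by \<open>0\<close> to the whole space.\<close>

lemma C_k_locally_constant_scaleR:
  fixes f :: "'a::euclidean_space \<Rightarrow> 'b::real_normed_vector"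
  assumes m: "open U" "locally_constant_on U m" and S: "closed S" "S \<subseteq> U"
  shows "C_k k f \<Longrightarrow> (\<forall>x. x \<notin> S \<longrightarrow> f x = 0) \<Longrightarrow> C_k k (\<lambda>x. m x *\<^sub>R f x)"
proof (induction k arbitrary: f)
  case 0
  have "isCont (\<lambda>x. m x *\<^sub>R f x) x" for x
  proof -
    have "isCont (\<lambda>y. m x *\<^sub>R f y) x"
      using 0 by (intro continuous_intros) (simp add: continuous_on_eq_continuous_at)
    then show ?thesis
      using isCont_cong[OF eventually_locally_constant_scaleR[OF m S 0(2), of x]] by simp
  qed
  then show ?case by (simp add: continuous_at_imp_continuous_on)
next
  case (Suc k)
  then obtain f' where f': "\<forall>x. (f has_derivative f' x) (at x)" "\<forall>h. C_k k (\<lambda>x. f' x h)"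
    by auto
  have "f' x h = 0" if "x \<notin> S" for x h
    using frechet_derivative_zero_outside[OF S(1) Suc.prems(2) that] frechet_derivative_at[OF f'(1)[rule_format, of x]]
    by simp
  then have "C_k k (\<lambda>x. m x *\<^sub>R f' x h)" for h
    using f'(2) by (intro Suc.IH) auto
  with has_derivative_locally_constant_scaleR[OF m S Suc.prems(2) f'(1)[rule_format]]
  show ?case by (rule C_k_SucI)
qed

lemma test_functions_locally_constant_scaleR:
  fixes \<phi> :: "'a::euclidean_space \<Rightarrow> 'b::real_normed_vector"
  assumes "open U" "locally_constant_on U m" "\<phi> \<in> test_functions U"
  shows "(\<lambda>x. m x *\<^sub>R \<phi> x) \<in> test_functions U"
proof -
  obtain S where S: "compact S" "S \<subseteq> U" "\<forall>x. x \<notin> S \<longrightarrow> \<phi> x = 0"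
    using test_function_support[OF assms(3)] by (elim exE conjE)
  have "smooth (\<lambda>x. m x *\<^sub>R \<phi> x)"
    using test_function_smooth[OF assms(3)] C_k_locally_constant_scaleR[OF assms(1,2) compact_imp_closed[OF S(1)] S(2) _ S(3)]
    unfolding smooth_def by simp
  then show ?thesis by (rule test_functionI[OF _ S(1,2)]) (use S(3) in simp)
qed

lemma frechet_derivative_locally_constant_scaleR:
  fixes \<phi> :: "'a::euclidean_space \<Rightarrow> 'b::real_normed_vector"
  assumes "open U" "locally_constant_on U m" "\<phi> \<in> test_functions U"
  shows "frechet_derivative (\<lambda>x. m x *\<^sub>R \<phi> x) (at x) = (\<lambda>h. m x *\<^sub>R frechet_derivative \<phi> (at x) h)"
proof -
  obtain S where S: "compact S" "S \<subseteq> U" "\<forall>x. x \<notin> S \<longrightarrow> \<phi> x = 0"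
    using test_function_support[OF assms(3)] by (elim exE conjE)
  show ?thesis
    by (rule frechet_derivative_at[symmetric],
        rule has_derivative_locally_constant_scaleR[OF assms(1,2) compact_imp_closed[OF S(1)] S(2,3)
          smooth_has_derivative[OF test_function_smooth[OF assms(3)]]])
qed

lemma grad_locally_constant_mult:
  assumes "open U" "locally_constant_on U m" "\<eta> \<in> test_functions U"
  shows "grad (\<lambda>x. m x * \<eta> x) x = m x *\<^sub>R grad \<eta> x"
  using frechet_derivative_locally_constant_scaleR[OF assms, of x]
  by (simp add: grad_def vec_eq_iff)

lemma jacobian_locally_constant_scaleR:
  assumes "open U" "locally_constant_on U m" "\<phi> \<in> test_functions U"
  shows "jacobian (\<lambda>x. m x *\<^sub>R \<phi> x) x = m x *\<^sub>R jacobian \<phi> x"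
  using frechet_derivative_locally_constant_scaleR[OF assms, of x]
  by (simp add: jacobian_def matrix_def vec_eq_iff)


section \<open>Weak gradients and traces of products\<close>

lemma set_integrable_mult_square_integrable:
  fixes f g :: "'a \<Rightarrow> real"
  assumes "square_integrable_on M U f" "square_integrable_on M U g"
  shows "set_integrable M U (\<lambda>x. f x * g x)"
  using set_integrable_inner_square_integrable[OF assms] by simp

lemma square_integrable_on_vec_nth:
  fixes f :: "'a \<Rightarrow> 'b::euclidean_space^'n"
  assumes "square_integrable_on M U f"
  shows "square_integrable_on M U (\<lambda>x. f x $ i)"
  using square_integrable_on_linear[OF assms bounded_linear_vec_nth] .

lemma H1_diff:
  assumes U: "open U" and u: "H1 U u Du" and v: "H1 U v Dv"
  shows "H1 U (\<lambda>x. u x - v x) (\<lambda>x. Du x - Dv x)"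
  unfolding H1_def
proof (intro conjI)
  show "L2 U (\<lambda>x. u x - v x)" "L2 U (\<lambda>x. Du x - Dv x)"
    using u v unfolding H1_def by (simp_all only: square_integrable_on_diff)
  show "has_weak_gradient U (\<lambda>x. u x - v x) (\<lambda>x. Du x - Dv x)"
    unfolding has_weak_gradient_def
  proof (intro ballI allI)
    fix \<eta> :: "real^'a \<Rightarrow> real" and i j assume \<eta>: "\<eta> \<in> test_functions U"
    have B: "U \<in> sets borel" using U by simp
    note L = L2_test_function[OF \<eta> B] square_integrable_on_vec_nth[OF L2_grad_test_function[OF \<eta> B], of j]
    have eq: "(LINT x:U|lebesgue. w x $ i * grad \<eta> x $ j) = - (LINT x:U|lebesgue. Dw x $ i $ j * \<eta> x)"
      and int: "set_integrable lebesgue U (\<lambda>x. w x $ i * grad \<eta> x $ j)"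
        "set_integrable lebesgue U (\<lambda>x. Dw x $ i $ j * \<eta> x)"
      if "H1 U w Dw" for w Dw
      using that \<eta> L unfolding H1_def has_weak_gradient_def
      by (blast, auto intro!: set_integrable_mult_square_integrable square_integrable_on_vec_nth)
    show "(LINT x:U|lebesgue. (u x - v x) $ i * grad \<eta> x $ j) = - (LINT x:U|lebesgue. (Du x - Dv x) $ i $ j * \<eta> x)"
      using eq[OF u] eq[OF v] set_integral_diff(2)[OF int(1)[OF u] int(1)[OF v]] set_integral_diff(2)[OF int(2)[OF u] int(2)[OF v]]
      by (simp add: left_diff_distrib)
  qed
qed

text \<open>The factor can be moved onto the test function, because \<open>m \<eta>\<close> is again a test function with gradient
  \<open>m \<nabla>\<eta>\<close>.\<close>

lemma H1_locally_constant_scaleR: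
  assumes U: "open U" and m: "locally_constant_on U m" "\<And>x. x \<in> U \<Longrightarrow> \<bar>m x\<bar> \<le> C"
    and u: "H1 U u Du"
  shows "H1 U (\<lambda>x. m x *\<^sub>R u x) (\<lambda>x. m x *\<^sub>R Du x)"
  unfolding H1_def
proof (intro conjI)
  have "set_borel_measurable lebesgue U m"
    using U locally_constant_on_continuous[OF m(1)] by (intro set_borel_measurable_continuous_lebesgue) simp_all
  then show "L2 U (\<lambda>x. m x *\<^sub>R u x)" "L2 U (\<lambda>x. m x *\<^sub>R Du x)"
    using u m(2) unfolding H1_def by (auto intro: square_integrable_on_scaleR_bounded)
  show "has_weak_gradient U (\<lambda>x. m x *\<^sub>R u x) (\<lambda>x. m x *\<^sub>R Du x)"
    unfolding has_weak_gradient_def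
  proof (intro ballI allI)
    fix \<eta> :: "real^'a \<Rightarrow> real" and i j assume \<eta>: "\<eta> \<in> test_functions U"
    have "(\<lambda>x. m x * \<eta> x) \<in> test_functions U"
      using test_functions_locally_constant_scaleR[OF U m(1) \<eta>] by simp
    then have "(LINT x:U|lebesgue. u x $ i * grad (\<lambda>x. m x * \<eta> x) x $ j) = - (LINT x:U|lebesgue. Du x $ i $ j * (m x * \<eta> x))"
      using u unfolding H1_def has_weak_gradient_def by blast
    then show "(LINT x:U|lebesgue. (m x *\<^sub>R u x) $ i * grad \<eta> x $ j) = - (LINT x:U|lebesgue. (m x *\<^sub>R Du x) $ i $ j * \<eta> x)"
      by (simp add: grad_locally_constant_mult[OF U m(1) \<eta>] mult.assoc mult.left_commute)
  qed
qed

text \<open>The tensor product \<open>a b\<^sup>T\<close>, which is what the gradient of a scalar factor contributes to the Jacobian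
  matrix of the product with a vector field.\<close>

definition outer_product :: "real^'m \<Rightarrow> real^'n::finite \<Rightarrow> real^'n^'m::finite" where
  "outer_product a b = (\<chi> i. a $ i *\<^sub>R b)"

lemma norm_outer_product: "norm (outer_product a b) = norm a * norm b"
proof -
  have "norm (outer_product a b) = L2_set (\<lambda>i. norm (a $ i *\<^sub>R b)) UNIV"
    unfolding norm_vec_def[of "outer_product a b"] by (simp add: outer_product_def)
  then show ?thesis by (simp add: norm_vec_def[of a] L2_set_left_distrib)
qed

lemma outer_product_zero_right [simp]: "outer_product a 0 = 0"
  by (simp add: outer_product_def vec_eq_iff)

lemma outer_product_zero_left [simp]: "outer_product 0 b = 0"
  by (simp add: outer_product_def vec_eq_iff)

lemma outer_product_nth: "outer_product a b $ i $ j = a $ i * b $ j"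
  by (simp add: outer_product_def)

lemma outer_product_diff_left: "outer_product (a - a') b = outer_product a b - outer_product a' b"
  by (simp add: outer_product_def vec_eq_iff algebra_simps)

lemma set_borel_measurable_outer_product:
  fixes f :: "'a \<Rightarrow> real^'m::finite" and g :: "'a \<Rightarrow> real^'n::finite"
  assumes "set_borel_measurable M U f" "set_borel_measurable M U g"
  shows "set_borel_measurable M U (\<lambda>x. outer_product (f x) (g x))"
proof -
  have c: "continuous_on UNIV (\<lambda>z. outer_product (fst z) (snd z) :: real^'n^'m)"
    unfolding outer_product_def by (intro continuous_intros)
  have "(\<lambda>x. outer_product (indicat_real U x *\<^sub>R f x) (indicat_real U x *\<^sub>R g x)) \<in> borel_measurable M"
    using assms unfolding set_borel_measurable_def by (rule borel_measurable_continuous_Pair[OF _ _ c])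
  moreover have "outer_product (indicat_real U x *\<^sub>R f x) (indicat_real U x *\<^sub>R g x) =
      indicat_real U x *\<^sub>R outer_product (f x) (g x)" for x
    by (cases "x \<in> U") (auto simp: outer_product_def vec_eq_iff)
  ultimately show ?thesis by (simp add: set_borel_measurable_def)
qed

text \<open>A field on \<open>F\<close> multiplied by a cutoff \<open>\<theta>\<close> that vanishes near \<open>\<Omega> - F\<close> extends by \<open>0\<close> to a field in
  \<open>H\<^sup>1(\<Omega>)\<close>.  The weak product rule follows by testing the gradient of \<open>w\<close> with \<open>\<theta> \<eta>\<close>, which is supported
  in \<open>F\<close> when \<open>\<eta>\<close> is supported in \<open>\<Omega>\<close>.\<close>

lemma H1_cutoff:
  assumes F: "open F" "F \<subseteq> \<Omega>" and \<Omega>: "open \<Omega>"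
    and \<theta>: "smooth \<theta>" "\<And>x. \<bar>\<theta> x\<bar> \<le> C" "\<And>x. norm (grad \<theta> x) \<le> C"
    and N: "open N" "\<Omega> - F \<subseteq> N" "\<And>x. x \<in> N \<Longrightarrow> \<theta> x = 0"
    and w: "H1 F w Dw"
  shows "H1 \<Omega> (\<lambda>x. \<theta> x *\<^sub>R w x) (\<lambda>x. \<theta> x *\<^sub>R Dw x + outer_product (w x) (grad \<theta> x))"
proof -
  have gN: "grad \<theta> x = 0" if "x \<in> N" for x
    using that N grad_zero_outside[of "- N" \<theta> x] by (simp add: closed_Compl)
  have BF: "F \<in> sets borel" and B\<Omega>: "\<Omega> \<in> sets borel" using F(1) \<Omega> by simp_all
  have m: "set_borel_measurable lebesgue F \<theta>" "set_borel_measurable lebesgue F (grad \<theta>)"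
    using set_borel_measurable_continuous_lebesgue[OF BF] smooth_continuous_on[OF \<theta>(1)]
      continuous_on_subset[OF continuous_on_grad[OF \<theta>(1)]] by blast+
  have LF: "L2 F w" "L2 F Dw" using w unfolding H1_def by blast+
  have mF: "set_borel_measurable lebesgue F w" "set_borel_measurable lebesgue F Dw"
    using LF unfolding square_integrable_on_def by blast+
  have extend: "set_borel_measurable lebesgue \<Omega> f"
    if "set_borel_measurable lebesgue F f" "\<And>x. x \<in> \<Omega> - F \<Longrightarrow> f x = 0"
    for f :: "real^'a \<Rightarrow> 'c::{second_countable_topology, real_normed_vector}"
  proof -
    have "(\<lambda>x. indicat_real \<Omega> x *\<^sub>R f x) = (\<lambda>x. indicat_real F x *\<^sub>R f x)"
    proof
      show "indicat_real \<Omega> x *\<^sub>R f x = indicat_real F x *\<^sub>R f x" for x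
        using that(2)[of x] F(2) by (cases "x \<in> F"; cases "x \<in> \<Omega>") auto
    qed
    then show ?thesis using that(1) by (simp only: set_borel_measurable_def)
  qed
  have 0: "\<theta> x = 0" "grad \<theta> x = 0" if "x \<in> \<Omega> - F" for x
    using that N gN by blast+
  have LO: "L2 F (\<lambda>x. outer_product (w x) (grad \<theta> x))"
  proof (rule square_integrable_on_dominated[OF LF(1,1), of _ _ C])
    show "norm (outer_product (w x) (grad \<theta> x)) \<le> C * (norm (w x) + norm (w x))" for x
    proof -
      have "norm (w x) * norm (grad \<theta> x) \<le> (norm (w x) + norm (w x)) * C"
        using \<theta>(3)[of x] by (intro mult_mono) auto
      then show ?thesis by (simp add: norm_outer_product mult.commute)
    qed
  qed (use set_borel_measurable_outer_product[OF mF(1) m(2)] in simp_all)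
  have L1: "L2 F (\<lambda>x. \<theta> x *\<^sub>R w x)" "L2 F (\<lambda>x. \<theta> x *\<^sub>R Dw x)"
    using LF m(1) \<theta>(2) by (auto intro: square_integrable_on_scaleR_bounded)
  have LD: "L2 F (\<lambda>x. \<theta> x *\<^sub>R Dw x + outer_product (w x) (grad \<theta> x))"
    by (rule square_integrable_on_add[OF L1(2) LO])
  have extL: "L2 \<Omega> f" if "L2 F f" "\<And>x. x \<in> \<Omega> - F \<Longrightarrow> f x = 0" for f :: "real^'a \<Rightarrow> 'c::euclidean_space"
    using that by (intro square_integrable_on_dominated[OF that(1,1), of _ _ 1] extend) (auto simp: square_integrable_on_def)
  show ?thesis
    unfolding H1_def
  proof (intro conjI)
    show "L2 \<Omega> (\<lambda>x. \<theta> x *\<^sub>R w x)" using L1(1) 0 by (intro extL) auto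
    show "L2 \<Omega> (\<lambda>x. \<theta> x *\<^sub>R Dw x + outer_product (w x) (grad \<theta> x))" using LD 0 by (intro extL) auto
    show "has_weak_gradient \<Omega> (\<lambda>x. \<theta> x *\<^sub>R w x) (\<lambda>x. \<theta> x *\<^sub>R Dw x + outer_product (w x) (grad \<theta> x))"
      unfolding has_weak_gradient_def
    proof (intro ballI allI)
      fix \<eta> :: "real^'a \<Rightarrow> real" and i j assume \<eta>: "\<eta> \<in> test_functions \<Omega>"
      obtain S where S: "compact S" "S \<subseteq> \<Omega>" "\<forall>x. x \<notin> S \<longrightarrow> \<eta> x = 0"
        using test_function_support[OF \<eta>] by (elim exE conjE)
      have \<theta>\<eta>: "(\<lambda>x. \<theta> x * \<eta> x) \<in> test_functions F"
      proof (rule test_functionI[of _ "S \<inter> - N"])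
        show "smooth (\<lambda>x. \<theta> x * \<eta> x)" by (rule smooth_mult[OF \<theta>(1) test_function_smooth[OF \<eta>]])
        show "compact (S \<inter> - N)" using S(1) N(1) by (intro compact_Int_closed closed_Compl)
        show "S \<inter> - N \<subseteq> F" using S(2) N(2) by blast
        show "\<theta> x * \<eta> x = 0" if "x \<notin> S \<inter> - N" for x using that S(3) N(3) by auto
      qed
      note g = grad_mult[OF \<theta>(1) test_function_smooth[OF \<eta>]]
      have i1: "set_integrable lebesgue F (\<lambda>x. w x $ i * grad (\<lambda>x. \<theta> x * \<eta> x) x $ j)"
        by (intro set_integrable_mult_square_integrable square_integrable_on_vec_nth LF
            L2_grad_test_function[OF \<theta>\<eta> BF])
      have i2: "set_integrable lebesgue F (\<lambda>x. outer_product (w x) (grad \<theta> x) $ i $ j * \<eta> x)"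
        by (intro set_integrable_mult_square_integrable square_integrable_on_vec_nth LO
            L2_test_function[OF \<eta> BF])
      have i3: "set_integrable lebesgue F (\<lambda>x. Dw x $ i $ j * (\<theta> x * \<eta> x))"
        by (intro set_integrable_mult_square_integrable square_integrable_on_vec_nth LF
            L2_test_function[OF \<theta>\<eta> BF])
      have "(LINT x:\<Omega>|lebesgue. (\<theta> x *\<^sub>R w x) $ i * grad \<eta> x $ j) =
          (LINT x:F|lebesgue. (\<theta> x *\<^sub>R w x) $ i * grad \<eta> x $ j)"
        using F(2) 0 by (intro set_integral_eq_zero_outside) auto
      also have "\<dots> = (LINT x:F|lebesgue. w x $ i * grad (\<lambda>x. \<theta> x * \<eta> x) x $ j -
          outer_product (w x) (grad \<theta> x) $ i $ j * \<eta> x)"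
        unfolding g by (simp add: outer_product_nth algebra_simps)
      also have "\<dots> = (LINT x:F|lebesgue. w x $ i * grad (\<lambda>x. \<theta> x * \<eta> x) x $ j) -
          (LINT x:F|lebesgue. outer_product (w x) (grad \<theta> x) $ i $ j * \<eta> x)"
        by (rule set_integral_diff(2)[OF i1 i2])
      also have "(LINT x:F|lebesgue. w x $ i * grad (\<lambda>x. \<theta> x * \<eta> x) x $ j) =
          - (LINT x:F|lebesgue. Dw x $ i $ j * (\<theta> x * \<eta> x))"
        using w \<theta>\<eta> unfolding H1_def has_weak_gradient_def by blast
      also have "- (LINT x:F|lebesgue. Dw x $ i $ j * (\<theta> x * \<eta> x)) -
          (LINT x:F|lebesgue. outer_product (w x) (grad \<theta> x) $ i $ j * \<eta> x) =
          - (LINT x:F|lebesgue. Dw x $ i $ j * (\<theta> x * \<eta> x) + outer_product (w x) (grad \<theta> x) $ i $ j * \<eta> x)"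
        using set_integral_add(2)[OF i3 i2] by simp
      also have "\<dots> = - (LINT x:F|lebesgue. (\<theta> x *\<^sub>R Dw x + outer_product (w x) (grad \<theta> x)) $ i $ j * \<eta> x)"
        by (simp add: algebra_simps)
      also have "\<dots> = - (LINT x:\<Omega>|lebesgue. (\<theta> x *\<^sub>R Dw x + outer_product (w x) (grad \<theta> x)) $ i $ j * \<eta> x)"
        using F(2) 0 by (intro arg_cong[where f=uminus] set_integral_eq_zero_outside[symmetric]) auto
      finally show "(LINT x:\<Omega>|lebesgue. (\<theta> x *\<^sub>R w x) $ i * grad \<eta> x $ j) =
          - (LINT x:\<Omega>|lebesgue. (\<theta> x *\<^sub>R Dw x + outer_product (w x) (grad \<theta> x)) $ i $ j * \<eta> x)" .
    qed
  qed
qed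

lemma has_trace_subset:
  assumes "has_trace U S u Du g" "S' \<subseteq> S" "S' \<in> sets borel"
  shows "has_trace U S' u Du g"
proof -
  obtain w Dw where w: "\<forall>k::nat. H1 U (w k) (Dw k) \<and> continuous_on (closure U) (w k)"
    "(\<lambda>k. \<integral>\<^sup>+x\<in>U. ennreal ((norm (w k x - u x))\<^sup>2) \<partial>lebesgue) \<longlonglongrightarrow> 0"
    "(\<lambda>k. \<integral>\<^sup>+x\<in>U. ennreal ((norm (Dw k x - Du x))\<^sup>2) \<partial>lebesgue) \<longlonglongrightarrow> 0"
    "(\<lambda>k. \<integral>\<^sup>+x\<in>S. ennreal ((norm (w k x - g x))\<^sup>2) \<partial>surface_measure) \<longlonglongrightarrow> 0"
    using assms(1) unfolding has_trace_def by (elim conjE exE)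
  have "(\<lambda>k. \<integral>\<^sup>+x\<in>S'. ennreal ((norm (w k x - g x))\<^sup>2) \<partial>surface_measure) \<longlonglongrightarrow> 0"
  proof (rule tendsto_sandwich[OF _ _ tendsto_const w(4)])
    show "\<forall>\<^sub>F k in sequentially. (\<integral>\<^sup>+x\<in>S'. ennreal ((norm (w k x - g x))\<^sup>2) \<partial>surface_measure) \<le>
        (\<integral>\<^sup>+x\<in>S. ennreal ((norm (w k x - g x))\<^sup>2) \<partial>surface_measure)"
      using assms(2) by (intro always_eventually allI nn_integral_mono mult_left_mono) (auto split: split_indicator)
  qed simp
  moreover have "square_integrable_on surface_measure S' g"
  proof (rule square_integrable_on_subset[OF _ _ assms(2)])
    show "square_integrable_on surface_measure S g" using assms(1) unfolding has_trace_def by (rule conjunct1)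
  qed (use assms(3) in simp)
  ultimately show ?thesis
    unfolding has_trace_def using w(1-3) by (intro conjI exI[of _ w] exI[of _ Dw])
qed

text \<open>On the empty set the trace is arbitrary: this is the condition on the rest of the boundary in a
  lifting from the whole boundary.\<close>

lemma has_trace_empty:
  assumes "has_trace U S u Du g"
  shows "has_trace U {} u Du h"
proof -
  obtain w Dw where w: "\<forall>k::nat. H1 U (w k) (Dw k) \<and> continuous_on (closure U) (w k)"
    "(\<lambda>k. \<integral>\<^sup>+x\<in>U. ennreal ((norm (w k x - u x))\<^sup>2) \<partial>lebesgue) \<longlonglongrightarrow> 0"
    "(\<lambda>k. \<integral>\<^sup>+x\<in>U. ennreal ((norm (Dw k x - Du x))\<^sup>2) \<partial>lebesgue) \<longlonglongrightarrow> 0"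
    using assms unfolding has_trace_def by (elim conjE exE)
  have "(\<lambda>k. \<integral>\<^sup>+x\<in>{}. ennreal ((norm (w k x - h x))\<^sup>2) \<partial>surface_measure) \<longlonglongrightarrow> 0"
    by simp
  moreover have "square_integrable_on surface_measure {} h"
    by (simp add: square_integrable_on_def set_borel_measurable_def)
  ultimately show ?thesis
    unfolding has_trace_def using w by (intro conjI exI[of _ w] exI[of _ Dw])
qed

text \<open>The differences of the approximating sequences approximate the difference.  The inclusion
  \<open>S \<subseteq> closure U\<close> makes their restrictions to \<open>S\<close> measurable, which subadditivity of the surface
  integrals requires.\<close>

lemma has_trace_diff:
  assumes U: "open U" and S: "S \<in> sets borel" "S \<subseteq> closure U"
    and u: "has_trace U S u Du g" and v: "has_trace U S v Dv h"
    and L: "L2 U u" "L2 U Du" "L2 U v" "L2 U Dv"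
  shows "has_trace U S (\<lambda>x. u x - v x) (\<lambda>x. Du x - Dv x) (\<lambda>x. g x - h x)"
proof -
  obtain w Dw where w: "\<forall>k::nat. H1 U (w k) (Dw k) \<and> continuous_on (closure U) (w k)"
    "(\<lambda>k. \<integral>\<^sup>+x\<in>U. ennreal ((norm (w k x - u x))\<^sup>2) \<partial>lebesgue) \<longlonglongrightarrow> 0"
    "(\<lambda>k. \<integral>\<^sup>+x\<in>U. ennreal ((norm (Dw k x - Du x))\<^sup>2) \<partial>lebesgue) \<longlonglongrightarrow> 0"
    "(\<lambda>k. \<integral>\<^sup>+x\<in>S. ennreal ((norm (w k x - g x))\<^sup>2) \<partial>surface_measure) \<longlonglongrightarrow> 0"
    using u unfolding has_trace_def by (elim conjE exE)
  obtain z Dz where z: "\<forall>k::nat. H1 U (z k) (Dz k) \<and> continuous_on (closure U) (z k)"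
    "(\<lambda>k. \<integral>\<^sup>+x\<in>U. ennreal ((norm (z k x - v x))\<^sup>2) \<partial>lebesgue) \<longlonglongrightarrow> 0"
    "(\<lambda>k. \<integral>\<^sup>+x\<in>U. ennreal ((norm (Dz k x - Dv x))\<^sup>2) \<partial>lebesgue) \<longlonglongrightarrow> 0"
    "(\<lambda>k. \<integral>\<^sup>+x\<in>S. ennreal ((norm (z k x - h x))\<^sup>2) \<partial>surface_measure) \<longlonglongrightarrow> 0"
    using v unfolding has_trace_def by (elim conjE exE)
  have gh: "square_integrable_on surface_measure S g" "square_integrable_on surface_measure S h"
    using u v unfolding has_trace_def by (simp_all only:)
  have mS: "set_borel_measurable surface_measure S (\<lambda>x. y x - f x)"
    if "continuous_on (closure U) y" "square_integrable_on surface_measure S f" for y f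
    using that set_borel_measurable_continuous_surface[OF S(1) continuous_on_subset[OF _ S(2)], of y]
    by (intro set_borel_measurable_diff) (simp_all add: square_integrable_on_def)
  have mU: "set_borel_measurable lebesgue U (\<lambda>x. y x - f x)"
    if "L2 U y" "L2 U f" for y f :: "real^'a \<Rightarrow> 'b::euclidean_space"
    using that by (intro set_borel_measurable_diff) (simp_all add: square_integrable_on_def)
  have tri: "norm (a - b - (c - d)) \<le> 1 * (norm (a - c) + norm (b - d))" for a b c d :: "'b::real_normed_vector"
    using norm_triangle_ineq4[of "a - c" "b - d"] by (simp add: algebra_simps)
  show ?thesis
    unfolding has_trace_def
  proof (intro conjI exI[of _ "\<lambda>k x. w k x - z k x"] exI[of _ "\<lambda>k x. Dw k x - Dz k x"] allI)
    show "square_integrable_on surface_measure S (\<lambda>x. g x - h x)"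
      by (rule square_integrable_on_diff[OF gh])
    show "H1 U (\<lambda>x. w k x - z k x) (\<lambda>x. Dw k x - Dz k x)" for k
      using w(1) z(1) by (blast intro: H1_diff[OF U])
    show "continuous_on (closure U) (\<lambda>x. w k x - z k x)" for k
      using w(1) z(1) by (blast intro: continuous_on_diff)
    show "(\<lambda>k. \<integral>\<^sup>+x\<in>U. ennreal ((norm (w k x - z k x - (u x - v x)))\<^sup>2) \<partial>lebesgue) \<longlonglongrightarrow> 0"
      using w(1) z(1) L unfolding H1_def
      by (intro nn_integral_norm_square_tendsto_0_dominated[OF _ _ w(2) z(2) tri] mU) simp_all
    show "(\<lambda>k. \<integral>\<^sup>+x\<in>U. ennreal ((norm (Dw k x - Dz k x - (Du x - Dv x)))\<^sup>2) \<partial>lebesgue) \<longlonglongrightarrow> 0"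
      using w(1) z(1) L unfolding H1_def
      by (intro nn_integral_norm_square_tendsto_0_dominated[OF _ _ w(3) z(3) tri] mU) simp_all
    show "(\<lambda>k. \<integral>\<^sup>+x\<in>S. ennreal ((norm (w k x - z k x - (g x - h x)))\<^sup>2) \<partial>surface_measure) \<longlonglongrightarrow> 0"
      using w(1) z(1) gh
      by (intro nn_integral_norm_square_tendsto_0_dominated[OF _ _ w(4) z(4) tri] mS) simp_all
  qed
qed

text \<open>Multiplication by \<open>a\<close>, with gradient \<open>A\<close>, maps an approximating sequence for \<open>u\<close> on \<open>U\<close> to one for \<open>a u\<close> on
  \<open>U'\<close>.  Two multipliers have the properties assumed here: locally constant functions on \<open>closure U\<close>, with
  \<open>A = 0\<close> and \<open>U' = U\<close>, and cutoffs, with \<open>A = \<nabla>a\<close> and a larger set \<open>U'\<close>.\<close>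

lemma has_trace_multiplier:
  assumes UU': "U \<subseteq> U'" and S: "S \<in> sets borel" "S \<subseteq> closure U"
    and u: "has_trace U S u Du g" "L2 U u" "L2 U Du"
    and bound: "\<And>x. x \<in> U \<Longrightarrow> \<bar>a x\<bar> \<le> C" "\<And>x. x \<in> U \<Longrightarrow> norm (A x) \<le> C" "\<And>x. x \<in> S \<Longrightarrow> \<bar>a x\<bar> \<le> C"
    and zero: "\<And>x. x \<in> U' - U \<Longrightarrow> a x = 0" "\<And>x. x \<in> U' - U \<Longrightarrow> A x = 0"
    and H1: "\<And>w Dw. H1 U w Dw \<Longrightarrow> H1 U' (\<lambda>x. a x *\<^sub>R w x) (\<lambda>x. a x *\<^sub>R Dw x + outer_product (w x) (A x))"
    and cont: "\<And>w::real^'n::finite \<Rightarrow> real^'n. continuous_on (closure U) w \<Longrightarrow> continuous_on (closure U') (\<lambda>x. a x *\<^sub>R w x)"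
    and h: "square_integrable_on surface_measure S h" "\<And>x. x \<in> S \<Longrightarrow> h x = a x *\<^sub>R g x"
  shows "has_trace U' S (\<lambda>x. a x *\<^sub>R u x) (\<lambda>x. a x *\<^sub>R Du x + outer_product (u x) (A x)) h"
proof -
  obtain w Dw where w: "\<forall>k::nat. H1 U (w k) (Dw k) \<and> continuous_on (closure U) (w k)"
    "(\<lambda>k. \<integral>\<^sup>+x\<in>U. ennreal ((norm (w k x - u x))\<^sup>2) \<partial>lebesgue) \<longlonglongrightarrow> 0"
    "(\<lambda>k. \<integral>\<^sup>+x\<in>U. ennreal ((norm (Dw k x - Du x))\<^sup>2) \<partial>lebesgue) \<longlonglongrightarrow> 0"
    "(\<lambda>k. \<integral>\<^sup>+x\<in>S. ennreal ((norm (w k x - g x))\<^sup>2) \<partial>surface_measure) \<longlonglongrightarrow> 0"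
    using u(1) unfolding has_trace_def by (elim conjE exE)
  have mS: "set_borel_measurable surface_measure S (\<lambda>x. w k x - g x)" for k
  proof (rule set_borel_measurable_diff)
    show "set_borel_measurable surface_measure S (w k)"
      using w(1) by (intro set_borel_measurable_continuous_surface[OF S(1) continuous_on_subset[OF _ S(2)]]) blast
    have "square_integrable_on surface_measure S g" using u(1) unfolding has_trace_def by (rule conjunct1)
    then show "set_borel_measurable surface_measure S g" by (simp add: square_integrable_on_def)
  qed
  have mU: "set_borel_measurable lebesgue U (\<lambda>x. w k x - u x)" "set_borel_measurable lebesgue U (\<lambda>x. Dw k x - Du x)" for k
    using w(1) u(2,3) by (auto intro!: set_borel_measurable_diff simp: square_integrable_on_def H1_def)
  have le: "norm (c *\<^sub>R y) \<le> C * (norm y + norm z)" if "\<bar>c\<bar> \<le> C"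
    for c and y :: "'b::real_normed_vector" and z :: "'c::real_normed_vector"
  proof -
    have "\<bar>c\<bar> * norm y \<le> C * (norm y + norm z)" using that by (intro mult_mono) auto
    then show ?thesis by simp
  qed
  show ?thesis
    unfolding has_trace_def
  proof (intro conjI exI[of _ "\<lambda>k x. a x *\<^sub>R w k x"] exI[of _ "\<lambda>k x. a x *\<^sub>R Dw k x + outer_product (w k x) (A x)"] allI h(1))
    show "H1 U' (\<lambda>x. a x *\<^sub>R w k x) (\<lambda>x. a x *\<^sub>R Dw k x + outer_product (w k x) (A x))" for k
      using w(1) by (intro H1) blast
    show "continuous_on (closure U') (\<lambda>x. a x *\<^sub>R w k x)" for k
      using w(1) by (intro cont) blast
    show "(\<lambda>k. \<integral>\<^sup>+x\<in>U'. ennreal ((norm (a x *\<^sub>R w k x - a x *\<^sub>R u x))\<^sup>2) \<partial>lebesgue) \<longlonglongrightarrow> 0"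
    proof (rule nn_integral_norm_square_tendsto_0_dominated[OF mU(1) mU(1) w(2) w(2)])
      show "norm (a x *\<^sub>R w k x - a x *\<^sub>R u x) \<le> C * (norm (w k x - u x) + norm (w k x - u x))"
        if "x \<in> U" for k x
        using le[OF bound(1)[OF that], of "w k x - u x" "w k x - u x"] by (simp flip: scaleR_diff_right)
    qed (use zero in simp)
    show "(\<lambda>k. \<integral>\<^sup>+x\<in>U'. ennreal ((norm (a x *\<^sub>R Dw k x + outer_product (w k x) (A x) -
        (a x *\<^sub>R Du x + outer_product (u x) (A x))))\<^sup>2) \<partial>lebesgue) \<longlonglongrightarrow> 0"
    proof (rule nn_integral_norm_square_tendsto_0_dominated[OF mU(2) mU(1) w(3) w(2)])
      fix k x assume x: "x \<in> U"
      have eq: "a x *\<^sub>R Dw k x + outer_product (w k x) (A x) - (a x *\<^sub>R Du x + outer_product (u x) (A x)) =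
          a x *\<^sub>R (Dw k x - Du x) + outer_product (w k x - u x) (A x)"
        by (simp add: outer_product_diff_left scaleR_diff_right)
      have "norm (a x *\<^sub>R (Dw k x - Du x) + outer_product (w k x - u x) (A x)) \<le>
          \<bar>a x\<bar> * norm (Dw k x - Du x) + norm (w k x - u x) * norm (A x)"
        using norm_triangle_ineq[of "a x *\<^sub>R (Dw k x - Du x)" "outer_product (w k x - u x) (A x)"]
        by (simp add: norm_outer_product)
      also have "\<dots> \<le> C * norm (Dw k x - Du x) + norm (w k x - u x) * C"
        using bound(1,2)[OF x] by (intro add_mono mult_right_mono mult_left_mono) auto
      finally show "norm (a x *\<^sub>R Dw k x + outer_product (w k x) (A x) - (a x *\<^sub>R Du x + outer_product (u x) (A x)))
          \<le> C * (norm (Dw k x - Du x) + norm (w k x - u x))"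
        unfolding eq by (simp add: distrib_left mult.commute)
    qed (use zero in simp)
    show "(\<lambda>k. \<integral>\<^sup>+x\<in>S. ennreal ((norm (a x *\<^sub>R w k x - h x))\<^sup>2) \<partial>surface_measure) \<longlonglongrightarrow> 0"
    proof (rule nn_integral_norm_square_tendsto_0_dominated[OF mS mS w(4) w(4)])
      show "norm (a x *\<^sub>R w k x - h x) \<le> C * (norm (w k x - g x) + norm (w k x - g x))" if "x \<in> S" for k x
        using le[OF bound(3)[OF that], of "w k x - g x" "w k x - g x"] by (simp add: h(2)[OF that] flip: scaleR_diff_right)
    qed simp
  qed
qed


section \<open>Normal traces\<close>

lemma distr_div_restrict:
  assumes "\<phi> \<in> test_functions A" "A \<subseteq> A'"
  shows "distr_div A' \<tau> \<phi> = distr_div A \<tau> \<phi>"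
  using assms(2) jacobian_test_function_zero_outside[OF assms(1)]
  unfolding distr_div_def by (intro arg_cong[where f = uminus] set_integral_eq_zero_outside) auto

lemma distr_div_add_scaleR:
  assumes "open A" "\<phi> \<in> test_functions A" "L2 A \<tau>" "L2 A \<tau>'"
  shows "distr_div A (\<lambda>x. \<tau> x + c *\<^sub>R \<tau>' x) \<phi> = distr_div A \<tau> \<phi> + c * distr_div A \<tau>' \<phi>"
proof -
  have J: "L2 A (jacobian \<phi>)" using assms(1,2) by (intro L2_jacobian_test_function) simp_all
  have i: "set_integrable lebesgue A (\<lambda>x. \<tau> x \<bullet> jacobian \<phi> x)" "set_integrable lebesgue A (\<lambda>x. \<tau>' x \<bullet> jacobian \<phi> x)"
    by (intro set_integrable_inner_square_integrable assms J)+
  have "set_integrable lebesgue A (\<lambda>x. c * (\<tau>' x \<bullet> jacobian \<phi> x))"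
    using i(2) by (intro set_integrable_mult_right) blast
  from set_integral_add(2)[OF i(1) this] show ?thesis
    by (simp add: distr_div_def inner_add_left set_integral_mult_right)
qed

lemma distr_div_locally_constant_scaleR:
  assumes "open A" "locally_constant_on A m" "\<phi> \<in> test_functions A"
  shows "distr_div A (\<lambda>x. m x *\<^sub>R \<tau> x) \<phi> = distr_div A \<tau> (\<lambda>x. m x *\<^sub>R \<phi> x)"
  by (simp add: distr_div_def jacobian_locally_constant_scaleR[OF assms])

lemma has_weak_divergence_subset:
  assumes "has_weak_divergence A \<tau> d" "A' \<subseteq> A"
  shows "has_weak_divergence A' \<tau> d"
  unfolding has_weak_divergence_def
proof
  fix \<phi> :: "real^'a \<Rightarrow> real^'a" assume \<phi>: "\<phi> \<in> test_functions A'"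
  have "distr_div A \<tau> \<phi> = (LINT x:A|lebesgue. d x \<bullet> \<phi> x)"
    using assms(1) test_functions_mono[OF \<phi> assms(2)] unfolding has_weak_divergence_def by blast
  also have "\<dots> = (LINT x:A'|lebesgue. d x \<bullet> \<phi> x)"
    using assms(2) test_function_zero_outside[OF \<phi>] by (intro set_integral_eq_zero_outside) auto
  finally show "distr_div A' \<tau> \<phi> = (LINT x:A'|lebesgue. d x \<bullet> \<phi> x)"
    by (simp add: distr_div_restrict[OF \<phi> assms(2)])
qed

lemma set_integrable_green:
  assumes "L2 A \<tau>" "L2 A d" "L2 A \<phi>" "L2 A D\<phi>"
  shows "set_integrable lebesgue A (\<lambda>x. \<tau> x \<bullet> D\<phi> x + d x \<bullet> \<phi> x)"
  using assms by (intro set_integral_add(1) set_integrable_inner_square_integrable)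

lemma is_lifting_L2:
  assumes "is_lifting U S \<psi> \<phi> D\<phi>" "open A" "A \<subseteq> U"
  shows "L2 A \<phi>" "L2 A D\<phi>"
proof -
  have "L2 U \<phi>" "L2 U D\<phi>" using assms(1) unfolding is_lifting_def H1_def by simp_all
  then show "L2 A \<phi>" "L2 A D\<phi>" using assms(2,3) by (auto intro: square_integrable_on_subset)
qed

text \<open>Green's formula on a fixed one-sided neighbourhood \<open>U \<inter> V\<close> with a fixed divergence \<open>d\<close>.  Normal traces
  of different tensor fields come with different neighbourhoods; naming them allows passing to a
  common one.\<close>

definition normal_trace_near ::
    "(real^'n::finite) set \<Rightarrow> (real^'n) set \<Rightarrow> (real^'n \<Rightarrow> real^'n^'n) \<Rightarrow> 'n functional \<Rightarrow>
     (real^'n) set \<Rightarrow> (real^'n \<Rightarrow> real^'n) \<Rightarrow> bool" where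
  "normal_trace_near U S \<tau> l V d \<longleftrightarrow>
     open V \<and> closure S \<subseteq> V \<and> L2 (U \<inter> V) \<tau> \<and> L2 (U \<inter> V) d \<and> has_weak_divergence (U \<inter> V) \<tau> d \<and>
     (\<forall>K \<psi> \<phi> D\<phi>. closed K \<and> K \<subseteq> V \<and> is_lifting U S \<psi> \<phi> D\<phi> \<and>
        (AE x in lebesgue. x \<in> U - K \<longrightarrow> \<phi> x = 0 \<and> D\<phi> x = 0) \<longrightarrow>
      l \<psi> = (LINT x:U \<inter> V|lebesgue. \<tau> x \<bullet> D\<phi> x + d x \<bullet> \<phi> x))"

lemma has_normal_trace_iff: "has_normal_trace U S \<tau> l \<longleftrightarrow> (\<exists>V d. normal_trace_near U S \<tau> l V d)"
  unfolding has_normal_trace_def normal_trace_near_def ..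

lemma normal_trace_nearD:
  assumes "normal_trace_near U S \<tau> l V d"
  shows "open V" "closure S \<subseteq> V" "L2 (U \<inter> V) \<tau>" "L2 (U \<inter> V) d" "has_weak_divergence (U \<inter> V) \<tau> d"
  using assms unfolding normal_trace_near_def by simp_all

lemma normal_trace_near_green:
  assumes "normal_trace_near U S \<tau> l V d" "closed K" "K \<subseteq> V" "is_lifting U S \<psi> \<phi> D\<phi>"
    "AE x in lebesgue. x \<in> U - K \<longrightarrow> \<phi> x = 0 \<and> D\<phi> x = 0"
  shows "l \<psi> = (LINT x:U \<inter> V|lebesgue. \<tau> x \<bullet> D\<phi> x + d x \<bullet> \<phi> x)"
  using assms unfolding normal_trace_near_def by meson

lemma normal_trace_nearI:
  assumes "open V" "closure S \<subseteq> V" "L2 (U \<inter> V) \<tau>" "L2 (U \<inter> V) d" "has_weak_divergence (U \<inter> V) \<tau> d"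
    and "\<And>K \<psi> \<phi> D\<phi>. closed K \<Longrightarrow> K \<subseteq> V \<Longrightarrow> is_lifting U S \<psi> \<phi> D\<phi> \<Longrightarrow>
        AE x in lebesgue. x \<in> U - K \<longrightarrow> \<phi> x = 0 \<and> D\<phi> x = 0 \<Longrightarrow>
      l \<psi> = (LINT x:U \<inter> V|lebesgue. \<tau> x \<bullet> D\<phi> x + d x \<bullet> \<phi> x)"
  shows "normal_trace_near U S \<tau> l V d"
  unfolding normal_trace_near_def using assms by (intro conjI allI impI; (elim conjE)?)

text \<open>Only liftings that vanish off a closed subset of the smaller neighbourhood are tested, so that the
  integrand vanishes on the part that is removed.\<close>

lemma normal_trace_near_shrink:
  assumes U: "open U" and tr: "normal_trace_near U S \<tau> l V d" and V': "open V'" "closure S \<subseteq> V'" "V' \<subseteq> V"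
  shows "normal_trace_near U S \<tau> l V' d"
proof (rule normal_trace_nearI[OF V'(1,2)])
  note D = normal_trace_nearD[OF tr]
  have sub: "U \<inter> V' \<subseteq> U \<inter> V" using V'(3) by blast
  have o: "open (U \<inter> V)" "open (U \<inter> V')" using U D(1) V'(1) by auto
  show L: "L2 (U \<inter> V') \<tau>" "L2 (U \<inter> V') d"
    using D(3,4) sub o(2) by (auto intro: square_integrable_on_subset)
  show "has_weak_divergence (U \<inter> V') \<tau> d" by (rule has_weak_divergence_subset[OF D(5) sub])
  fix K \<psi> \<phi> D\<phi>
  assume K: "closed K" "K \<subseteq> V'" and lift: "is_lifting U S \<psi> \<phi> D\<phi>"
    and ae: "AE x in lebesgue. x \<in> U - K \<longrightarrow> \<phi> x = 0 \<and> D\<phi> x = 0"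
  have "l \<psi> = (LINT x:U \<inter> V|lebesgue. \<tau> x \<bullet> D\<phi> x + d x \<bullet> \<phi> x)"
    using K V'(3) by (intro normal_trace_near_green[OF tr K(1) _ lift ae]) blast
  also have "\<dots> = (LINT x:U \<inter> V'|lebesgue. \<tau> x \<bullet> D\<phi> x + d x \<bullet> \<phi> x)"
  proof (rule set_integral_eq_AE_zero_outside[OF _ _ sub])
    show "set_integrable lebesgue (U \<inter> V) (\<lambda>x. \<tau> x \<bullet> D\<phi> x + d x \<bullet> \<phi> x)"
      by (rule set_integrable_green[OF D(3,4) is_lifting_L2[OF lift o(1) Int_lower1]])
    show "set_integrable lebesgue (U \<inter> V') (\<lambda>x. \<tau> x \<bullet> D\<phi> x + d x \<bullet> \<phi> x)"
      by (rule set_integrable_green[OF L is_lifting_L2[OF lift o(2) Int_lower1]])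
    show "AE x in lebesgue. x \<in> U \<inter> V - U \<inter> V' \<longrightarrow> \<tau> x \<bullet> D\<phi> x + d x \<bullet> \<phi> x = 0"
      using ae by (rule AE_mp) (use K(2) in \<open>auto intro!: AE_I2\<close>)
  qed
  finally show "l \<psi> = (LINT x:U \<inter> V'|lebesgue. \<tau> x \<bullet> D\<phi> x + d x \<bullet> \<phi> x)" .
qed

lemma has_normal_trace_add_scaleR:
  assumes U: "open U" and \<tau>: "has_normal_trace U S \<tau> l" and \<tau>': "has_normal_trace U S \<tau>' l'"
  shows "has_normal_trace U S (\<lambda>x. \<tau> x + c *\<^sub>R \<tau>' x) (\<lambda>\<psi>. l \<psi> + c * l' \<psi>)"
proof -
  obtain V1 d1 where 1: "normal_trace_near U S \<tau> l V1 d1" using \<tau> unfolding has_normal_trace_iff by (elim exE)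
  obtain V2 d2 where 2: "normal_trace_near U S \<tau>' l' V2 d2" using \<tau>' unfolding has_normal_trace_iff by (elim exE)
  define V where "V = V1 \<inter> V2"
  have V: "open V" "closure S \<subseteq> V"
    using normal_trace_nearD(1,2)[OF 1] normal_trace_nearD(1,2)[OF 2] unfolding V_def by auto
  have t: "normal_trace_near U S \<tau> l V d1" "normal_trace_near U S \<tau>' l' V d2"
    by (rule normal_trace_near_shrink[OF U 1 V], simp add: V_def)
       (rule normal_trace_near_shrink[OF U 2 V], simp add: V_def)
  note D1 = normal_trace_nearD[OF t(1)] and D2 = normal_trace_nearD[OF t(2)]
  have o: "open (U \<inter> V)" using U V(1) by auto
  have "normal_trace_near U S (\<lambda>x. \<tau> x + c *\<^sub>R \<tau>' x) (\<lambda>\<psi>. l \<psi> + c * l' \<psi>) V (\<lambda>x. d1 x + c *\<^sub>R d2 x)"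
  proof (rule normal_trace_nearI[OF V])
    show "L2 (U \<inter> V) (\<lambda>x. \<tau> x + c *\<^sub>R \<tau>' x)"
      by (rule square_integrable_on_add[OF D1(3) square_integrable_on_linear[OF D2(3) bounded_linear_scaleR_right]])
    show "L2 (U \<inter> V) (\<lambda>x. d1 x + c *\<^sub>R d2 x)"
      by (rule square_integrable_on_add[OF D1(4) square_integrable_on_linear[OF D2(4) bounded_linear_scaleR_right]])
    have lin: "(LINT x:U \<inter> V|lebesgue. f x) + c * (LINT x:U \<inter> V|lebesgue. g x) = (LINT x:U \<inter> V|lebesgue. f x + c * g x)"
      if "set_integrable lebesgue (U \<inter> V) f" "set_integrable lebesgue (U \<inter> V) g" for f g :: "real^'a \<Rightarrow> real"
    proof -
      have "set_integrable lebesgue (U \<inter> V) (\<lambda>x. c * g x)" using that(2) by (intro set_integrable_mult_right) blast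
      from set_integral_add(2)[OF that(1) this] show ?thesis by (simp add: set_integral_mult_right)
    qed
    show "has_weak_divergence (U \<inter> V) (\<lambda>x. \<tau> x + c *\<^sub>R \<tau>' x) (\<lambda>x. d1 x + c *\<^sub>R d2 x)"
      unfolding has_weak_divergence_def
    proof
      fix \<phi> :: "real^'a \<Rightarrow> real^'a" assume \<phi>: "\<phi> \<in> test_functions (U \<inter> V)"
      have L: "L2 (U \<inter> V) \<phi>" using o by (intro L2_test_function[OF \<phi>]) simp
      have "distr_div (U \<inter> V) (\<lambda>x. \<tau> x + c *\<^sub>R \<tau>' x) \<phi> =
          (LINT x:U \<inter> V|lebesgue. d1 x \<bullet> \<phi> x) + c * (LINT x:U \<inter> V|lebesgue. d2 x \<bullet> \<phi> x)"
        using D1(5) D2(5) \<phi> unfolding has_weak_divergence_def distr_div_add_scaleR[OF o \<phi> D1(3) D2(3)]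
        by simp
      also have "\<dots> = (LINT x:U \<inter> V|lebesgue. d1 x \<bullet> \<phi> x + c * (d2 x \<bullet> \<phi> x))"
        by (intro lin set_integrable_inner_square_integrable D1(4) D2(4) L)
      finally show "distr_div (U \<inter> V) (\<lambda>x. \<tau> x + c *\<^sub>R \<tau>' x) \<phi> = (LINT x:U \<inter> V|lebesgue. (d1 x + c *\<^sub>R d2 x) \<bullet> \<phi> x)"
        by (simp add: inner_add_left)
    qed
    fix K \<psi> \<phi> D\<phi>
    assume K: "closed K" "K \<subseteq> V" and lift: "is_lifting U S \<psi> \<phi> D\<phi>"
      and ae: "AE x in lebesgue. x \<in> U - K \<longrightarrow> \<phi> x = 0 \<and> D\<phi> x = 0"
    note L = is_lifting_L2[OF lift o Int_lower1]
    have "l \<psi> + c * l' \<psi> = (LINT x:U \<inter> V|lebesgue. \<tau> x \<bullet> D\<phi> x + d1 x \<bullet> \<phi> x) + c * (LINT x:U \<inter> V|lebesgue. \<tau>' x \<bullet> D\<phi> x + d2 x \<bullet> \<phi> x)"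
      using normal_trace_near_green[OF t(1) K lift ae] normal_trace_near_green[OF t(2) K lift ae] by simp
    also have "\<dots> = (LINT x:U \<inter> V|lebesgue. (\<tau> x \<bullet> D\<phi> x + d1 x \<bullet> \<phi> x) + c * (\<tau>' x \<bullet> D\<phi> x + d2 x \<bullet> \<phi> x))"
      by (intro lin set_integrable_green L D1(3,4) D2(3,4))
    finally show "l \<psi> + c * l' \<psi> = (LINT x:U \<inter> V|lebesgue. (\<tau> x + c *\<^sub>R \<tau>' x) \<bullet> D\<phi> x + (d1 x + c *\<^sub>R d2 x) \<bullet> \<phi> x)"
      by (simp add: inner_add_left algebra_simps)
  qed
  then show ?thesis unfolding has_normal_trace_iff by blast
qed

lemma has_normal_trace_cong:
  assumes "\<And>x. x \<in> U \<Longrightarrow> \<tau> x = \<tau>' x" "has_normal_trace U S \<tau> l"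
  shows "has_normal_trace U S \<tau>' l"
proof -
  obtain V d where t: "normal_trace_near U S \<tau> l V d" using assms(2) unfolding has_normal_trace_iff by (elim exE)
  note D = normal_trace_nearD[OF t]
  have eq: "(LINT x:U \<inter> V|lebesgue. f (\<tau> x) x) = (LINT x:U \<inter> V|lebesgue. f (\<tau>' x) x)" for f :: "_ \<Rightarrow> _ \<Rightarrow> real"
    unfolding set_lebesgue_integral_def using assms(1)
    by (intro Bochner_Integration.integral_cong) (auto simp: indicator_def)
  have "normal_trace_near U S \<tau>' l V d"
  proof (rule normal_trace_nearI[OF D(1,2)])
    show "L2 (U \<inter> V) \<tau>'"
      using D(3) square_integrable_on_cong[of "U \<inter> V" \<tau> \<tau>' lebesgue] assms(1) by blast
    show "has_weak_divergence (U \<inter> V) \<tau>' d"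
      using D(5) unfolding has_weak_divergence_def distr_div_def using eq[of "\<lambda>t x. t \<bullet> jacobian _ x"] by simp
    show "l \<psi> = (LINT x:U \<inter> V|lebesgue. \<tau>' x \<bullet> D\<phi> x + d x \<bullet> \<phi> x)"
      if "closed K" "K \<subseteq> V" "is_lifting U S \<psi> \<phi> D\<phi>" "AE x in lebesgue. x \<in> U - K \<longrightarrow> \<phi> x = 0 \<and> D\<phi> x = 0"
      for K \<psi> \<phi> D\<phi>
      using normal_trace_near_green[OF t that] eq[of "\<lambda>t x. t \<bullet> D\<phi> x + d x \<bullet> \<phi> x"] by simp
  qed (rule D(4))
  then show ?thesis unfolding has_normal_trace_iff by blast
qed

text \<open>The functions \<open>m\<close> and \<open>m'\<close> need to agree on the boundary only, since boundary fields matter only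
  there; for a viscosity, \<open>m'\<close> is a jump and has no meaning inside \<open>U\<close>.\<close>

lemma is_lifting_locally_constant_scaleR:
  assumes U: "open U" and m: "locally_constant_on (closure U) m" "\<And>x. x \<in> closure U \<Longrightarrow> \<bar>m x\<bar> \<le> C"
    and m': "\<And>x. x \<in> frontier U \<Longrightarrow> m' x = m x"
    and lift: "is_lifting U (frontier U) \<psi> \<phi> D\<phi>"
  shows "is_lifting U (frontier U) (\<lambda>x. m' x *\<^sub>R \<psi> x) (\<lambda>x. m x *\<^sub>R \<phi> x) (\<lambda>x. m x *\<^sub>R D\<phi> x)"
proof -
  have mU: "locally_constant_on U m" "\<And>x. x \<in> U \<Longrightarrow> \<bar>m x\<bar> \<le> C"
    using m closure_subset locally_constant_on_subset by blast+
  have H: "H1 U \<phi> D\<phi>" "has_trace U (frontier U) \<phi> D\<phi> \<psi>"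
    using lift unfolding is_lifting_def by simp_all
  have fr: "frontier U \<subseteq> closure U" by (simp add: frontier_def)
  have "square_integrable_on surface_measure (frontier U) (\<lambda>x. m x *\<^sub>R \<psi> x)"
  proof (rule square_integrable_on_scaleR_bounded)
    show "square_integrable_on surface_measure (frontier U) \<psi>"
      using H(2) unfolding has_trace_def by (rule conjunct1)
    show "set_borel_measurable surface_measure (frontier U) m"
      using locally_constant_on_continuous[OF locally_constant_on_subset[OF m(1) fr]]
      by (intro set_borel_measurable_continuous_surface) simp_all
  qed (use m(2) fr in blast)
  then have sq: "square_integrable_on surface_measure (frontier U) (\<lambda>x. m' x *\<^sub>R \<psi> x)"
    using square_integrable_on_cong[of "frontier U" "\<lambda>x. m x *\<^sub>R \<psi> x" "\<lambda>x. m' x *\<^sub>R \<psi> x" surface_measure] m' by simp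
  have "has_trace U (frontier U) (\<lambda>x. m x *\<^sub>R \<phi> x) (\<lambda>x. m x *\<^sub>R D\<phi> x + outer_product (\<phi> x) 0) (\<lambda>x. m' x *\<^sub>R \<psi> x)"
  proof (rule has_trace_multiplier[OF _ _ fr H(2), where C = "\<bar>C\<bar>"])
    show "\<bar>m x\<bar> \<le> \<bar>C\<bar>" if "x \<in> U" for x using mU(2)[OF that] by simp
    show "\<bar>m x\<bar> \<le> \<bar>C\<bar>" if "x \<in> frontier U" for x using m(2)[of x] that fr by force
    show "H1 U (\<lambda>x. m x *\<^sub>R w x) (\<lambda>x. m x *\<^sub>R Dw x + outer_product (w x) 0)" if "H1 U w Dw" for w Dw
      using H1_locally_constant_scaleR[OF U mU that] by simp
    show "continuous_on (closure U) (\<lambda>x. m x *\<^sub>R w x)" if "continuous_on (closure U) w" for w :: "real^'a \<Rightarrow> real^'a"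
      by (rule continuous_on_scaleR[OF locally_constant_on_continuous[OF m(1)] that])
  qed (use H(1) sq m' in \<open>simp_all add: H1_def\<close>)
  then have tr: "has_trace U (frontier U) (\<lambda>x. m x *\<^sub>R \<phi> x) (\<lambda>x. m x *\<^sub>R D\<phi> x) (\<lambda>x. m' x *\<^sub>R \<psi> x)"
    by simp
  show ?thesis
    unfolding is_lifting_def using H1_locally_constant_scaleR[OF U mU H(1)] tr has_trace_empty[OF tr] by simp
qed

text \<open>In Green's formula the factor \<open>m\<close> can be moved from the tensor field to the lifting, and \<open>m \<phi>\<close> is a
  lifting of \<open>m \<psi>\<close>: the normal trace of \<open>m \<tau>\<close> applied to \<open>\<psi>\<close> is that of \<open>\<tau>\<close> applied to \<open>m \<psi>\<close>.\<close>

lemma has_normal_trace_locally_constant_scaleR: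
  assumes U: "open U" and m: "locally_constant_on (closure U) m" "\<And>x. x \<in> closure U \<Longrightarrow> \<bar>m x\<bar> \<le> C"
    and m': "\<And>x. x \<in> frontier U \<Longrightarrow> m' x = m x"
    and \<tau>: "has_normal_trace U (frontier U) \<tau> l"
  shows "has_normal_trace U (frontier U) (\<lambda>x. m x *\<^sub>R \<tau> x) (\<lambda>\<psi>. l (\<lambda>x. m' x *\<^sub>R \<psi> x))"
proof -
  obtain V d where t: "normal_trace_near U (frontier U) \<tau> l V d" using \<tau> unfolding has_normal_trace_iff by (elim exE)
  note D = normal_trace_nearD[OF t]
  have o: "open (U \<inter> V)" using U D(1) by auto
  have sub: "U \<inter> V \<subseteq> closure U" using closure_subset by blast
  have mA: "locally_constant_on (U \<inter> V) m" by (rule locally_constant_on_subset[OF m(1) sub])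
  have mm: "set_borel_measurable lebesgue (U \<inter> V) m"
    using o locally_constant_on_continuous[OF mA] by (intro set_borel_measurable_continuous_lebesgue) simp_all
  have mb: "\<bar>m x\<bar> \<le> C" if "x \<in> U \<inter> V" for x using m(2) sub that by blast
  have "normal_trace_near U (frontier U) (\<lambda>x. m x *\<^sub>R \<tau> x) (\<lambda>\<psi>. l (\<lambda>x. m' x *\<^sub>R \<psi> x)) V (\<lambda>x. m x *\<^sub>R d x)"
  proof (rule normal_trace_nearI[OF D(1,2)])
    show "L2 (U \<inter> V) (\<lambda>x. m x *\<^sub>R \<tau> x)" by (rule square_integrable_on_scaleR_bounded[OF D(3) mm mb])
    show "L2 (U \<inter> V) (\<lambda>x. m x *\<^sub>R d x)" by (rule square_integrable_on_scaleR_bounded[OF D(4) mm mb])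
    show "has_weak_divergence (U \<inter> V) (\<lambda>x. m x *\<^sub>R \<tau> x) (\<lambda>x. m x *\<^sub>R d x)"
      unfolding has_weak_divergence_def
    proof
      fix \<phi> :: "real^'a \<Rightarrow> real^'a" assume \<phi>: "\<phi> \<in> test_functions (U \<inter> V)"
      have "distr_div (U \<inter> V) \<tau> (\<lambda>x. m x *\<^sub>R \<phi> x) = (LINT x:U \<inter> V|lebesgue. d x \<bullet> (m x *\<^sub>R \<phi> x))"
        using D(5) test_functions_locally_constant_scaleR[OF o mA \<phi>] unfolding has_weak_divergence_def by (rule bspec)
      then show "distr_div (U \<inter> V) (\<lambda>x. m x *\<^sub>R \<tau> x) \<phi> = (LINT x:U \<inter> V|lebesgue. (m x *\<^sub>R d x) \<bullet> \<phi> x)"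
        by (simp add: distr_div_locally_constant_scaleR[OF o mA \<phi>])
    qed
    fix K \<psi> \<phi> D\<phi>
    assume K: "closed K" "K \<subseteq> V" and lift: "is_lifting U (frontier U) \<psi> \<phi> D\<phi>"
      and ae: "AE x in lebesgue. x \<in> U - K \<longrightarrow> \<phi> x = 0 \<and> D\<phi> x = 0"
    have "AE x in lebesgue. x \<in> U - K \<longrightarrow> m x *\<^sub>R \<phi> x = 0 \<and> m x *\<^sub>R D\<phi> x = 0"
      using ae by (rule AE_mp) (auto intro!: AE_I2)
    from normal_trace_near_green[OF t K is_lifting_locally_constant_scaleR[OF U m m' lift] this]
    show "l (\<lambda>x. m' x *\<^sub>R \<psi> x) = (LINT x:U \<inter> V|lebesgue. (m x *\<^sub>R \<tau> x) \<bullet> D\<phi> x + (m x *\<^sub>R d x) \<bullet> \<phi> x)"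
      by simp
  qed
  then show ?thesis unfolding has_normal_trace_iff by blast
qed

text \<open>The normal trace on the outer boundary depends only on a neighbourhood of it, but the fields that it
  is tested with live on \<open>\<Omega>\<close> in one case and on \<open>\<Omega> - D\<close> in the other.  A lifting that vanishes off a closed set \<open>K\<close> disjoint from
  \<open>D\<close> is unchanged by a cutoff that is \<open>1\<close> on \<open>K\<close> and \<open>0\<close> near \<open>D\<close>, and its product with the cutoff extends by
  \<open>0\<close> to \<open>\<Omega>\<close>.\<close>

lemma has_normal_trace_away_from_compact:
  fixes \<Omega> D :: "(real^'n::finite) set"
  assumes \<Omega>: "open \<Omega>" and D: "compact D" "D \<subseteq> \<Omega>"
    and S: "S \<subseteq> frontier \<Omega>" "S \<in> sets borel" and \<tau>: "has_normal_trace \<Omega> S \<tau> l"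
  shows "has_normal_trace (\<Omega> - D) S \<tau> l"
proof -
  define F where "F = \<Omega> - D"
  have F: "open F" "F \<subseteq> \<Omega>" unfolding F_def using \<Omega> compact_imp_closed[OF D(1)] by auto
  have clF: "closure \<Omega> = closure F \<union> D"
  proof -
    have "\<Omega> = F \<union> D" unfolding F_def using D(2) by blast
    then show ?thesis using closure_Un[of F D] closure_closed[OF compact_imp_closed[OF D(1)]] by simp
  qed
  have frD: "frontier \<Omega> \<inter> \<Omega> = {}" using \<Omega> by (simp add: frontier_disjoint_eq)
  have frF: "frontier \<Omega> \<subseteq> closure F"
    using frD D(2) clF by (auto simp: frontier_def)
  have frFF: "frontier \<Omega> \<subseteq> frontier F"
    using frF frD F by (auto simp: frontier_def interior_open)
  obtain V0 d where t0: "normal_trace_near \<Omega> S \<tau> l V0 d" using \<tau> unfolding has_normal_trace_iff by (elim exE)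
  define V where "V = V0 - D"
  have "closure S \<subseteq> frontier \<Omega>" using S(1) by (intro closure_minimal) auto
  then have V: "open V" "closure S \<subseteq> V"
    using normal_trace_nearD(1,2)[OF t0] D frD compact_imp_closed[OF D(1)] unfolding V_def by (auto intro: open_Diff)
  have t: "normal_trace_near \<Omega> S \<tau> l V d"
    by (rule normal_trace_near_shrink[OF \<Omega> t0 V]) (simp add: V_def)
  note N = normal_trace_nearD[OF t]
  have FV: "F \<inter> V = \<Omega> \<inter> V" unfolding F_def V_def by blast
  have oV: "open (\<Omega> \<inter> V)" using \<Omega> V(1) by auto
  have "normal_trace_near F S \<tau> l V d"
  proof (rule normal_trace_nearI[OF V])
    fix K \<psi> \<phi> D\<phi>
    assume K: "closed K" "K \<subseteq> V" and lift: "is_lifting F S \<psi> \<phi> D\<phi>"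
      and ae: "AE x in lebesgue. x \<in> F - K \<longrightarrow> \<phi> x = 0 \<and> D\<phi> x = 0"
    have "open (\<Omega> - K)" "D \<subseteq> \<Omega> - K" using \<Omega> K D(2) unfolding V_def by auto
    then obtain b M where b: "b \<in> test_functions (\<Omega> - K)" "open M" "D \<subseteq> M" "\<And>x. x \<in> M \<Longrightarrow> b x = (1::real)"
      using cutoff_exists[OF D(1)] by (metis (no_types, lifting))
    \<comment> \<open>\<open>\<theta>\<close> is \<open>1\<close> on \<open>K\<close> and off \<open>\<Omega>\<close>, so that multiplication by it preserves the traces on \<open>frontier \<Omega>\<close>
      even where \<open>K\<close> does not reach the boundary.\<close>
    define \<theta> where "\<theta> x = 1 + (- 1) * b x" for x
    have sm: "smooth b" by (rule test_function_smooth[OF b(1)])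
    have sm\<theta>: "smooth \<theta>"
      using sm unfolding \<theta>_def smooth_def by (intro allI C_k_add C_k_mult C_k_const) simp_all
    have grad: "grad \<theta> x = - grad b x" for x
    proof -
      have "(\<theta> has_derivative (\<lambda>h. - frechet_derivative b (at x) h)) (at x)"
        unfolding \<theta>_def using smooth_has_derivative[OF sm, of x] by (auto intro!: derivative_eq_intros)
      from frechet_derivative_at[OF this, symmetric] show ?thesis by (simp add: grad_def vec_eq_iff)
    qed
    obtain T where T: "compact T" "\<forall>x. x \<notin> T \<longrightarrow> b x = 0"
      using test_function_support[OF b(1)] by (elim exE conjE)
    obtain C1 where C1: "C1 \<ge> 0" "\<forall>x. norm (b x) \<le> C1"
      using bounded_continuous_compact_support[OF smooth_continuous_on[OF sm] T] by (elim exE conjE)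
    obtain C2 where C2: "C2 \<ge> 0" "\<forall>x. norm (grad b x) \<le> C2"
      using bounded_continuous_compact_support[OF continuous_on_grad[OF sm] T(1)]
        grad_zero_outside[OF compact_imp_closed[OF T(1)] T(2)] by (meson)
    define C where "C = 1 + C1 + C2"
    have C: "\<bar>\<theta> x\<bar> \<le> C" "norm (grad \<theta> x) \<le> C" for x
      using C1(1) C2(1) C1(2)[rule_format, of x] C2(2)[rule_format, of x] by (auto simp: \<theta>_def C_def grad)
    have one: "\<theta> x = 1" "grad \<theta> x = 0" if "x \<notin> \<Omega> - K" for x
      using test_function_zero_outside[OF b(1) that] grad_test_function_zero_outside[OF b(1) that]
      by (simp_all add: \<theta>_def grad)
    have zM: "\<theta> x = 0" if "x \<in> M" for x using b(4)[OF that] by (simp add: \<theta>_def)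
    have zD: "\<theta> x = 0" "grad \<theta> x = 0" if "x \<in> D" for x
      using that b(2,3) zM grad_zero_outside[of "- M" \<theta> x] by (auto simp: closed_Compl)
    have FM: "\<Omega> - F \<subseteq> M" using b(3) unfolding F_def by blast
    have FD: "x \<in> D" if "x \<in> \<Omega> - F" for x using that unfolding F_def by blast
    define \<phi>' where "\<phi>' x = \<theta> x *\<^sub>R \<phi> x" for x
    define D\<phi>' where "D\<phi>' x = \<theta> x *\<^sub>R D\<phi> x + outer_product (\<phi> x) (grad \<theta> x)" for x
    have lF: "H1 F \<phi> D\<phi>" "has_trace F S \<phi> D\<phi> \<psi>" "has_trace F (frontier F - S) \<phi> D\<phi> (\<lambda>_. 0)"
      using lift unfolding is_lifting_def by simp_all
    have LF: "L2 F \<phi>" "L2 F D\<phi>" using lF(1) unfolding H1_def by simp_all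
    have H1_ext: "H1 \<Omega> (\<lambda>x. \<theta> x *\<^sub>R w x) (\<lambda>x. \<theta> x *\<^sub>R Dw x + outer_product (w x) (grad \<theta> x))"
      if "H1 F w Dw" for w Dw
      by (rule H1_cutoff[OF F \<Omega> sm\<theta> C b(2) FM zM that])
    have trace_ext: "has_trace \<Omega> R \<phi>' D\<phi>' h"
      if R: "R \<in> sets borel" "R \<subseteq> frontier \<Omega>" and h: "has_trace F R \<phi> D\<phi> h" for R h
      unfolding \<phi>'_def D\<phi>'_def
    proof (rule has_trace_multiplier[OF F(2) R(1) _ h LF C(1,2,1) _ _ H1_ext])
      show "R \<subseteq> closure F" using R(2) frF by blast
      show "square_integrable_on surface_measure R h" using h unfolding has_trace_def by (rule conjunct1)
      show "h x = \<theta> x *\<^sub>R h x" if "x \<in> R" for x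
      proof -
        have "x \<notin> \<Omega> - K" using that R(2) frD by blast
        then show ?thesis using one(1) by simp
      qed
      show "continuous_on (closure \<Omega>) (\<lambda>x. \<theta> x *\<^sub>R w x)" if "continuous_on (closure F) w" for w :: "real^'n \<Rightarrow> real^'n"
        unfolding clF
      proof (rule continuous_on_closed_Un)
        show "continuous_on (closure F) (\<lambda>x. \<theta> x *\<^sub>R w x)"
          by (rule continuous_on_scaleR[OF smooth_continuous_on[OF sm\<theta>] that])
        show "continuous_on D (\<lambda>x. \<theta> x *\<^sub>R w x)"
          using zD(1) by (auto intro: continuous_on_eq[OF continuous_on_const[of D 0]])
      qed (simp_all add: compact_imp_closed D(1))
    qed (use zD FD in blast)+
    have lift': "is_lifting \<Omega> S \<psi> \<phi>' D\<phi>'"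
      unfolding is_lifting_def
    proof (intro conjI)
      show "H1 \<Omega> \<phi>' D\<phi>'" unfolding \<phi>'_def D\<phi>'_def by (rule H1_ext[OF lF(1)])
      show "has_trace \<Omega> S \<phi>' D\<phi>' \<psi>" by (rule trace_ext[OF S(2,1) lF(2)])
      have R: "frontier \<Omega> - S \<in> sets borel" using S(2) by (intro sets.Diff) simp_all
      show "has_trace \<Omega> (frontier \<Omega> - S) \<phi>' D\<phi>' (\<lambda>_. 0)"
        using frFF by (intro trace_ext R has_trace_subset[OF lF(3) _ R]) auto
    qed
    have ae': "AE x in lebesgue. x \<in> \<Omega> - K \<longrightarrow> \<phi>' x = 0 \<and> D\<phi>' x = 0"
      using ae
    proof (rule AE_mp, intro AE_I2 impI)
      fix x assume *: "x \<in> F - K \<longrightarrow> \<phi> x = 0 \<and> D\<phi> x = 0" "x \<in> \<Omega> - K"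
      show "\<phi>' x = 0 \<and> D\<phi>' x = 0"
      proof (cases "x \<in> F")
        case True then show ?thesis using * by (simp add: \<phi>'_def D\<phi>'_def)
      next
        case False then show ?thesis using * FD[of x] zD[of x] by (simp add: \<phi>'_def D\<phi>'_def)
      qed
    qed
    have "l \<psi> = (LINT x:\<Omega> \<inter> V|lebesgue. \<tau> x \<bullet> D\<phi>' x + d x \<bullet> \<phi>' x)"
      by (rule normal_trace_near_green[OF t K lift' ae'])
    also have "\<dots> = (LINT x:\<Omega> \<inter> V|lebesgue. \<tau> x \<bullet> D\<phi> x + d x \<bullet> \<phi> x)"
      unfolding set_lebesgue_integral_def
    proof (rule integral_cong_AE)
      have "set_integrable lebesgue (\<Omega> \<inter> V) (\<lambda>x. \<tau> x \<bullet> D\<phi>' x + d x \<bullet> \<phi>' x)"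
        by (rule set_integrable_green[OF N(3,4) is_lifting_L2[OF lift' oV Int_lower1]])
      then show "(\<lambda>x. indicat_real (\<Omega> \<inter> V) x *\<^sub>R (\<tau> x \<bullet> D\<phi>' x + d x \<bullet> \<phi>' x)) \<in> borel_measurable lebesgue"
        unfolding set_integrable_def by (rule borel_measurable_integrable)
      have "set_integrable lebesgue (\<Omega> \<inter> V) (\<lambda>x. \<tau> x \<bullet> D\<phi> x + d x \<bullet> \<phi> x)"
        using FV by (intro set_integrable_green N(3,4) is_lifting_L2[OF lift oV]) blast+
      then show "(\<lambda>x. indicat_real (\<Omega> \<inter> V) x *\<^sub>R (\<tau> x \<bullet> D\<phi> x + d x \<bullet> \<phi> x)) \<in> borel_measurable lebesgue"
        unfolding set_integrable_def by (rule borel_measurable_integrable)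
      show "AE x in lebesgue. indicat_real (\<Omega> \<inter> V) x *\<^sub>R (\<tau> x \<bullet> D\<phi>' x + d x \<bullet> \<phi>' x) =
          indicat_real (\<Omega> \<inter> V) x *\<^sub>R (\<tau> x \<bullet> D\<phi> x + d x \<bullet> \<phi> x)"
        using ae
      proof (rule AE_mp, intro AE_I2 impI)
        fix x assume *: "x \<in> F - K \<longrightarrow> \<phi> x = 0 \<and> D\<phi> x = 0"
        show "indicat_real (\<Omega> \<inter> V) x *\<^sub>R (\<tau> x \<bullet> D\<phi>' x + d x \<bullet> \<phi>' x) =
          indicat_real (\<Omega> \<inter> V) x *\<^sub>R (\<tau> x \<bullet> D\<phi> x + d x \<bullet> \<phi> x)"
        proof (cases "x \<in> K")
          case True
          then show ?thesis using one[of x] by (simp add: \<phi>'_def D\<phi>'_def)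
        next
          case False
          show ?thesis
          proof (cases "x \<in> \<Omega> \<inter> V")
            case True
            then have "x \<in> F - K" using FV False by blast
            then show ?thesis using * by (simp add: \<phi>'_def D\<phi>'_def)
          qed simp
        qed
      qed
    qed
    finally show "l \<psi> = (LINT x:F \<inter> V|lebesgue. \<tau> x \<bullet> D\<phi> x + d x \<bullet> \<phi> x)"
      unfolding FV .
  qed (simp_all only: FV N)
  then show ?thesis unfolding has_normal_trace_iff F_def by blast
qed


section \<open>Geometry of smooth interfaces\<close>

lemma frechet_derivative_eq_grad_inner:
  assumes "smooth \<rho>"
  shows "frechet_derivative \<rho> (at x) h = grad \<rho> x \<bullet> h"
proof -
  have lin: "linear (frechet_derivative \<rho> (at x))"
    by (rule has_derivative_linear[OF smooth_has_derivative[OF assms]])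
  have "frechet_derivative \<rho> (at x) h = frechet_derivative \<rho> (at x) (\<Sum>j\<in>UNIV. h $ j *\<^sub>R axis j 1)"
    by (simp add: basis_expansion flip: scalar_mult_eq_scaleR)
  also have "\<dots> = (\<Sum>j\<in>UNIV. h $ j * frechet_derivative \<rho> (at x) (axis j 1))"
    by (simp add: linear_sum[OF lin] linear_scale[OF lin])
  also have "\<dots> = grad \<rho> x \<bullet> h"
    by (simp add: inner_vec_def grad_def mult.commute)
  finally show ?thesis .
qed

lemma mean_value_grad:
  assumes "smooth \<rho>" "convex S" "y \<in> S" "w \<in> S"
  shows "\<exists>z\<in>S. \<rho> w - \<rho> y = grad \<rho> z \<bullet> (w - y)"
proof -
  have "((\<lambda>t. \<rho> (y + t *\<^sub>R (w - y))) has_real_derivative grad \<rho> (y + t *\<^sub>R (w - y)) \<bullet> (w - y)) (at t)" for t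
  proof -
    have "((\<lambda>t. y + t *\<^sub>R (w - y)) has_derivative (\<lambda>s. s *\<^sub>R (w - y))) (at t)"
      by (auto intro!: derivative_eq_intros)
    from has_derivative_compose[OF this smooth_has_derivative[OF assms(1)]] show ?thesis
      by (simp add: has_field_derivative_def frechet_derivative_eq_grad_inner[OF assms(1)] mult_commute_abs)
  qed
  then obtain t where t: "0 < t" "t < 1"
      "\<rho> (y + 1 *\<^sub>R (w - y)) - \<rho> (y + 0 *\<^sub>R (w - y)) = (1 - 0) * (grad \<rho> (y + t *\<^sub>R (w - y)) \<bullet> (w - y))"
    using MVT2[of 0 1 "\<lambda>t. \<rho> (y + t *\<^sub>R (w - y))" "\<lambda>t. grad \<rho> (y + t *\<^sub>R (w - y)) \<bullet> (w - y)"]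
    by auto
  have "(1 - t) *\<^sub>R y + t *\<^sub>R w \<in> S" using t(1,2) by (intro convexD[OF assms(2-4)]) auto
  moreover have "(1 - t) *\<^sub>R y + t *\<^sub>R w = y + t *\<^sub>R (w - y)" by (simp add: algebra_simps)
  ultimately show ?thesis using t(3) by (intro bexI[of _ "y + t *\<^sub>R (w - y)"]) auto
qed

text \<open>Near the boundary point \<open>x\<close> the gradient of the defining function \<open>\<rho>\<close> is close to its nonzero value \<open>g\<close>
  at \<open>x\<close>, so that \<open>\<rho>\<close> is Lipschitz there and increases at a definite rate in the direction of \<open>g\<close>.\<close>

lemma smooth_boundary_local:
  assumes "smooth_boundary U" "x \<in> frontier U"
  obtains \<rho> g r c L where "continuous_on UNIV \<rho>" "0 < r" "0 < c" "0 \<le> L" "g \<noteq> 0"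
    "\<And>y. y \<in> ball x r \<Longrightarrow> y \<in> U \<longleftrightarrow> \<rho> y < 0"
    "\<And>y t. 0 \<le> t \<Longrightarrow> y \<in> ball x r \<Longrightarrow> y + t *\<^sub>R g \<in> ball x r \<Longrightarrow> \<rho> y + t * c \<le> \<rho> (y + t *\<^sub>R g)"
    "\<And>y w. y \<in> ball x r \<Longrightarrow> w \<in> ball x r \<Longrightarrow> \<rho> w \<le> \<rho> y + L * dist w y"
proof -
  obtain \<rho> where "defining_function U x \<rho>" using assms unfolding smooth_boundary_def by blast
  then obtain r1 where \<rho>: "smooth \<rho>" "grad \<rho> x \<noteq> 0" and r1: "0 < r1" "\<forall>y\<in>ball x r1. y \<in> U \<longleftrightarrow> \<rho> y < 0"
    unfolding defining_function_def by blast
  define g where "g = grad \<rho> x"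
  define e where "e = norm g / 2"
  have e: "0 < e" using \<rho>(2) by (simp add: e_def g_def)
  have "isCont (grad \<rho>) x" using continuous_on_grad[OF \<rho>(1)] by (simp add: continuous_on_eq_continuous_at)
  then obtain r2 where r2: "0 < r2" "\<forall>y. dist y x < r2 \<longrightarrow> dist (grad \<rho> y) g < e"
    using e unfolding continuous_at_eps_delta g_def by meson
  define r where "r = min r1 r2"
  have near: "norm (grad \<rho> y - g) < e" if "y \<in> ball x r" for y
  proof -
    have "dist y x < r2" using that by (simp add: r_def dist_commute)
    from r2(2)[rule_format, OF this] show ?thesis by (simp add: dist_norm)
  qed
  show thesis
  proof (rule that[of \<rho> r "(norm g)\<^sup>2 / 2" "norm g + e" g])
    show "continuous_on UNIV \<rho>" by (rule smooth_continuous_on[OF \<rho>(1)])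
    show "0 < r" using r1(1) r2(1) by (simp add: r_def)
    show "0 < (norm g)\<^sup>2 / 2" "0 \<le> norm g + e" "g \<noteq> 0" using \<rho>(2) e by (simp_all add: g_def)
    show "y \<in> U \<longleftrightarrow> \<rho> y < 0" if "y \<in> ball x r" for y using that r1(2) unfolding r_def by auto
    show "\<rho> y + t * ((norm g)\<^sup>2 / 2) \<le> \<rho> (y + t *\<^sub>R g)"
      if yt: "0 \<le> t" "y \<in> ball x r" "y + t *\<^sub>R g \<in> ball x r" for y t
    proof -
      obtain z where z: "z \<in> ball x r" "\<rho> (y + t *\<^sub>R g) - \<rho> y = grad \<rho> z \<bullet> (y + t *\<^sub>R g - y)"
        using mean_value_grad[OF \<rho>(1) convex_ball yt(2,3)] by blast
      have "- ((grad \<rho> z - g) \<bullet> g) \<le> norm (grad \<rho> z - g) * norm g"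
        using norm_cauchy_schwarz[of "g - grad \<rho> z" g] by (simp add: norm_minus_commute inner_diff_left)
      also have "\<dots> \<le> e * norm g" using near[OF z(1)] by (intro mult_right_mono) auto
      also have "\<dots> = (norm g)\<^sup>2 / 2" by (simp add: e_def power2_eq_square)
      finally have "(norm g)\<^sup>2 / 2 \<le> grad \<rho> z \<bullet> g" by (simp add: inner_diff_left power2_norm_eq_inner)
      then have "t * ((norm g)\<^sup>2 / 2) \<le> t * (grad \<rho> z \<bullet> g)" using yt(1) by (rule mult_left_mono)
      then show ?thesis using z(2) by simp
    qed
    show "\<rho> w \<le> \<rho> y + (norm g + e) * dist w y" if yw: "y \<in> ball x r" "w \<in> ball x r" for y w
    proof -
      obtain z where z: "z \<in> ball x r" "\<rho> w - \<rho> y = grad \<rho> z \<bullet> (w - y)"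
        using mean_value_grad[OF \<rho>(1) convex_ball yw] by blast
      have "norm (grad \<rho> z) \<le> norm g + e" using near[OF z(1)] norm_triangle_ineq2[of "grad \<rho> z" g] by linarith
      then have "norm (grad \<rho> z) * norm (w - y) \<le> (norm g + e) * norm (w - y)" by (rule mult_right_mono) simp
      then show ?thesis using z(2) norm_cauchy_schwarz[of "grad \<rho> z" "w - y"] by (simp add: dist_norm)
    qed
  qed
qed

text \<open>The defining function is nonnegative at a boundary point and increases strictly along its gradient,
  which therefore leads out of \<open>closure U\<close> at once: the set lies on one side of its boundary only.\<close>

lemma smooth_boundary_frontier_subset_closure_exterior:
  assumes "open U" "smooth_boundary U"
  shows "frontier U \<subseteq> closure (- closure U)"
proof
  fix x assume x: "x \<in> frontier U"
  show "x \<in> closure (- closure U)"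
  proof (rule smooth_boundary_local[OF assms(2) x])
    fix \<rho> g r c L
    assume \<rho>: "continuous_on UNIV \<rho>" "0 < r" "0 < c" "0 \<le> L" "g \<noteq> 0"
      "\<And>y. y \<in> ball x r \<Longrightarrow> y \<in> U \<longleftrightarrow> \<rho> y < 0"
      "\<And>y t. 0 \<le> t \<Longrightarrow> y \<in> ball x r \<Longrightarrow> y + t *\<^sub>R g \<in> ball x r \<Longrightarrow> \<rho> y + t * c \<le> \<rho> (y + t *\<^sub>R g)"
    have "x \<notin> U" using x assms(1) frontier_disjoint_eq by blast
    then have \<rho>x: "0 \<le> \<rho> x" using \<rho>(2) \<rho>(6)[of x] by simp
    show "x \<in> closure (- closure U)"
      unfolding closure_approachable
    proof (intro allI impI)
      fix e :: real assume e: "0 < e"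
      define t where "t = min e r / (2 * norm g)"
      have t: "0 < t" using e \<rho>(2,5) by (simp add: t_def)
      have d: "dist (x + t *\<^sub>R g) x = min e r / 2" using e \<rho>(2,5) by (simp add: dist_norm t_def)
      have b: "x + t *\<^sub>R g \<in> ball x r" using d e \<rho>(2) by (simp add: dist_commute)
      have "0 < t * c" using t \<rho>(3) by simp
      then have pos: "0 < \<rho> (x + t *\<^sub>R g)" using \<rho>(7)[of t x] \<rho>x t b \<rho>(2) by simp
      define W where "W = ball x r \<inter> \<rho> -` {0<..}"
      have "open W" unfolding W_def using \<rho>(1) by (intro open_Int open_vimage) simp_all
      moreover have "W \<inter> U = {}" unfolding W_def using \<rho>(6) by force
      ultimately have "W \<inter> closure U = {}" by (simp add: open_Int_closure_eq_empty)
      moreover have "x + t *\<^sub>R g \<in> W" using b pos by (simp add: W_def)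
      ultimately have "x + t *\<^sub>R g \<in> - closure U" by blast
      then show "\<exists>y\<in>- closure U. dist y x < e"
        using d e by (intro bexI[of _ "x + t *\<^sub>R g"]) auto
    qed
  qed
qed

text \<open>Two points of \<open>U\<close> close to a boundary point are joined inside \<open>U\<close> by pushing both into \<open>U\<close>, against
  the direction \<open>g\<close> of increase, far enough that the segment between the shifted points lies in \<open>U\<close>.\<close>

lemma smooth_boundary_locally_connected:
  assumes "smooth_boundary U" "x \<in> frontier U"
  shows "\<exists>\<delta>>0. \<forall>y \<in> U \<inter> ball x \<delta>. \<forall>z \<in> U \<inter> ball x \<delta>. connected_component U y z"
proof (rule smooth_boundary_local[OF assms])
  fix \<rho> g r c L
  assume "continuous_on UNIV \<rho>" "g \<noteq> 0" and \<rho>: "0 < r" "0 < c" "0 \<le> L"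
    "\<And>y. y \<in> ball x r \<Longrightarrow> y \<in> U \<longleftrightarrow> \<rho> y < 0"
    "\<And>y t. 0 \<le> t \<Longrightarrow> y \<in> ball x r \<Longrightarrow> y + t *\<^sub>R g \<in> ball x r \<Longrightarrow> \<rho> y + t * c \<le> \<rho> (y + t *\<^sub>R g)"
    "\<And>y w. y \<in> ball x r \<Longrightarrow> w \<in> ball x r \<Longrightarrow> \<rho> w \<le> \<rho> y + L * dist w y"
  \<comment> \<open>Within the ball of radius \<open>\<delta>\<close> the defining function varies by at most \<open>L (2 \<delta>)\<close>; a shift by \<open>- T g\<close>
    lowers it by at least \<open>T c\<close>, which is the same amount.  The radius \<open>\<delta>\<close> is chosen such that shifted
    points stay in the ball of radius \<open>r = \<delta> + T |g|\<close>.\<close>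
  define q where "q = 1 + 2 * L * norm g / c"
  define \<delta> where "\<delta> = r / q"
  define T where "T = 2 * L * \<delta> / c"
  have q: "1 \<le> q" using \<rho>(2,3) by (simp add: q_def)
  have \<delta>: "0 < \<delta>" using \<rho>(1) q by (simp add: \<delta>_def)
  have T: "0 \<le> T" using \<delta> \<rho>(2,3) by (simp add: T_def)
  have Tc: "T * c = L * (2 * \<delta>)" using \<rho>(2) by (simp add: T_def)
  have "\<delta> + T * norm g = \<delta> * q" by (simp add: T_def q_def algebra_simps)
  also have "\<dots> = r" using q by (simp add: \<delta>_def)
  finally have sum: "\<delta> + T * norm g = r" .
  have shift: "y - t *\<^sub>R g \<in> ball x r" if "y \<in> ball x \<delta>" "0 \<le> t" "t \<le> T" for y t
  proof -
    have "dist x (y - t *\<^sub>R g) \<le> dist x y + norm (t *\<^sub>R g)"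
      using norm_triangle_ineq[of "x - y" "t *\<^sub>R g"] by (simp add: dist_norm algebra_simps)
    also have "\<dots> < \<delta> + T * norm g"
      using that by (intro add_less_le_mono) (auto intro: mult_right_mono)
    finally show ?thesis using sum by simp
  qed
  have down: "\<rho> (y - t *\<^sub>R g) + t * c \<le> \<rho> y" if "y \<in> ball x \<delta>" "0 \<le> t" "t \<le> T" for y t
    using \<rho>(5)[of t "y - t *\<^sub>R g"] shift[OF that] shift[of y 0] that T by simp
  have vert: "connected_component U y (y - T *\<^sub>R g)" if y: "y \<in> U \<inter> ball x \<delta>" for y
    unfolding connected_component_def
  proof (intro exI conjI)
    show "connected (closed_segment y (y - T *\<^sub>R g))" by simp
    show "closed_segment y (y - T *\<^sub>R g) \<subseteq> U"
    proof
      fix w assume "w \<in> closed_segment y (y - T *\<^sub>R g)"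
      then obtain s where s: "0 \<le> s" "s \<le> 1" "w = (1 - s) *\<^sub>R y + s *\<^sub>R (y - T *\<^sub>R g)" by (auto simp: in_segment)
      then have w: "w = y - (s * T) *\<^sub>R g" by (simp add: algebra_simps)
      have sT: "0 \<le> s * T" "s * T \<le> T" using s T by (simp_all add: mult_left_le_one_le)
      have "\<rho> y < 0" using y \<rho>(4)[of y] shift[of y 0] T by simp
      moreover have "\<rho> w + s * T * c \<le> \<rho> y" unfolding w using down[of y "s * T"] y sT by simp
      moreover have "0 \<le> s * T * c" using sT \<rho>(2) by simp
      ultimately have "\<rho> w < 0" by linarith
      moreover have "w \<in> ball x r" unfolding w using y sT by (intro shift) auto
      ultimately show "w \<in> U" using \<rho>(4) by blast
    qed
  qed simp_all
  have horiz: "connected_component U (y - T *\<^sub>R g) (z - T *\<^sub>R g)"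
    if y: "y \<in> U \<inter> ball x \<delta>" and z: "z \<in> U \<inter> ball x \<delta>" for y z
    unfolding connected_component_def
  proof (intro exI conjI)
    show "connected (closed_segment (y - T *\<^sub>R g) (z - T *\<^sub>R g))" by simp
    show "closed_segment (y - T *\<^sub>R g) (z - T *\<^sub>R g) \<subseteq> U"
    proof
      fix w assume "w \<in> closed_segment (y - T *\<^sub>R g) (z - T *\<^sub>R g)"
      then obtain s where s: "0 \<le> s" "s \<le> 1" "w = (1 - s) *\<^sub>R (y - T *\<^sub>R g) + s *\<^sub>R (z - T *\<^sub>R g)"
        by (auto simp: in_segment)
      define v where "v = (1 - s) *\<^sub>R y + s *\<^sub>R z"
      have w: "w = v - T *\<^sub>R g" using s(3) by (simp add: v_def algebra_simps)
      have v: "v \<in> ball x \<delta>"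
        unfolding v_def using y z s(1,2) by (intro convexD[OF convex_ball]) auto
      have "dist v y < 2 * \<delta>"
        using v y dist_triangle[of v y x] by (simp add: dist_commute)
      then have "L * dist v y \<le> L * (2 * \<delta>)" using \<rho>(3) by (intro mult_left_mono) auto
      moreover have "\<rho> v \<le> \<rho> y + L * dist v y"
        using \<rho>(6)[of y v] shift[of y 0] shift[of v 0] T y v by simp
      moreover have "\<rho> y < 0" using y \<rho>(4)[of y] shift[of y 0] T by simp
      moreover have "\<rho> w + T * c \<le> \<rho> v" unfolding w using down[OF v T] by simp
      ultimately have "\<rho> w < 0" using Tc by linarith
      moreover have "w \<in> ball x r" unfolding w by (rule shift[OF v T]) simp
      ultimately show "w \<in> U" using \<rho>(4) by blast
    qed
  qed simp_all
  have "connected_component U y z" if yz: "y \<in> U \<inter> ball x \<delta>" "z \<in> U \<inter> ball x \<delta>" for y z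
    by (rule connected_component_trans[OF vert[OF yz(1)] connected_component_trans[OF horiz[OF yz]
        connected_component_sym[OF vert[OF yz(2)]]]])
  then show ?thesis using \<delta> by (intro exI[of _ \<delta>]) simp
qed

lemma constant_on_components_connected_component:
  assumes "\<And>C. C \<in> components U \<Longrightarrow> m constant_on C" "connected_component U y z"
  shows "m y = m z"
proof -
  have y: "y \<in> U" using connected_component_in[OF assms(2)] by (rule conjunct1)
  then have "connected_component_set U y \<in> components U" by (rule componentsI)
  then have "m constant_on connected_component_set U y" by (rule assms(1))
  then show ?thesis using assms(2) y unfolding constant_on_def
    by (metis connected_component_refl mem_Collect_eq)
qed

lemma constant_on_components_locally_constant:
  fixes m :: "'a::real_normed_vector \<Rightarrow> 'b"
  assumes "open U" "\<And>C. C \<in> components U \<Longrightarrow> m constant_on C"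
  shows "locally_constant_on U m"
  unfolding locally_constant_on_def
proof
  fix x assume x: "x \<in> U"
  have "open (connected_component_set U x)" using assms(1) by (rule open_connected_component)
  moreover have "x \<in> connected_component_set U x" using x by simp
  ultimately have "\<forall>\<^sub>F y in nhds x. y \<in> connected_component_set U x" by (rule eventually_nhds_in_open)
  then have "\<forall>\<^sub>F y in nhds x. m y = m x"
    by (rule eventually_mono) (use constant_on_components_connected_component[OF assms(2)] in \<open>auto intro: sym\<close>)
  then show "\<forall>\<^sub>F y in at x within U. m y = m x"
    unfolding eventually_at_filter by (rule eventually_mono) simp
qed

lemma Lim_eventually_const_within:
  fixes m :: "'a::perfect_space \<Rightarrow> 'b::t2_space"
  assumes "x \<in> closure A" "x \<notin> A" "\<forall>\<^sub>F y in at x within A. m y = c"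
  shows "Lim (at x within A) m = c"
proof (rule tendsto_Lim)
  show "at x within A \<noteq> bot" using assms(1,2) by (simp add: trivial_limit_within closure_def)
  show "(m \<longlongrightarrow> c) (at x within A)" by (rule tendsto_eventually[OF assms(3)])
qed

text \<open>The part of \<open>B\<close> near a boundary point lies in a single component, so that \<open>\<mu>\<close> has one constant value there.  Hence the
  limit in the jump exists, and the jump continues \<open>\<mu>F - \<mu>\<close> to \<open>closure B\<close> without discontinuity.\<close>

lemma jump_extension_locally_constant:
  fixes B F :: "(real^'n::finite) set" and \<mu> :: "real^'n \<Rightarrow> real"
  assumes B: "open B" "smooth_boundary B" and F: "F \<inter> frontier B = {}" "frontier B \<subseteq> closure F"
    and \<mu>: "\<And>x. x \<in> F \<Longrightarrow> \<mu> x = \<mu>F" "\<And>C. C \<in> components B \<Longrightarrow> \<mu> constant_on C"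
  shows "locally_constant_on (closure B) (\<lambda>x. if x \<in> B then \<mu>F - \<mu> x else jump F B \<mu> x)" (is "locally_constant_on _ ?M")
  unfolding locally_constant_on_def
proof
  fix x assume x: "x \<in> closure B"
  show "\<forall>\<^sub>F y in at x within closure B. ?M y = ?M x"
  proof (cases "x \<in> B")
    case True
    have "\<forall>\<^sub>F y in at x. \<mu> y = \<mu> x"
      using constant_on_components_locally_constant[OF B(1) \<mu>(2)] True
      unfolding locally_constant_on_def at_within_open[OF True B(1), symmetric] by blast
    moreover have "\<forall>\<^sub>F y in at x. y \<in> B" by (rule eventually_at_in_open'[OF B(1) True])
    ultimately have "\<forall>\<^sub>F y in at x. ?M y = ?M x" by eventually_elim (simp add: True)
    then show ?thesis by (rule filter_leD[OF at_le[OF subset_UNIV]])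
  next
    case False
    then have xf: "x \<in> frontier B" using x B(1) by (simp add: frontier_def interior_open)
    obtain \<delta> where \<delta>: "0 < \<delta>" "\<forall>y \<in> B \<inter> ball x \<delta>. \<forall>z \<in> B \<inter> ball x \<delta>. connected_component B y z"
      using smooth_boundary_locally_connected[OF B(2) xf] by (elim exE conjE)
    obtain y0 where y0: "y0 \<in> B" "dist y0 x < \<delta>" using x \<delta>(1) unfolding closure_approachable by blast
    have const: "\<mu> y = \<mu> y0" if "y \<in> B \<inter> ball x \<delta>" for y
    proof (rule constant_on_components_connected_component[OF \<mu>(2)])
      show "connected_component B y y0" using \<delta>(2) that y0 by (simp add: dist_commute)
    qed
    have M: "?M y = \<mu>F - \<mu> y0" if y: "y \<in> closure B" "y \<in> ball x \<delta>" for y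
    proof (cases "y \<in> B")
      case True
      then show ?thesis using const y(2) by simp
    next
      case False
      then have yf: "y \<in> frontier B" using y(1) B(1) by (simp add: frontier_def interior_open)
      have "\<forall>\<^sub>F z in at y. z \<in> ball x \<delta>" using y(2) by (intro eventually_at_in_open') simp_all
      then have "\<forall>\<^sub>F z in at y within B. z \<in> ball x \<delta>" by (rule filter_leD[OF at_le[OF subset_UNIV]])
      moreover have "\<forall>\<^sub>F z in at y within B. z \<in> B" by (simp add: eventually_at_filter)
      ultimately have "\<forall>\<^sub>F z in at y within B. \<mu> z = \<mu> y0" by eventually_elim (rule const, blast)
      then have 1: "Lim (at y within B) \<mu> = \<mu> y0" using y(1) False by (intro Lim_eventually_const_within)
      have "\<forall>\<^sub>F z in at y within F. \<mu> z = \<mu>F" using \<mu>(1) by (simp add: eventually_at_filter)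
      then have 2: "Lim (at y within F) \<mu> = \<mu>F" using yf F by (intro Lim_eventually_const_within) auto
      show ?thesis using False 1 2 by (simp add: jump_def)
    qed
    have "\<forall>\<^sub>F y in at x. y \<in> ball x \<delta>" using \<delta>(1) by (intro eventually_at_in_open') simp_all
    then have "\<forall>\<^sub>F y in at x within closure B. y \<in> ball x \<delta>" by (rule filter_leD[OF at_le[OF subset_UNIV]])
    moreover have "\<forall>\<^sub>F y in at x within closure B. y \<in> closure B" by (simp add: eventually_at_filter)
    ultimately show ?thesis
    proof eventually_elim
      case (elim y)
      show ?case using M[OF elim(2,1)] M[OF x] \<delta>(1) by simp
    qed
  qed
qed

lemma bounded_linear_sym: "bounded_linear (\<lambda>X::real^'n::finite^'n. (1/2) *\<^sub>R (X + transpose X))"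
  by (rule linear_conv_bounded_linear[THEN iffD1], rule linearI) (simp_all add: transpose_def vec_eq_iff algebra_simps)

lemma L2_sym_grad: "L2 A Du \<Longrightarrow> L2 A (sym_grad Du)"
  unfolding sym_grad_def by (rule square_integrable_on_linear[OF _ bounded_linear_sym])

lemma L2_stress:
  assumes "L2 A Du" "L2 A p" "set_borel_measurable lebesgue A \<mu>" "\<And>x. x \<in> A \<Longrightarrow> \<bar>\<mu> x\<bar> \<le> C"
  shows "L2 A (stress \<mu> Du p)"
proof -
  have "L2 A (\<lambda>x. \<mu> x *\<^sub>R sym_grad Du x)"
    by (rule square_integrable_on_scaleR_bounded[OF L2_sym_grad[OF assms(1)] assms(3,4)])
  then have "L2 A (\<lambda>x. 2 *\<^sub>R (\<mu> x *\<^sub>R sym_grad Du x))"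
    by (rule square_integrable_on_linear[OF _ bounded_linear_scaleR_right])
  from square_integrable_on_diff[OF this square_integrable_on_linear[OF assms(2) bounded_linear_scaleR_left[of "mat 1"]]]
  show ?thesis by (simp add: stress_def[abs_def])
qed

text \<open>The viscous stress is bilinear in the viscosity and the velocity gradient; changing the viscosity of
  the droplet-free field from \<open>\<mu>\<close> to \<open>\<mu>F\<close> leaves the residual \<open>2 (\<mu>F - \<mu>) \<epsilon>(u\<^sub>0)\<close>.\<close>

lemma stress_diff:
  "stress \<mu> (\<lambda>x. Du x - Du0 x) (\<lambda>x. p x - p0 x) x =
     stress \<mu> Du p x + (- 1) *\<^sub>R stress (\<lambda>_. \<mu>F) Du0 p0 x + (2 * (\<mu>F - \<mu> x)) *\<^sub>R sym_grad Du0 x"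
proof -
  have eq: "sym_grad (\<lambda>x. Du x - Du0 x) x = sym_grad Du x - sym_grad Du0 x"
    using linear_diff[OF bounded_linear.linear[OF bounded_linear_sym], of "Du x" "Du0 x"] by (simp add: sym_grad_def)
  show ?thesis unfolding stress_def eq by (simp add: algebra_simps)
qed


section \<open>The equations for the error fields\<close>

lemma locally_constant_on_open_Un:
  assumes "open A" "open B" "locally_constant_on A m" "locally_constant_on B m"
  shows "locally_constant_on (A \<union> B) m"
  unfolding locally_constant_on_def
proof
  fix x assume "x \<in> A \<union> B"
  then have "\<forall>\<^sub>F y in at x. m y = m x"
    using assms unfolding locally_constant_on_def by (metis Un_iff at_within_open)
  then show "\<forall>\<^sub>F y in at x within A \<union> B. m y = m x" by (rule filter_leD[OF at_le[OF subset_UNIV]])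
qed

lemma locally_constant_on_compose:
  assumes "locally_constant_on A m"
  shows "locally_constant_on A (\<lambda>x. h (m x))"
  unfolding locally_constant_on_def
proof
  fix x assume "x \<in> A"
  then have "\<forall>\<^sub>F y in at x within A. m y = m x" using assms unfolding locally_constant_on_def by blast
  then show "\<forall>\<^sub>F y in at x within A. h (m y) = h (m x)" by (rule eventually_mono) simp
qed

lemma div_free_diff:
  assumes A: "open A" "A \<subseteq> \<Omega>" and u: "div_free A u" "L2 A u" and v: "div_free \<Omega> v" "L2 A v"
  shows "div_free A (\<lambda>x. u x - v x)"
  unfolding div_free_def
proof
  fix \<eta> :: "real^'a \<Rightarrow> real" assume \<eta>: "\<eta> \<in> test_functions A"
  have G: "L2 A (grad \<eta>)" using A(1) by (intro L2_grad_test_function[OF \<eta>]) simp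
  have "(LINT x:A|lebesgue. u x \<bullet> grad \<eta> x) = 0" using u(1) \<eta> unfolding div_free_def by blast
  moreover have "(LINT x:\<Omega>|lebesgue. v x \<bullet> grad \<eta> x) = 0"
    using v(1) test_functions_mono[OF \<eta> A(2)] unfolding div_free_def by blast
  moreover have "(LINT x:\<Omega>|lebesgue. v x \<bullet> grad \<eta> x) = (LINT x:A|lebesgue. v x \<bullet> grad \<eta> x)"
    using A(2) grad_test_function_zero_outside[OF \<eta>] by (intro set_integral_eq_zero_outside) auto
  ultimately show "(LINT x:A|lebesgue. (u x - v x) \<bullet> grad \<eta> x) = 0"
    using set_integral_diff(2)[OF set_integrable_inner_square_integrable[OF u(2) G] set_integrable_inner_square_integrable[OF v(2) G]]
    by (simp add: inner_diff_left)
qed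

lemma trace_jump_diff:
  assumes F: "open F" "frontier B \<subseteq> closure F" and B: "open B"
    and L: "\<And>A. A = F \<or> A = B \<Longrightarrow> L2 A u \<and> L2 A Du \<and> L2 A v \<and> L2 A Dv"
    and u: "trace_jump F B u Du j" and v: "trace_jump F B v Dv k"
  shows "trace_jump F B (\<lambda>x. u x - v x) (\<lambda>x. Du x - Dv x) (\<lambda>x. j x - k x)"
proof -
  obtain gF gB where g: "has_trace F (frontier B) u Du gF" "has_trace B (frontier B) u Du gB"
    "AE x in surface_measure. x \<in> frontier B \<longrightarrow> gF x - gB x = j x"
    using u unfolding trace_jump_def by (elim exE conjE)
  obtain hF hB where h: "has_trace F (frontier B) v Dv hF" "has_trace B (frontier B) v Dv hB"
    "AE x in surface_measure. x \<in> frontier B \<longrightarrow> hF x - hB x = k x"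
    using v unfolding trace_jump_def by (elim exE conjE)
  have fB: "frontier B \<subseteq> closure B" by (simp add: frontier_def)
  show ?thesis
    unfolding trace_jump_def
  proof (intro exI conjI)
    show "has_trace F (frontier B) (\<lambda>x. u x - v x) (\<lambda>x. Du x - Dv x) (\<lambda>x. gF x - hF x)"
      using L[of F] by (intro has_trace_diff F g h) simp_all
    show "has_trace B (frontier B) (\<lambda>x. u x - v x) (\<lambda>x. Du x - Dv x) (\<lambda>x. gB x - hB x)"
      using L[of B] by (intro has_trace_diff B fB g h) simp_all
    show "AE x in surface_measure. x \<in> frontier B \<longrightarrow> gF x - hF x - (gB x - hB x) = j x - k x"
      using g(3) h(3) by eventually_elim (simp add: algebra_simps)
  qed
qed

theorem proposition2p1:
  fixes \<Omega> \<Omega>B \<Omega>F \<Gamma> \<Gamma>D \<Gamma>N :: "(real^'n::finite) set"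
    and \<mu> \<gamma> p p0 :: "real^'n \<Rightarrow> real" and \<mu>F :: real
    and u u0 gD :: "real^'n \<Rightarrow> real^'n" and Du Du0 :: "real^'n \<Rightarrow> real^'n^'n"
    and f gN eps0_n :: "'n functional"
  assumes dim: "CARD('n) = 2 \<or> CARD('n) = 3"
    and Omega: "open \<Omega>" "connected \<Omega>" "\<Omega> \<noteq> {}" "bounded \<Omega>" "lipschitz_boundary \<Omega>"
    and droplets: "open \<Omega>B" "closure \<Omega>B \<subseteq> \<Omega>" "\<Omega>B \<noteq> {}" "finite (components \<Omega>B)" "smooth_boundary \<Omega>B"
    and regions: "\<Omega>F = \<Omega> - closure \<Omega>B" "\<Gamma> = frontier \<Omega>B"
    and boundary: "\<Gamma>D \<subseteq> frontier \<Omega>" "\<Gamma>D \<in> sets borel" "\<Gamma>N = frontier \<Omega> - \<Gamma>D"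
    and viscosity: "\<And>x. x \<in> \<Omega> \<Longrightarrow> \<mu> x > 0" "\<mu>F > 0" "\<And>x. x \<in> \<Omega>F \<Longrightarrow> \<mu> x = \<mu>F"
      "\<And>C. C \<in> components \<Omega>B \<Longrightarrow> \<mu> constant_on C"
    and tension: "\<And>C. C \<in> components \<Gamma> \<Longrightarrow> \<gamma> constant_on C"
    and data: "H_minus_one \<Omega> f" "gD \<in> H_half \<Omega> \<Gamma>D" "H_minus_half \<Omega> \<Gamma>N gN"
    and u: "stokes_interface_problem \<Omega> \<Omega>B \<Gamma>D \<mu> f (surface_tension \<Omega>B \<gamma>) gD gN u Du p"
    and u0: "stokes_problem \<Omega> \<Gamma>D \<mu>F f gD gN u0 Du0 p0"
    and u0_jump: "trace_jump \<Omega>F \<Omega>B u0 Du0 (\<lambda>_. 0)"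
    and u0_stress_jump: "normal_jump \<Omega>F \<Omega>B (stress (\<lambda>_. \<mu>F) Du0 p0) (\<lambda>_. 0)"
    and eps0_n: "has_normal_trace \<Omega>B \<Gamma> (sym_grad Du0) eps0_n"
  shows "stokes_interface_problem \<Omega> \<Omega>B \<Gamma>D \<mu>
           (distr_mult (\<lambda>x. 2 * (\<mu> x - \<mu>F)) (distr_div (\<Omega>B \<union> \<Omega>F) (sym_grad Du0)))
           (\<lambda>\<psi>. surface_tension \<Omega>B \<gamma> \<psi> - 2 * eps0_n (\<lambda>x. jump \<Omega>F \<Omega>B \<mu> x *\<^sub>R \<psi> x))
           (\<lambda>_. 0) (\<lambda>_. 0)
           (\<lambda>x. u x - u0 x) (\<lambda>x. Du x - Du0 x) (\<lambda>x. p x - p0 x)"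
proof -
  let ?A = "\<Omega>B \<union> \<Omega>F"
  let ?\<sigma> = "stress \<mu> Du p" and ?\<tau> = "stress (\<lambda>_. \<mu>F) Du0 p0"
  let ?\<sigma>v = "stress \<mu> (\<lambda>x. Du x - Du0 x) (\<lambda>x. p x - p0 x)"
  have U: "H1 \<Omega> u Du" "L2 \<Omega> p" "\<forall>\<phi> \<in> test_functions ?A. - distr_div ?A ?\<sigma> \<phi> = f \<phi>"
    "div_free ?A u" "trace_jump \<Omega>F \<Omega>B u Du (\<lambda>_. 0)" "normal_jump \<Omega>F \<Omega>B ?\<sigma> (surface_tension \<Omega>B \<gamma>)"
    "has_trace \<Omega> \<Gamma>D u Du gD" "has_normal_trace \<Omega>F \<Gamma>N ?\<sigma> gN"
    using u unfolding stokes_interface_problem_def Let_def regions(1)[symmetric] boundary(3)[symmetric]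
    by blast+
  have U0: "H1 \<Omega> u0 Du0" "L2 \<Omega> p0" "\<forall>\<phi> \<in> test_functions \<Omega>. - distr_div \<Omega> ?\<tau> \<phi> = f \<phi>"
    "div_free \<Omega> u0" "has_trace \<Omega> \<Gamma>D u0 Du0 gD" "has_normal_trace \<Omega> \<Gamma>N ?\<tau> gN"
    using u0 unfolding stokes_problem_def boundary(3)[symmetric] by blast+
  have oF: "open \<Omega>F" unfolding regions(1) using Omega(1) by (intro open_Diff) simp_all
  have oA: "open ?A" using oF droplets(1) by blast
  have B\<Omega>: "\<Omega>B \<subseteq> \<Omega>" using droplets(2) closure_subset by blast
  have F\<Omega>: "\<Omega>F \<subseteq> \<Omega>" unfolding regions(1) by blast
  have cB: "compact (closure \<Omega>B)"
    using bounded_subset[OF Omega(4) B\<Omega>] by (simp add: compact_closure)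
  have frF: "frontier \<Omega>B \<subseteq> closure \<Omega>F"
  proof
    fix x assume x: "x \<in> frontier \<Omega>B"
    have "x \<in> \<Omega>" using x droplets(2) by (auto simp: frontier_def)
    moreover have "x \<in> closure (- closure \<Omega>B)"
      using smooth_boundary_frontier_subset_closure_exterior[OF droplets(1,5)] x by blast
    ultimately have "x \<in> closure (\<Omega> \<inter> - closure \<Omega>B)"
      using open_Int_closure_subset[OF Omega(1)] by blast
    then show "x \<in> closure \<Omega>F" by (simp add: regions(1) Diff_eq)
  qed
  have FfrB: "\<Omega>F \<inter> frontier \<Omega>B = {}" unfolding regions(1) frontier_def by blast
  \<comment> \<open>\<open>m\<close> is \<open>- (\<mu> - \<mu>F)\<close> in the droplets, continued to the interface by the jump of \<open>\<mu>\<close>.\<close>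
  define m where "m x = (if x \<in> \<Omega>B then \<mu>F - \<mu> x else jump \<Omega>F \<Omega>B \<mu> x)" for x
  have lm: "locally_constant_on (closure \<Omega>B) m"
    unfolding m_def[abs_def] by (rule jump_extension_locally_constant[OF droplets(1,5) FfrB frF viscosity(3,4)])
  have mB: "m x = \<mu>F - \<mu> x" if "x \<in> \<Omega>B" for x using that by (simp add: m_def)
  have m\<Gamma>: "jump \<Omega>F \<Omega>B \<mu> x = m x" if "x \<in> frontier \<Omega>B" for x
    using that droplets(1) by (simp add: m_def frontier_def interior_open)
  have "compact (m ` closure \<Omega>B)"
    by (rule compact_continuous_image[OF locally_constant_on_continuous[OF lm] cB])
  then have "bounded (m ` closure \<Omega>B)" by (rule compact_imp_bounded)
  then obtain C where C: "\<forall>y \<in> m ` closure \<Omega>B. norm y \<le> C" unfolding bounded_iff by (elim exE)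
  have mC: "\<bar>m x\<bar> \<le> C" if "x \<in> closure \<Omega>B" for x using C that by auto
  have l\<mu>: "locally_constant_on ?A \<mu>"
  proof (rule locally_constant_on_open_Un[OF droplets(1) oF])
    show "locally_constant_on \<Omega>B \<mu>" by (rule constant_on_components_locally_constant[OF droplets(1) viscosity(4)])
    show "locally_constant_on \<Omega>F \<mu>"
      unfolding locally_constant_on_def using viscosity(3) by (simp add: eventually_at_filter)
  qed
  have \<mu>C: "\<bar>\<mu> x\<bar> \<le> \<mu>F + \<bar>C\<bar>" if "x \<in> ?A" for x
    using that
  proof
    assume x: "x \<in> \<Omega>B"
    then have "\<bar>m x\<bar> \<le> C" using mC[of x] closure_subset by blast
    then show ?thesis using mB[OF x] viscosity(2) by linarith
  qed (use viscosity(2,3) in simp)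
  have sub: "L2 \<Omega>' h" if "L2 \<Omega> h" "open \<Omega>'" "\<Omega>' \<subseteq> \<Omega>" for \<Omega>' and h :: "real^'n \<Rightarrow> 'b::euclidean_space"
    using that by (auto intro: square_integrable_on_subset)
  have L: "L2 \<Omega> u" "L2 \<Omega> Du" "L2 \<Omega> u0" "L2 \<Omega> Du0"
    using U(1) U0(1) unfolding H1_def by simp_all
  have A\<Omega>: "?A \<subseteq> \<Omega>" using B\<Omega> F\<Omega> by blast
  have meas: "set_borel_measurable lebesgue ?A \<mu>"
    using oA locally_constant_on_continuous[OF l\<mu>] by (intro set_borel_measurable_continuous_lebesgue) simp_all
  have L\<sigma>: "L2 ?A ?\<sigma>"
    by (rule L2_stress[OF sub[OF L(2) oA A\<Omega>] sub[OF U(2) oA A\<Omega>] meas \<mu>C])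
  have L\<sigma>0: "L2 ?A ?\<tau>"
    using oA by (intro L2_stress[OF sub[OF L(4) oA A\<Omega>] sub[OF U0(2) oA A\<Omega>], of _ "\<bar>\<mu>F\<bar>"]
        set_borel_measurable_continuous_lebesgue continuous_on_const) simp_all
  have Le: "L2 ?A (sym_grad Du0)" by (rule L2_sym_grad[OF sub[OF L(4) oA A\<Omega>]])
  have \<sigma>v: "?\<sigma>v x = ?\<sigma> x + (- 1) *\<^sub>R ?\<tau> x + (2 * (\<mu>F - \<mu> x)) *\<^sub>R sym_grad Du0 x" for x
    by (rule stress_diff)

  have "- distr_div ?A ?\<sigma>v \<phi> = distr_mult (\<lambda>x. 2 * (\<mu> x - \<mu>F)) (distr_div ?A (sym_grad Du0)) \<phi>"
    if \<phi>: "\<phi> \<in> test_functions ?A" for \<phi>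
  proof -
    let ?k = "\<lambda>x. 2 * (\<mu> x - \<mu>F)"
    have lk: "locally_constant_on ?A ?k" by (rule locally_constant_on_compose[OF l\<mu>])
    have Lk: "L2 ?A (\<lambda>x. ?k x *\<^sub>R sym_grad Du0 x)"
    proof (rule square_integrable_on_scaleR_bounded[OF Le])
      show "set_borel_measurable lebesgue ?A ?k"
        using oA locally_constant_on_continuous[OF lk] by (intro set_borel_measurable_continuous_lebesgue) simp_all
      show "\<bar>?k x\<bar> \<le> 2 * (2 * \<mu>F + \<bar>C\<bar>)" if "x \<in> ?A" for x
        using \<mu>C[OF that] viscosity(2) by (simp add: abs_le_iff)
    qed
    have eq: "?\<sigma>v = (\<lambda>x. (?\<sigma> x + (- 1) *\<^sub>R ?\<tau> x) + (- 1) *\<^sub>R (?k x *\<^sub>R sym_grad Du0 x))"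
      by (rule ext) (simp add: \<sigma>v algebra_simps)
    have "distr_div ?A ?\<sigma>v \<phi> = distr_div ?A ?\<sigma> \<phi> - distr_div ?A ?\<tau> \<phi> - distr_div ?A (sym_grad Du0) (\<lambda>x. ?k x *\<^sub>R \<phi> x)"
      unfolding eq
        distr_div_add_scaleR[OF oA \<phi> square_integrable_on_add[OF L\<sigma> square_integrable_on_linear[OF L\<sigma>0 bounded_linear_scaleR_right]] Lk]
        distr_div_add_scaleR[OF oA \<phi> L\<sigma> L\<sigma>0] distr_div_locally_constant_scaleR[OF oA lk \<phi>]
      by simp
    moreover have "- distr_div ?A ?\<sigma> \<phi> = f \<phi>" using U(3) \<phi> by blast
    moreover have "- distr_div ?A ?\<tau> \<phi> = f \<phi>"
      using U0(3) test_functions_mono[OF \<phi> A\<Omega>] distr_div_restrict[OF \<phi> A\<Omega>, of ?\<tau>] by fastforce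
    ultimately show ?thesis by (simp add: distr_mult_def)
  qed
  note bulk = this

  \<comment> \<open>The residual \<open>2 (\<mu>F - \<mu>) \<epsilon>(u\<^sub>0)\<close> vanishes on the side of the fluid, so that only the trace from the
    droplets sees it.\<close>
  have stressF: "?\<sigma> x + (- 1) *\<^sub>R ?\<tau> x = ?\<sigma>v x" if "x \<in> \<Omega>F" for x
    using viscosity(3)[OF that] by (simp add: \<sigma>v)
  have stressB: "?\<sigma> x + (- 1) *\<^sub>R ?\<tau> x + 2 *\<^sub>R (m x *\<^sub>R sym_grad Du0 x) = ?\<sigma>v x" if "x \<in> \<Omega>B" for x
    using mB[OF that] by (simp add: \<sigma>v)

  have normal: "normal_jump \<Omega>F \<Omega>B ?\<sigma>v
      (\<lambda>\<psi>. surface_tension \<Omega>B \<gamma> \<psi> - 2 * eps0_n (\<lambda>x. jump \<Omega>F \<Omega>B \<mu> x *\<^sub>R \<psi> x))"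
  proof -
    obtain lF lB where l: "has_normal_trace \<Omega>F (frontier \<Omega>B) ?\<sigma> lF" "has_normal_trace \<Omega>B (frontier \<Omega>B) ?\<sigma> lB"
      "\<forall>\<psi> \<in> H_half \<Omega>B (frontier \<Omega>B). - lF \<psi> - lB \<psi> = surface_tension \<Omega>B \<gamma> \<psi>"
      using U(6) unfolding normal_jump_def by (elim exE conjE)
    obtain kF kB where k: "has_normal_trace \<Omega>F (frontier \<Omega>B) ?\<tau> kF" "has_normal_trace \<Omega>B (frontier \<Omega>B) ?\<tau> kB"
      "\<forall>\<psi> \<in> H_half \<Omega>B (frontier \<Omega>B). - kF \<psi> - kB \<psi> = 0"
      using u0_stress_jump unfolding normal_jump_def by (elim exE conjE)
    have e: "has_normal_trace \<Omega>B (frontier \<Omega>B) (\<lambda>x. m x *\<^sub>R sym_grad Du0 x) (\<lambda>\<psi>. eps0_n (\<lambda>x. jump \<Omega>F \<Omega>B \<mu> x *\<^sub>R \<psi> x))"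
      by (rule has_normal_trace_locally_constant_scaleR[OF droplets(1) lm mC m\<Gamma> eps0_n[unfolded regions(2)]])
    show ?thesis
      unfolding normal_jump_def
    proof (intro exI conjI ballI)
      show "has_normal_trace \<Omega>F (frontier \<Omega>B) ?\<sigma>v (\<lambda>\<psi>. lF \<psi> + (- 1) * kF \<psi>)"
        by (rule has_normal_trace_cong[OF stressF has_normal_trace_add_scaleR[OF oF l(1) k(1)]])
      show "has_normal_trace \<Omega>B (frontier \<Omega>B) ?\<sigma>v
          (\<lambda>\<psi>. lB \<psi> + (- 1) * kB \<psi> + 2 * eps0_n (\<lambda>x. jump \<Omega>F \<Omega>B \<mu> x *\<^sub>R \<psi> x))"
        by (rule has_normal_trace_cong[OF stressB has_normal_trace_add_scaleR[OF droplets(1)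
              has_normal_trace_add_scaleR[OF droplets(1) l(2) k(2)] e]])
      fix \<psi> assume "\<psi> \<in> H_half \<Omega>B (frontier \<Omega>B)"
      then have "- lF \<psi> - lB \<psi> = surface_tension \<Omega>B \<gamma> \<psi>" "- kF \<psi> - kB \<psi> = 0" using l(3) k(3) by blast+
      then show "- (lF \<psi> + (- 1) * kF \<psi>) - (lB \<psi> + (- 1) * kB \<psi> + 2 * eps0_n (\<lambda>x. jump \<Omega>F \<Omega>B \<mu> x *\<^sub>R \<psi> x)) =
          surface_tension \<Omega>B \<gamma> \<psi> - 2 * eps0_n (\<lambda>x. jump \<Omega>F \<Omega>B \<mu> x *\<^sub>R \<psi> x)"
        by simp
    qed
  qed

  have neumann: "has_normal_trace \<Omega>F \<Gamma>N ?\<sigma>v (\<lambda>_. 0)"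
  proof -
    have "\<Gamma>N \<subseteq> frontier \<Omega>" "\<Gamma>N \<in> sets borel"
      unfolding boundary(3) using boundary(2) by (auto intro: sets.Diff)
    then have "has_normal_trace \<Omega>F \<Gamma>N ?\<tau> gN"
      unfolding regions(1) by (intro has_normal_trace_away_from_compact[OF Omega(1) cB droplets(2)] U0(6))
    from has_normal_trace_cong[OF stressF has_normal_trace_add_scaleR[OF oF U(8) this]] show ?thesis
      by simp
  qed

  have L2B: "L2 A u \<and> L2 A Du \<and> L2 A u0 \<and> L2 A Du0" if "A = \<Omega>F \<or> A = \<Omega>B" for A
    using that by (elim disjE) (simp_all add: L[THEN sub, OF oF F\<Omega>] L[THEN sub, OF droplets(1) B\<Omega>])
  have "trace_jump \<Omega>F \<Omega>B (\<lambda>x. u x - u0 x) (\<lambda>x. Du x - Du0 x) (\<lambda>_. 0)"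
    using trace_jump_diff[OF oF frF droplets(1) L2B U(5) u0_jump] by simp
  moreover have "has_trace \<Omega> \<Gamma>D (\<lambda>x. u x - u0 x) (\<lambda>x. Du x - Du0 x) (\<lambda>_. 0)"
  proof -
    have "\<Gamma>D \<subseteq> closure \<Omega>" using boundary(1) unfolding frontier_def by blast
    from has_trace_diff[OF Omega(1) boundary(2) this U(7) U0(5) L] show ?thesis by simp
  qed
  moreover have "div_free ?A (\<lambda>x. u x - u0 x)"
    by (rule div_free_diff[OF oA A\<Omega> U(4) sub[OF L(1) oA A\<Omega>] U0(4) sub[OF L(3) oA A\<Omega>]])
  ultimately show ?thesis
    unfolding stokes_interface_problem_def Let_def regions(1)[symmetric] boundary(3)[symmetric]
    using H1_diff[OF Omega(1) U(1) U0(1)] square_integrable_on_diff[OF U(2) U0(2)] bulk normal neumann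
    by (intro conjI ballI) assumption+
qed

end
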